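(* Let $A\in C^\omega(\mathbb{R}/\mathbb{Z},\mathbb{C}^{d\times d})$ and $\alpha\in\mathbb{R}/\mathbb{Z}$ be such that $L_1(\alpha,A)=-\infty$. Then the following hold. (i) There exists $U\in C^\omega(\mathbb{R}/\mathbb{Z},\mathrm{U}(d))$, with values in the unitary group $\mathrm{U}(d)$, such that $B(x):=U(x+\alpha)^{-1}A(x)U(x)$ is, for all $x$, upper triangular with zeroes on and below the diagonal. More precisely, if $p$ is the nilpotency degree of $(\alpha,A)$, then one can choose $U$ such that $B(x)$ is divided into $p\times p$ blocks (possibly of different sizes, the partition being independent of $x$ and the diagonal blocks being square) with the block structure $$B(x)=U(x+\alpha)^{-1}A(x)U(x)=\begin{pmatrix}\mathbf{0}&D_2(x)&\star&\star\\&\ddots&\ddots&\star\\&&\ddots&D_p(x)\\&&&\mathbf{0}\end{pmatrix},$$ i.e. all blocks on and below the block diagonal vanish. (ii) Assume additionally that for every $n\geq 1$, $\operatorname{rank}A_n(x)=r_n$ is constant in $x$. Then there exists $M\in C^\omega(\mathbb{R}/\mathbb{Z},\mathrm{GL}(d,\mathbb{C}))$ such that for all $x$ $$\mathcal{J}:=M(x+\alpha)^{-1}A(x)M(x)=\begin{pmatrix}J_1\\&\ddots\\&&J_m\end{pmatrix},$$ which is block diagonal and independent of $x$, where $m=\dim\ker A(x)$ and each $J_i$ is a square matrix (sizes may depend on $i$) of the form $$J_i=\begin{pmatrix}0&1\\&\ddots&\ddots\\&&\ddots&1\\&&&0\end{pmatrix}$$ with ones on the superdiagonal and zeroes elsew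here.
   Context: $C^\omega(\mathbb{R}/\mathbb{Z},Y)$ denotes real analytic (one-periodic) functions with values in $Y$. The one-frequency cocycle $(\alpha,A)$ is the linear cocycle over $f(x)=x+\alpha$ on $\mathbb{R}/\mathbb{Z}$ with Lebesgue (Haar) measure $\mu$; $\alpha$ may be rational or irrational. Iterates: $A_n(x)=A(x+(n-1)\alpha)\cdots A(x+\alpha)A(x)$ for $n\ge1$. Lyapunov exponents: with $\sigma_1(M)\ge\dots\ge\sigma_d(M)\ge0$ the singular values of $M$, $L_k(\alpha,A)=\lim_{n\to\infty}\frac1n\int_0^1\ln(\sigma_k(A_n(x)))\,dx\in[-\infty,\infty)$, with $\ln0=-\infty$. Nilpotency: $(\alpha,A)$ is nilpotent if for some finite $n$ one has $A_n(x)=\mathbf{0}$ for almost every $x$; the minimal such natural number is the nilpotency degree $p$. (For analytic cocycles with $L_1(\alpha,A)=-\infty$ the cocycle is nilpotent, so that $p$ is defined.) *)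

theory Defs
  imports
    "HOL-Analysis.Analysis"
    "Jordan_Normal_Form.Schur_Decomposition"
    "Jordan_Normal_Form.Jordan_Normal_Form"
    "Jordan_Normal_Form.Matrix_Kernel"
    "Jordan_Normal_Form.DL_Rank"
begin

section \<open>Analytic matrix functions on the circle\<close>

definition real_analytic :: "(real \<Rightarrow> complex) \<Rightarrow> bool" where
  "real_analytic f \<longleftrightarrow>
     (\<forall>x0. \<exists>r>0. \<exists>c :: nat \<Rightarrow> complex. \<forall>x. \<bar>x - x0\<bar> < r \<longrightarrow>
        (\<lambda>n. c n * complex_of_real (x - x0) ^ n) sums f x)"

text \<open>
  Functions on the circle \<open>\<real>/\<int>\<close> are 1-periodic functions on the real line, and an element of
  the circle (such as the frequency) is given by any real representative.
  The set \<open>Y\<close> is meant to consist of \<open>d \<times> d\<close> matrices.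
\<close>

definition analytic_circle :: "nat \<Rightarrow> complex mat set \<Rightarrow> (real \<Rightarrow> complex mat) set" where
  "analytic_circle d Y =
     {A. (\<forall>x. A x \<in> Y) \<and> (\<forall>x. A (x + 1) = A x) \<and>
         (\<forall>i<d. \<forall>j<d. real_analytic (\<lambda>x. A x $$ (i, j)))}"

definition unitary_group :: "nat \<Rightarrow> complex mat set" where
  "unitary_group d = {U \<in> carrier_mat d d. mat_adjoint U * U = 1\<^sub>m d \<and> U * mat_adjoint U = 1\<^sub>m d}"

definition general_linear_group :: "nat \<Rightarrow> complex mat set" where
  "general_linear_group d = {M \<in> carrier_mat d d. invertible_mat M}"

definition mat_inv :: "complex mat \<Rightarrow> complex mat" where
  "mat_inv M = the (mat_inverse M)"


section \<open>Iterates, Lyapunov exponents and nilpotency\<close>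

primrec iterate :: "nat \<Rightarrow> real \<Rightarrow> (real \<Rightarrow> complex mat) \<Rightarrow> nat \<Rightarrow> real \<Rightarrow> complex mat" where
  "iterate d \<alpha> A 0 x = 1\<^sub>m d"
| "iterate d \<alpha> A (Suc n) x = A (x + real n * \<alpha>) * iterate d \<alpha> A n x"

text \<open>
  The singular values are the square roots of the eigenvalues of \<open>M\<^sup>* M\<close> (which are
  nonnegative reals), listed with multiplicity in decreasing order.
\<close>

definition singular_values :: "complex mat \<Rightarrow> real list" where
  "singular_values M =
     rev (sorted_list_of_multiset
       (image_mset (\<lambda>z. sqrt (Re z)) (proots (char_poly (mat_adjoint M * M)))))"

definition sing_val :: "nat \<Rightarrow> complex mat \<Rightarrow> real" where
  "sing_val k M = singular_values M ! (k - 1)"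

text \<open>Only nonnegative arguments matter below.\<close>

definition ln_ext :: "real \<Rightarrow> ereal" where
  "ln_ext t = (if t = 0 then -\<infinity> else ereal (ln t))"

abbreviation circle_measure :: "real measure" where
  "circle_measure \<equiv> restrict_space lborel {0..1}"

text \<open>
  Integral of an extended-real function whose positive part has finite integral, computed as
  positive part minus negative part (\<open>e2ennreal\<close> truncates negative values to 0); the value
  is \<open>-\<infinity>\<close> if the negative part is not integrable.
\<close>

definition ereal_integral :: "real measure \<Rightarrow> (real \<Rightarrow> ereal) \<Rightarrow> ereal" where
  "ereal_integral M f =
     enn2ereal (\<integral>\<^sup>+ x. e2ennreal (f x) \<partial>M) - enn2ereal (\<integral>\<^sup>+ x. e2ennreal (- f x) \<partial>M)"

text \<open>The \<open>k\<close>-th Lyapunov exponent, \<open>1 \<le> k \<le> d\<close>, as a limit in the extended reals.\<close>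

definition has_lyapunov_exponent ::
    "nat \<Rightarrow> nat \<Rightarrow> real \<Rightarrow> (real \<Rightarrow> complex mat) \<Rightarrow> ereal \<Rightarrow> bool" where
  "has_lyapunov_exponent d k \<alpha> A L \<longleftrightarrow>
     (\<lambda>n. ereal (1 / real n) *
        ereal_integral circle_measure (\<lambda>x. ln_ext (sing_val k (iterate d \<alpha> A n x)))) \<longlonglongrightarrow> L"

text \<open>The least \<open>n \<ge> 1\<close> such that the \<open>n\<close>-th iterate vanishes almost everywhere.\<close>

definition nilpotency_degree :: "nat \<Rightarrow> real \<Rightarrow> (real \<Rightarrow> complex mat) \<Rightarrow> nat" where
  "nilpotency_degree d \<alpha> A =
     (LEAST n. n \<ge> 1 \<and> (AE x in circle_measure. iterate d \<alpha> A n x = 0\<^sub>m d d))"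


section \<open>Conjugation and block structure\<close>

definition conj_cocycle ::
    "real \<Rightarrow> (real \<Rightarrow> complex mat) \<Rightarrow> (real \<Rightarrow> complex mat) \<Rightarrow> real \<Rightarrow> complex mat" where
  "conj_cocycle \<alpha> A U x = mat_inv (U (x + \<alpha>)) * A x * U x"

definition strictly_upper_triangular :: "complex mat \<Rightarrow> bool" where
  "strictly_upper_triangular B \<longleftrightarrow> (\<forall>i<dim_row B. \<forall>j<dim_col B. j \<le> i \<longrightarrow> B $$ (i, j) = 0)"

text \<open>
  A list \<open>ns\<close> of positive numbers with sum \<open>d\<close> partitions the indices \<open>0, \<dots>, d - 1\<close> into
  consecutive intervals; \<open>block_range ns a\<close> is the interval number \<open>a\<close>, of length \<open>ns ! a\<close>.
\<close>

definition block_sizes :: "nat \<Rightarrow> nat list \<Rightarrow> bool" where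
  "block_sizes d ns \<longleftrightarrow> (\<forall>n\<in>set ns. n > 0) \<and> sum_list ns = d"

definition block_range :: "nat list \<Rightarrow> nat \<Rightarrow> nat set" where
  "block_range ns a = {sum_list (take a ns) ..< sum_list (take (Suc a) ns)}"

definition strictly_block_upper_triangular :: "nat list \<Rightarrow> complex mat \<Rightarrow> bool" where
  "strictly_block_upper_triangular ns B \<longleftrightarrow>
     (\<forall>a<length ns. \<forall>b\<le>a. \<forall>i\<in>block_range ns a. \<forall>j\<in>block_range ns b. B $$ (i, j) = 0)"

end

theory Submission
  imports
    Defs
    "HOL-Complex_Analysis.Complex_Analysis"
    "Jordan_Normal_Form.Jordan_Normal_Form_Uniqueness"
begin

text \<open>
Real-analytic 1-periodic functions form an integral domain, the type \<open>circ\<close>, on which complex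
conjugation and translations act. An analytic cocycle is a square matrix over this domain. The
property of the domain behind everything else is \<open>unit_pair_proportional\<close>: any two elements
\<open>a\<close>, \<open>b\<close> are proportional to a pair \<open>s\<close>, \<open>t\<close> of elements with \<open>\<bar>s\<bar>\<^sup>2 + \<bar>t\<bar>\<^sup>2 = 1\<close>. Indeed a common
zero \<open>z\<close> can be divided out by \<open>e(x) - e(z)\<close>, where \<open>e(x) = exp (2 \<pi> \<i> x)\<close>, and a pair without
common zeros can be normalised. Hence there are analytic Givens rotations, every vector over the
domain is rotated into its first coordinate by an analytic unitary matrix, and the kernel of a
matrix \<open>A\<close> is split off by an analytic unitary \<open>N\<close> with \<open>A N = [0 | C]\<close> and \<open>C\<close> injective over the
domain (\<open>kernel_splitting\<close>). This yields global periodic frames without any bundle theory.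

With such an \<open>N\<close> as change of coordinates, \<open>A(x) N(x) = N(x + \<alpha>) [0 | G(x)]\<close> with \<open>G\<close> injective. The
lower square block \<open>L\<close> of \<open>G\<close> is again a cocycle, smaller than \<open>A\<close> unless \<open>A\<close> is injective over
the domain, and \<open>A\<^bsub>n+1\<^esub>\<close> becomes \<open>[0 | G(x + n\<alpha>) L\<^sub>n(x)]\<close>; so \<open>L\<close> reaches zero exactly one
step before \<open>A\<close> (\<open>itc_reduction_zero_iff\<close>). Three inductions use this reduction.

For a nilpotent cocycle the kernel of \<open>A\<close> is the first block of the triangular form and the flag of
\<open>L\<close> supplies the others; this is part (i), \<open>nilpotent_flag\<close>.

For an arbitrary cocycle the reduction ends with a block of size 0, and then the cocycle is
nilpotent, or with a block of size \<open>r \<ge> 1\<close> whose determinant \<open>c\<close> is a nonzero element of the domain.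
In the second case \<open>\<Prod>j<n. \<bar>c(x + j\<alpha>)\<bar>\<close> is at most a constant times \<open>\<parallel>A\<^sub>n(x)\<parallel>\<^sup>r\<close>, and \<open>ln \<bar>c\<bar>\<close> has an
integrable negative part, so that the first Lyapunov exponent is larger than \<open>-\<infinity>\<close>
(\<open>nilpotent_or_minorant\<close>, \<open>nilpotent_if_lyapunov_minus_infinity\<close>).

If the ranks of the iterates are constant, \<open>G\<close> is injective at every point and has an analytic left
inverse. A basis of Jordan chains for \<open>L\<close> is then prolonged to one for \<open>A\<close>: every chain gets one
more vector at the bottom, in the kernel of \<open>A\<close>, and the bottoms are completed to a basis of that
kernel by chains of length 1 (\<open>chain_basis_zcols\<close>). This is part (ii).
\<close>

unbundle no vec_syntax
no_notation fps_nth (infixl \<open>$\<close> 75)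
unbundle no inner_syntax
hide_const (open) Order.top

section \<open>Real-analytic functions on the line\<close>

text \<open>
Through local holomorphic extensions the closure of real-analytic functions under products,
quotients and square roots, and their behaviour at zeros, are inherited from complex analysis.
\<close>

lemma real_analytic_iff_extends:
  "real_analytic f \<longleftrightarrow>
     (\<forall>x0. \<exists>g. g analytic_on {complex_of_real x0} \<and>
               (\<forall>\<^sub>F x in nhds x0. f x = g (complex_of_real x)))"
proof
  assume f: "real_analytic f"
  show "\<forall>x0. \<exists>g. g analytic_on {complex_of_real x0} \<and>
               (\<forall>\<^sub>F x in nhds x0. f x = g (complex_of_real x))"
  proof
    fix x0
    obtain r c where r: "r > 0"
      and s: "\<And>x. \<bar>x - x0\<bar> < r \<Longrightarrow> (\<lambda>n. c n * complex_of_real (x - x0) ^ n) sums f x"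
      using f unfolding real_analytic_def by metis
    define g where "g w = (\<Sum>n. c n * (w - complex_of_real x0) ^ n)" for w
    have "(\<lambda>n. c n * (w - complex_of_real x0) ^ n) sums g w" if w: "w \<in> ball (complex_of_real x0)
        r" for w
    proof -
      obtain t where t: "norm (w - complex_of_real x0) < t" "t < r"
        using w dense by (metis dist_norm dist_commute mem_ball)
      have "summable (\<lambda>n. c n * complex_of_real t ^ n)"
        using s[of "x0 + t"] t norm_ge_zero[of "w - complex_of_real x0"]
        by (auto simp: sums_iff)
      hence "summable (\<lambda>n. c n * (w - complex_of_real x0) ^ n)"
        by (rule powser_inside) (use t in auto)
      thus ?thesis unfolding g_def by (simp add: summable_sums)
    qed
    hence "g holomorphic_on ball (complex_of_real x0) r" by (rule power_series_holomorphic)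
    hence "g analytic_on {complex_of_real x0}"
      using r by (auto simp: analytic_at intro!: exI[of _ "ball (complex_of_real x0) r"])
    moreover have "\<forall>\<^sub>F x in nhds x0. f x = g (complex_of_real x)"
      unfolding eventually_nhds_metric
    proof (intro exI[of _ r] conjI allI impI)
      fix x assume "dist x x0 < r"
      thus "f x = g (complex_of_real x)" using s[of x]
        by (auto simp: g_def dist_real_def sums_iff)
    qed (rule r)
    ultimately show "\<exists>g. g analytic_on {complex_of_real x0} \<and>
               (\<forall>\<^sub>F x in nhds x0. f x = g (complex_of_real x))" by blast
  qed
next
  assume R: "\<forall>x0. \<exists>g. g analytic_on {complex_of_real x0} \<and>
               (\<forall>\<^sub>F x in nhds x0. f x = g (complex_of_real x))"
  show "real_analytic f"
    unfolding real_analytic_def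
  proof
    fix x0
    obtain g where g: "g analytic_on {complex_of_real x0}"
      and e: "\<forall>\<^sub>F x in nhds x0. f x = g (complex_of_real x)" using R by blast
    obtain r1 where r1: "r1 > 0" "g holomorphic_on ball (complex_of_real x0) r1"
      using g by (auto simp: analytic_on_def)
    obtain r2 where r2: "r2 > 0" "\<And>x. dist x x0 < r2 \<Longrightarrow> f x = g (complex_of_real x)"
      using e unfolding eventually_nhds_metric by blast
    show "\<exists>r>0. \<exists>c. \<forall>x. \<bar>x - x0\<bar> < r \<longrightarrow> (\<lambda>n. c n * complex_of_real (x - x0) ^ n) sums f x"
    proof (intro exI[of _ "min r1 r2"] conjI
        exI[of _ "\<lambda>n. (deriv ^^ n) g (complex_of_real x0) / fact n"] allI impI)
      fix x assume x: "\<bar>x - x0\<bar> < min r1 r2"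
      have "complex_of_real x \<in> ball (complex_of_real x0) r1"
        using x by (auto simp: dist_norm norm_minus_commute simp flip: of_real_diff)
      from holomorphic_power_series[OF r1(2) this]
      show "(\<lambda>n. (deriv ^^ n) g (complex_of_real x0) / fact n * complex_of_real (x - x0) ^ n) sums f x"
        using r2(2)[of x] x by (simp add: dist_real_def)
    qed (use r1 r2 in auto)
  qed
qed

lemma real_analyticI:
  assumes "\<And>x0. \<exists>g. g analytic_on {complex_of_real x0} \<and>
               (\<forall>\<^sub>F x in nhds x0. f x = g (complex_of_real x))"
  shows "real_analytic f"
  using assms real_analytic_iff_extends by blast

lemma real_analyticD:
  assumes "real_analytic f"
  obtains g where "g analytic_on {complex_of_real x0}"
               "\<forall>\<^sub>F x in nhds x0. f x = g (complex_of_real x)"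
  using assms real_analytic_iff_extends by blast

lemma isCont_analytic_of_real:
  assumes "g analytic_on {complex_of_real x0}"
  shows "isCont (\<lambda>x. g (complex_of_real x)) x0"
  by (rule isCont_o2[where g = g, OF continuous_of_real[OF continuous_ident]
        analytic_at_imp_isCont[OF assms]])

lemma real_analytic_binary:
  assumes "real_analytic f" "real_analytic g"
    and "\<And>F G x0. F analytic_on {complex_of_real x0} \<Longrightarrow> G analytic_on {complex_of_real x0} \<Longrightarrow>
           (\<lambda>w. op (F w) (G w)) analytic_on {complex_of_real x0}"
  shows "real_analytic (\<lambda>x. op (f x) (g x))"
proof (rule real_analyticI)
  fix x0
  obtain F where F: "F analytic_on {complex_of_real x0}"
               "\<forall>\<^sub>F x in nhds x0. f x = F (complex_of_real x)" using real_analyticD assms(1) by blast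
  obtain G where G: "G analytic_on {complex_of_real x0}"
               "\<forall>\<^sub>F x in nhds x0. g x = G (complex_of_real x)" using real_analyticD assms(2) by blast
  have "\<forall>\<^sub>F x in nhds x0. op (f x) (g x) = op (F (complex_of_real x)) (G (complex_of_real x))"
    using F(2) G(2) by eventually_elim simp
  with assms(3)[OF F(1) G(1)]
  show "\<exists>h. h analytic_on {complex_of_real x0} \<and>
        (\<forall>\<^sub>F x in nhds x0. op (f x) (g x) = h (complex_of_real x))" by blast
qed

lemma real_analytic_of_analytic:
  assumes "\<And>x0. g analytic_on {complex_of_real x0}"
  shows "real_analytic (\<lambda>x. g (complex_of_real x))"
  by (rule real_analyticI, rule exI[of _ g]) (use assms in auto)

lemma real_analytic_const: "real_analytic (\<lambda>x. c)"
  using real_analytic_of_analytic[of "\<lambda>_. c"] by simp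

lemma real_analytic_add: "real_analytic f \<Longrightarrow> real_analytic g \<Longrightarrow> real_analytic (\<lambda>x. f x + g x)"
  by (rule real_analytic_binary) (simp_all add: analytic_on_add)

lemma real_analytic_diff: "real_analytic f \<Longrightarrow> real_analytic g \<Longrightarrow> real_analytic (\<lambda>x. f x - g x)"
  by (rule real_analytic_binary) (simp_all add: analytic_on_diff)

lemma real_analytic_mult: "real_analytic f \<Longrightarrow> real_analytic g \<Longrightarrow> real_analytic (\<lambda>x. f x * g x)"
  by (rule real_analytic_binary) (simp_all add: analytic_on_mult)

lemma real_analytic_uminus: "real_analytic f \<Longrightarrow> real_analytic (\<lambda>x. - f x)"
  using real_analytic_diff[OF real_analytic_const[of 0], of f] by simp

lemma real_analytic_cnj:
  assumes "real_analytic f" shows "real_analytic (\<lambda>x. cnj (f x))"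
  unfolding real_analytic_def
proof
  fix x0
  obtain r c where r: "r > 0"
    and s: "\<And>x. \<bar>x - x0\<bar> < r \<Longrightarrow> (\<lambda>n. c n * complex_of_real (x - x0) ^ n) sums f x"
    using assms unfolding real_analytic_def by metis
  have "(\<lambda>n. cnj (c n) * complex_of_real (x - x0) ^ n) sums cnj (f x)" if "\<bar>x - x0\<bar> < r" for x
    using iffD2[OF sums_cnj s[OF that]] by simp
  thus "\<exists>r>0. \<exists>c. \<forall>x. \<bar>x - x0\<bar> < r \<longrightarrow> (\<lambda>n. c n * complex_of_real (x - x0) ^ n) sums cnj (f x)"
    using r by (intro exI[of _ r] conjI exI[of _ "\<lambda>n. cnj (c n)"]) auto
qed

lemma real_analytic_shift:
  assumes "real_analytic f" shows "real_analytic (\<lambda>x. f (x + a))"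
  unfolding real_analytic_def
proof
  fix x0
  obtain r c where r: "r > 0"
    and s: "\<And>x. \<bar>x - (x0 + a)\<bar> < r \<Longrightarrow> (\<lambda>n. c n * complex_of_real (x - (x0 + a)) ^ n) sums f x"
    using assms unfolding real_analytic_def by metis
  show "\<exists>r>0. \<exists>c. \<forall>x. \<bar>x - x0\<bar> < r \<longrightarrow> (\<lambda>n. c n * complex_of_real (x - x0) ^ n) sums f (x + a)"
    using r s[of "_ + a"] by (intro exI[of _ r] conjI exI[of _ c]) auto
qed

lemma real_analytic_continuous:
  assumes "real_analytic f" shows "continuous_on S f"
proof -
  have "isCont f x0" for x0
  proof -
    obtain g where g: "g analytic_on {complex_of_real x0}"
               "\<forall>\<^sub>F x in nhds x0. f x = g (complex_of_real x)" using real_analyticD assms by blast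
    have "isCont (\<lambda>x. g (complex_of_real x)) x0" by (rule isCont_analytic_of_real[OF g(1)])
    thus ?thesis using isCont_cong[OF g(2)] by simp
  qed
  thus ?thesis by (simp add: continuous_at_imp_continuous_on)
qed

lemma real_analytic_inverse:
  assumes "real_analytic f" "\<And>x. f x \<noteq> 0"
  shows "real_analytic (\<lambda>x. inverse (f x))"
proof (rule real_analyticI)
  fix x0
  obtain F where F: "F analytic_on {complex_of_real x0}"
               "\<forall>\<^sub>F x in nhds x0. f x = F (complex_of_real x)" using real_analyticD assms(1) by blast
  have "f x0 = F (complex_of_real x0)" using eventually_nhds_x_imp_x[OF F(2)] .
  hence "(\<lambda>w. inverse (F w)) analytic_on {complex_of_real x0}"
    using assms(2)[of x0] by (intro analytic_on_inverse F(1)) auto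
  moreover have "\<forall>\<^sub>F x in nhds x0. inverse (f x) = inverse (F (complex_of_real x))"
    using F(2) by eventually_elim simp
  ultimately show "\<exists>h. h analytic_on {complex_of_real x0} \<and>
        (\<forall>\<^sub>F x in nhds x0. inverse (f x) = h (complex_of_real x))" by blast
qed

lemma real_analytic_sqrt:
  assumes "real_analytic (\<lambda>x. complex_of_real (f x))" "\<And>x. f x > 0"
  shows "real_analytic (\<lambda>x. complex_of_real (sqrt (f x)))"
proof (rule real_analyticI)
  fix x0
  obtain F where F: "F analytic_on {complex_of_real x0}"
               "\<forall>\<^sub>F x in nhds x0. complex_of_real (f x) = F (complex_of_real x)"
    using real_analyticD assms(1) by blast
  have eq: "F (complex_of_real x0) = complex_of_real (f x0)"
    using eventually_nhds_x_imp_x[OF F(2)] by simp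
  have "complex_of_real (f x0) \<notin> \<real>\<^sub>\<le>\<^sub>0"
    using assms(2)[of x0] by (simp add: complex_nonpos_Reals_iff)
  hence "(\<lambda>w. csqrt (F w)) analytic_on {complex_of_real x0}"
    by (intro analytic_on_csqrt' F(1)) (simp add: eq)
  moreover have "\<forall>\<^sub>F x in nhds x0. complex_of_real (sqrt (f x)) = csqrt (F (complex_of_real x))"
    using F(2)
  proof eventually_elim
    case (elim x)
    show ?case using elim[symmetric] assms(2)[of x] by simp
  qed
  ultimately show "\<exists>h. h analytic_on {complex_of_real x0} \<and>
        (\<forall>\<^sub>F x in nhds x0. complex_of_real (sqrt (f x)) = h (complex_of_real x))" by blast
qed

text \<open>
Either the holomorphic extension at \<open>x0\<close> vanishes identically, or its zero at \<open>x0\<close> has a finite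
order \<open>n\<close>.
\<close>

lemma real_analytic_local_form:
  assumes "real_analytic f"
  shows "(\<forall>\<^sub>F x in nhds x0. f x = 0) \<or>
    (\<exists>n h. h analytic_on {complex_of_real x0} \<and> h (complex_of_real x0) \<noteq> 0 \<and>
       (\<forall>\<^sub>F x in nhds x0. f x = complex_of_real (x - x0) ^ n * h (complex_of_real x)))"
proof -
  let ?z = "complex_of_real x0"
  obtain F where F: "F analytic_on {?z}"
               "\<forall>\<^sub>F x in nhds x0. f x = F (complex_of_real x)" using real_analyticD assms(1) by blast
  obtain r where r: "r > 0" "F holomorphic_on ball ?z r"
    using F(1) by (auto simp: analytic_on_def)
  have near: "\<forall>\<^sub>F x in nhds x0. complex_of_real x \<in> ball ?z s" if "s > 0" for s
    unfolding eventually_nhds_metric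
    by (intro exI[of _ s]) (use that in \<open>auto simp: dist_real_def dist_norm norm_minus_commute
        simp flip: of_real_diff\<close>)
  consider "F ?z \<noteq> 0" | "F ?z = 0" "F constant_on ball ?z r" | "F ?z = 0" "\<not> F constant_on ball ?z r"
    by argo
  thus ?thesis
  proof cases
    case 1
    thus ?thesis using F by (intro disjI2 exI[of _ "0::nat"] exI[of _ F] conjI) simp_all
  next
    case 2
    have "\<forall>\<^sub>F x in nhds x0. f x = 0" using F(2) near[OF r(1)]
    proof eventually_elim
      case (elim x)
      thus ?case using 2 r(1) by (auto simp: constant_on_def)
    qed
    thus ?thesis ..
  next
    case 3
    obtain g s n where g: "0 < s" "ball ?z s \<subseteq> ball ?z r" "g holomorphic_on ball ?z s"
        "\<And>w. w \<in> ball ?z s \<Longrightarrow> F w = (w - ?z)^n * g w"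
        "\<And>w. w \<in> ball ?z s \<Longrightarrow> g w \<noteq> 0"
    proof (rule holomorphic_factor_zero_nonconstant[OF r(2) open_ball connected_ball _ 3])
      show "?z \<in> ball ?z r" using r(1) by simp
    qed blast
    have "g analytic_on {?z}" using g by (auto simp: analytic_on_def)
    moreover have "\<forall>\<^sub>F x in nhds x0. f x = complex_of_real (x - x0) ^ n * g (complex_of_real x)"
      using F(2) near[OF g(1)] by eventually_elim (simp add: g(4))
    moreover have "g ?z \<noteq> 0" using g(5)[of ?z] g(1) by simp
    ultimately show ?thesis
      by (intro disjI2 exI[of _ n] exI[of _ g] conjI)
  qed
qed

text \<open>
The points near which \<open>f\<close> vanishes form an open set. At any other point the local form shows that
zeros of \<open>f\<close> do not accumulate, so the complement is open too, and the line is connected.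
\<close>

lemma real_analytic_identity:
  assumes f: "real_analytic f" and ne: "f x1 \<noteq> 0"
  shows "\<exists>n h. h analytic_on {complex_of_real x0} \<and> h (complex_of_real x0) \<noteq> 0 \<and>
       (\<forall>\<^sub>F x in nhds x0. f x = complex_of_real (x - x0) ^ n * h (complex_of_real x))"
    and "\<forall>\<^sub>F x in at x0. f x \<noteq> 0"
proof -
  have nz: "\<forall>\<^sub>F x in at x0. f x \<noteq> 0" if "h analytic_on {complex_of_real x0}" "h (complex_of_real
      x0) \<noteq> 0"
    "\<forall>\<^sub>F x in nhds x0. f x = complex_of_real (x - x0) ^ n * h (complex_of_real x)" for n h x0
  proof -
    have "isCont (\<lambda>x. h (complex_of_real x)) x0"
      by (rule isCont_analytic_of_real[OF that(1)])
    hence "\<forall>\<^sub>F x in at x0. h (complex_of_real x) \<noteq> 0"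
      using that(2) unfolding isCont_def by (rule tendsto_imp_eventually_ne)
    moreover have "\<forall>\<^sub>F x in at x0. f x = complex_of_real (x - x0) ^ n * h (complex_of_real x)"
      using that(3) by (simp add: eventually_nhds_conv_at)
    moreover have "\<forall>\<^sub>F x in at x0. x \<noteq> x0" by (simp add: eventually_at_filter)
    ultimately show ?thesis by eventually_elim simp
  qed
  define S where "S = {x. \<forall>\<^sub>F y in nhds x. f y = 0}"
  have "open S" unfolding S_def
    by (subst open_subopen) (auto simp: eventually_nhds)
  moreover have "open (- S)"
  proof (subst open_subopen, safe)
    fix x assume "x \<notin> S"
    then obtain n h where "h analytic_on {complex_of_real x}" "h (complex_of_real x) \<noteq> 0"
       "\<forall>\<^sub>F y in nhds x. f y = complex_of_real (y - x) ^ n * h (complex_of_real y)"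
      using real_analytic_local_form[OF f, of x] unfolding S_def by blast
    from nz[OF this] have "\<forall>\<^sub>F y in at x. f y \<noteq> 0" .
    hence "\<forall>\<^sub>F y in at x. y \<notin> S"
      by eventually_elim (auto simp: S_def dest: eventually_nhds_x_imp_x)
    hence "\<forall>\<^sub>F y in nhds x. y \<notin> S" using \<open>x \<notin> S\<close> by (simp add: eventually_nhds_conv_at)
    thus "\<exists>T. open T \<and> x \<in> T \<and> T \<subseteq> - S" unfolding eventually_nhds by blast
  qed
  ultimately have "S = {} \<or> S = UNIV" using clopen[of S] by (simp add: closed_def)
  moreover have "x1 \<notin> S" using ne unfolding S_def by (auto dest: eventually_nhds_x_imp_x)
  ultimately have "x0 \<notin> S" by blast
  thus *: "\<exists>n h. h analytic_on {complex_of_real x0} \<and> h (complex_of_real x0) \<noteq> 0 \<and>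
       (\<forall>\<^sub>F x in nhds x0. f x = complex_of_real (x - x0) ^ n * h (complex_of_real x))"
    using real_analytic_local_form[OF f, of x0] unfolding S_def by blast
  thus "\<forall>\<^sub>F x in at x0. f x \<noteq> 0" using nz by blast
qed

section \<open>The ring of analytic functions on the circle\<close>

text \<open>
As a type these functions become an instance of \<open>idom\<close>, so that determinants and kernel vectors
of matrices over them are available without evaluating at points.
\<close>

typedef circ = "{f :: real \<Rightarrow> complex. real_analytic f \<and> (\<forall>x. f (x + 1) = f x)}"
  morphisms ev Circ
  by (rule exI[of _ "\<lambda>_. 0"]) (simp add: real_analytic_const)

setup_lifting type_definition_circ

lemma ev_analytic [simp]: "real_analytic (ev f)" and ev_periodic [simp]: "ev f (x + 1) = ev f x"
  using ev[of f] by auto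

lemma ev_Circ: "real_analytic f \<Longrightarrow> (\<And>x. f (x + 1) = f x) \<Longrightarrow> ev (Circ f) = f"
  by (simp add: Circ_inverse)

lemma circ_eqI: "(\<And>x. ev f x = ev g x) \<Longrightarrow> f = g"
  by (metis ev_inject ext)

instantiation circ :: comm_ring_1
begin
lift_definition zero_circ :: circ is "\<lambda>_. 0" by (simp add: real_analytic_const)
lift_definition one_circ :: circ is "\<lambda>_. 1" by (simp add: real_analytic_const)
lift_definition plus_circ :: "circ \<Rightarrow> circ \<Rightarrow> circ" is "\<lambda>f g x. f x + g x" by (simp add:
    real_analytic_add)
lift_definition minus_circ :: "circ \<Rightarrow> circ \<Rightarrow> circ" is "\<lambda>f g x. f x - g x" by (simp add:
    real_analytic_diff)
lift_definition times_circ :: "circ \<Rightarrow> circ \<Rightarrow> circ" is "\<lambda>f g x. f x * g x" by (simp add: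
    real_analytic_mult)
lift_definition uminus_circ :: "circ \<Rightarrow> circ" is "\<lambda>f x. - f x" by (simp add: real_analytic_uminus)
instance
  by standard (transfer; simp add: algebra_simps fun_eq_iff)+
end

lemma ev_simps [simp]:
  "ev 0 x = 0" "ev 1 x = 1" "ev (f + g) x = ev f x + ev g x" "ev (f - g) x = ev f x - ev g x"
  "ev (f * g) x = ev f x * ev g x" "ev (- f) x = - ev f x"
  by (transfer; simp)+

lemma ev_power [simp]: "ev (f ^ n) x = ev f x ^ n"
  by (induction n) auto

lemma circ_nonzero: "f \<noteq> 0 \<Longrightarrow> \<exists>x. ev f x \<noteq> 0"
  using circ_eqI[of f 0] by auto

lemma ev_eventually_nonzero: "f \<noteq> 0 \<Longrightarrow> \<forall>\<^sub>F x in at x0. ev f x \<noteq> 0"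
  using circ_nonzero real_analytic_identity(2)[OF ev_analytic] by blast

text \<open>
The zeros of nonzero elements are isolated, so two of them are simultaneously nonzero somewhere.
\<close>

instance circ :: idom
proof
  fix f g :: circ assume "f \<noteq> 0" "g \<noteq> 0"
  hence "\<forall>\<^sub>F x in at 0. ev f x \<noteq> 0" "\<forall>\<^sub>F x in at 0. ev g x \<noteq> 0"
    using ev_eventually_nonzero by blast+
  hence "\<forall>\<^sub>F x in at 0. ev f x * ev g x \<noteq> 0" by eventually_elim simp
  hence "\<exists>x. ev f x * ev g x \<noteq> 0"
    using eventually_happens[of _ "at (0::real)"] by auto
  thus "f * g \<noteq> 0" by (metis ev_simps(1) ev_simps(5))
qed

lemma ev_comm_ring_hom: "comm_ring_hom (\<lambda>f. ev f x)"
  by standard auto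

lemma ev_continuous [simp]: "continuous_on S (ev f)"
  by (simp add: real_analytic_continuous)

lemma ev_isCont: "isCont (ev f) x"
  using ev_continuous[of UNIV f] continuous_on_eq_continuous_at[OF open_UNIV] by blast

lemma periodic_add_int:
  assumes per: "\<And>x :: real. f (x + 1) = f x"
  shows "f (x + of_int k) = f x"
proof -
  have nat: "f (y + real n) = f y" for y n
  proof (induction n)
    case (Suc n)
    thus ?case using per[of "y + real n"] by (simp add: add_ac)
  qed simp
  show ?thesis
  proof (cases "k \<ge> 0")
    case True
    thus ?thesis using nat[of x "nat k"] by simp
  next
    case False
    thus ?thesis using nat[of "x + of_int k" "nat (-k)"] by simp
  qed
qed

lemma ev_add_int: "ev f (x + of_int k) = ev f x"
  by (rule periodic_add_int) simp

lemma ev_frac: "ev f (frac x) = ev f x"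
  using ev_add_int[of f "frac x" "\<lfloor>x\<rfloor>"] by (simp add: frac_def)

lift_definition cconj :: "circ \<Rightarrow> circ" is "\<lambda>f x. cnj (f x)" by (simp add: real_analytic_cnj)

lift_definition cconst :: "complex \<Rightarrow> circ" is "\<lambda>c _. c" by (simp add: real_analytic_const)

lift_definition shift :: "real \<Rightarrow> circ \<Rightarrow> circ" is "\<lambda>a f x. f (x + a)"
proof safe
  fix a x and f :: "real \<Rightarrow> complex" assume "real_analytic f" "\<forall>x. f (x + 1) = f x"
  thus "f (x + 1 + a) = f (x + a)" by (metis add.commute add.left_commute)
qed (rule real_analytic_shift)

lemma ev_cconj [simp]: "ev (cconj f) x = cnj (ev f x)" by transfer simp
lemma ev_cconst [simp]: "ev (cconst c) x = c" by transfer simp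
lemma ev_shift [simp]: "ev (shift a f) x = ev f (x + a)" by transfer simp

lemma shift_comm_ring_hom: "comm_ring_hom (shift a)"
  by standard (auto intro: circ_eqI)

lemma shift_shift: "shift a (shift b f) = shift (a + b) f"
  by (rule circ_eqI) (simp add: add_ac)

lemma shift_zero_arg [simp]: "shift 0 f = f"
  by (rule circ_eqI) simp

lemma circ_inverse_exists:
  assumes "\<And>x. ev f x \<noteq> 0"
  obtains g where "f * g = 1"
proof
  have "ev (Circ (\<lambda>x. inverse (ev f x))) = (\<lambda>x. inverse (ev f x))"
    using assms by (intro ev_Circ) (auto intro: real_analytic_inverse)
  thus "f * Circ (\<lambda>x. inverse (ev f x)) = 1"
    using assms by (intro circ_eqI) simp
qed

section \<open>Division by zeros\<close>

lemma real_analytic_cis: "real_analytic (\<lambda>x. cis (2 * pi * x))"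
proof -
  have "real_analytic (\<lambda>x. exp (\<i> * (of_real (2 * pi) * complex_of_real x)))"
    by (rule real_analytic_of_analytic) (intro analytic_intros)
  thus ?thesis by (simp add: cis_conv_exp)
qed

text \<open>
Since complex values are allowed, there is a periodic function with a single simple zero per
period; a real-valued one has an even number of zeros, counted with multiplicity.
\<close>

lift_definition linear_factor :: "real \<Rightarrow> circ" is "\<lambda>z x. cis (2 * pi * x) - cis (2 * pi * z)"
  by (auto intro!: real_analytic_diff real_analytic_cis real_analytic_const
      simp: distrib_left simp flip: cis_mult)

lemma ev_linear_factor: "ev (linear_factor z) x = cis (2 * pi * x) - cis (2 * pi * z)"
  by transfer simp

lemma ev_linear_factor_eq_0_iff: "ev (linear_factor z) x = 0 \<longleftrightarrow> x - z \<in> \<int>"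
proof -
  have "ev (linear_factor z) x = 0 \<longleftrightarrow> cis (2 * pi * (x - z)) = 1"
    by (simp add: ev_linear_factor right_diff_distrib flip: cis_divide)
  also have "\<dots> \<longleftrightarrow> x - z \<in> \<int>"
  proof
    assume "cis (2 * pi * (x - z)) = 1"
    hence "cos (2 * pi * (x - z)) = 1" by (simp add: complex_eq_iff)
    then obtain n where "2 * pi * (x - z) = of_int n * 2 * pi"
      using cos_one_2pi_int[of "2 * pi * (x - z)"] by auto
    hence "(x - z) * (2 * pi) = of_int n * (2 * pi)" by (simp add: algebra_simps)
    hence "x - z = of_int n" by simp
    thus "x - z \<in> \<int>" by simp
  next
    assume "x - z \<in> \<int>"
    thus "cis (2 * pi * (x - z)) = 1" by (auto elim!: Ints_cases)
  qed
  finally show ?thesis .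
qed

lemma linear_factor_neq_0: "linear_factor z \<noteq> 0"
proof
  assume "linear_factor z = 0"
  hence "z + 1/2 - z \<in> \<int>" using ev_linear_factor_eq_0_iff[of z "z + 1/2"] by simp
  then obtain k :: int where "(1/2 :: real) = of_int k" by (auto elim: Ints_cases)
  hence "of_int (2 * k) = (1::real)" by simp
  hence "2 * k = 1" by linarith
  thus False by presburger
qed

lemma cis_analytic_near_zero:
  obtains h where "h analytic_on {complex_of_real x0}" "h (complex_of_real x0) \<noteq> 0"
    "\<And>x. cis (2 * pi * x) - cis (2 * pi * x0) = complex_of_real (x - x0) * h (complex_of_real x)"
proof -
  let ?g = "\<lambda>w. exp (\<i> * (of_real (2 * pi) * w)) - exp (\<i> * (of_real (2 * pi) * complex_of_real x0))"
  let ?z = "complex_of_real x0"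
  define h where "h w = (if w = ?z then deriv ?g ?z else ?g w / (w - ?z))" for w
  have D: "(?g has_field_derivative exp (\<i> * (of_real (2 * pi) * ?z)) * (\<i> * of_real (2 * pi))) (at ?z)"
    by (auto intro!: derivative_eq_intros)
  have "h holomorphic_on UNIV"
  proof (rule pole_theorem_open_0[of ?g])
    show "?g holomorphic_on UNIV" by (intro holomorphic_intros)
  qed (auto simp: h_def)
  hence "h analytic_on {?z}" using analytic_on_open analytic_on_subset by blast
  moreover have "h ?z \<noteq> 0" using DERIV_imp_deriv[OF D] by (simp add: h_def)
  moreover have "cis (2 * pi * x) - cis (2 * pi * x0) = complex_of_real (x - x0) * h
      (complex_of_real x)" for x
    by (auto simp: h_def cis_conv_exp)
  ultimately show ?thesis using that by blast
qed

text \<open>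
The quotient is extended by its limits to the zeros of the linear factor. At such a point both
functions have a factor \<open>x - x0\<close>, and the cofactor of the denominator does not vanish.
\<close>

lemma divide_linear_factor:
  assumes "ev f z = 0"
  obtains g where "f = linear_factor z * g"
proof -
  \<comment> \<open>The limit exists at each zero of the linear factor; this is part of the local argument below.\<close>
  define q where "q x = (if ev (linear_factor z) x = 0
     then Lim (at x) (\<lambda>y. ev f y / ev (linear_factor z) y)
     else ev f x / ev (linear_factor z) x)" for x
  have nzt: "\<forall>\<^sub>F y in at x0. ev (linear_factor z) y \<noteq> 0" for x0
    using ev_eventually_nonzero[OF linear_factor_neq_0] .
  have local: "\<exists>h. h analytic_on {complex_of_real x0} \<and> (\<forall>\<^sub>F x in nhds x0. q x = h
      (complex_of_real x))" for x0
  proof -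
    obtain F where F: "F analytic_on {complex_of_real x0}"
      "\<forall>\<^sub>F x in nhds x0. ev f x = F (complex_of_real x)" using real_analyticD ev_analytic by blast
    obtain G where G: "G analytic_on {complex_of_real x0}" "G (complex_of_real x0) \<noteq> 0"
      "\<And>x. cis (2 * pi * x) - cis (2 * pi * x0) = complex_of_real (x - x0) * G (complex_of_real x)"
      using cis_analytic_near_zero[of x0] by blast
    have Gc: "isCont (\<lambda>x. G (complex_of_real x)) x0"
      by (rule isCont_analytic_of_real[OF G(1)])
    show ?thesis
    proof (cases "ev (linear_factor z) x0 = 0")
      case False
      have "isCont (ev (linear_factor z)) x0" by (rule ev_isCont)
      hence "\<forall>\<^sub>F x in nhds x0. ev (linear_factor z) x \<noteq> 0"
        using tendsto_imp_eventually_ne[of "ev (linear_factor z)" _ "at x0" 0] False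
        by (simp add: isCont_def eventually_nhds_conv_at)
      hence q: "\<forall>\<^sub>F x in nhds x0. q x = ev f x * inverse (ev (linear_factor z) x)"
        by eventually_elim (simp add: q_def field_simps)
      obtain L where L: "L analytic_on {complex_of_real x0}"
        "\<forall>\<^sub>F x in nhds x0. ev (linear_factor z) x = L (complex_of_real x)"
        using real_analyticD ev_analytic by blast
      have "L (complex_of_real x0) \<noteq> 0" using eventually_nhds_x_imp_x[OF L(2)] False by simp
      hence "(\<lambda>w. F w * inverse (L w)) analytic_on {complex_of_real x0}"
        by (intro analytic_on_mult F(1) analytic_on_inverse L(1)) auto
      moreover have "\<forall>\<^sub>F x in nhds x0. q x = F (complex_of_real x) * inverse (L (complex_of_real x))"
        using q F(2) L(2) by eventually_elim simp
      ultimately show ?thesis by blast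
    next
      case True
      hence eq: "cis (2 * pi * x0) = cis (2 * pi * z)" by (simp add: ev_linear_factor)
      have "x0 - z \<in> \<int>" using True ev_linear_factor_eq_0_iff by blast
      then obtain k where "x0 = z + of_int k" by (auto elim!: Ints_cases simp: algebra_simps)
      hence f0: "ev f x0 = 0" using assms ev_add_int by simp
      hence F0: "F (complex_of_real x0) = 0" using eventually_nhds_x_imp_x[OF F(2)] by simp
      obtain r where r: "r > 0" "F holomorphic_on ball (complex_of_real x0) r"
        using F(1) by (auto simp: analytic_on_def)
      define H where "H w = (if w = complex_of_real x0 then deriv F (complex_of_real x0)
          else F w / (w - complex_of_real x0))" for w
      have "H holomorphic_on ball (complex_of_real x0) r"
        by (rule pole_theorem_open_0[OF r(2)]) (auto simp: H_def F0)
      hence H: "H analytic_on {complex_of_real x0}" using r(1) by (auto simp: analytic_on_def)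
      hence Hc: "isCont (\<lambda>x. H (complex_of_real x)) x0" by (rule isCont_analytic_of_real)
      have FH: "\<forall>\<^sub>F x in at x0. ev f x / ev (linear_factor z) x = H (complex_of_real x) / G
          (complex_of_real x)"
      proof -
        have "\<forall>\<^sub>F x in at x0. ev f x = F (complex_of_real x)"
          using F(2) by (simp add: eventually_nhds_conv_at)
        moreover have "\<forall>\<^sub>F x in at x0. x \<noteq> x0" by (simp add: eventually_at_filter)
        ultimately show ?thesis
        proof eventually_elim
          case (elim x)
          have "ev (linear_factor z) x = complex_of_real (x - x0) * G (complex_of_real x)"
            using G(3)[of x] eq by (simp add: ev_linear_factor)
          thus ?case using elim by (simp add: H_def)
        qed
      qed
      have lim: "((\<lambda>x. H (complex_of_real x) / G (complex_of_real x)) \<longlongrightarrow>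
             H (complex_of_real x0) / G (complex_of_real x0)) (at x0)"
        using Hc Gc G(2) unfolding isCont_def by (intro tendsto_divide)
      hence "((\<lambda>x. ev f x / ev (linear_factor z) x) \<longlongrightarrow> H (complex_of_real x0) / G (complex_of_real
          x0)) (at x0)"
        using tendsto_cong[OF FH] by blast
      hence "Lim (at x0) (\<lambda>x. ev f x / ev (linear_factor z) x) = H (complex_of_real x0) / G
          (complex_of_real x0)"
        by (intro tendsto_Lim) auto
      hence q0: "q x0 = H (complex_of_real x0) / G (complex_of_real x0)"
        unfolding q_def using True by simp
      have "\<forall>\<^sub>F x in at x0. q x = H (complex_of_real x) / G (complex_of_real x)"
        using FH nzt[of x0] by eventually_elim (simp add: q_def)
      hence "\<forall>\<^sub>F x in nhds x0. q x = H (complex_of_real x) / G (complex_of_real x)"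
        using q0 by (simp add: eventually_nhds_conv_at)
      moreover have "(\<lambda>w. H w / G w) analytic_on {complex_of_real x0}"
        using G(2) by (intro analytic_on_divide H G(1)) auto
      ultimately show ?thesis by blast
    qed
  qed
  have "real_analytic q" by (rule real_analyticI) (rule local)
  moreover have "q (x + 1) = q x" for x
  proof -
    have "Lim (at (x + 1)) (\<lambda>y. ev f y / ev (linear_factor z) y) = Lim (at x) (\<lambda>y. ev f y / ev
        (linear_factor z) y)"
    proof -
      have "at (x + 1) = filtermap (\<lambda>y. y + 1) (at x)" using filtermap_at_shift[of "-1" x] by simp
      thus ?thesis by (simp add: Topological_Spaces.Lim_def filterlim_filtermap)
    qed
    thus ?thesis by (simp add: q_def)
  qed
  ultimately have q: "ev (Circ q) = q" by (intro ev_Circ)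
  have "f = linear_factor z * Circ q"
  proof (rule circ_eqI)
    fix x show "ev f x = ev (linear_factor z * Circ q) x"
    proof (cases "ev (linear_factor z) x = 0")
      case False thus ?thesis by (simp add: q q_def)
    next
      case True
      hence "x - z \<in> \<int>" using ev_linear_factor_eq_0_iff by blast
      then obtain k where "x = z + of_int k" by (auto elim!: Ints_cases simp: algebra_simps)
      thus ?thesis using True assms ev_add_int by simp
    qed
  qed
  thus ?thesis by (rule that)
qed

text \<open>
If every cofactor vanished at \<open>z\<close>, then \<open>f\<close> would be divisible by all powers of the linear factor,
against the finite order of its zero.
\<close>

lemma split_off_zero:
  assumes "f \<noteq> 0"
  obtains m g where "f = linear_factor z ^ m * g" "ev g z \<noteq> 0"
proof (rule ccontr)
  assume no: "\<not> thesis"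
  have ex: "\<exists>g. f = linear_factor z ^ m * g" for m
  proof (induction m)
    case (Suc m)
    then obtain g where g: "f = linear_factor z ^ m * g" by blast
    have "ev g z = 0" using no that[OF g] by blast
    then obtain g' where "g = linear_factor z * g'" by (rule divide_linear_factor)
    thus ?case using g by (intro exI[of _ g']) (simp add: mult_ac)
  qed simp
  obtain x1 where "ev f x1 \<noteq> 0" using circ_nonzero[OF assms] by blast
  then obtain n h where h: "h analytic_on {complex_of_real z}" "h (complex_of_real z) \<noteq> 0"
       "\<forall>\<^sub>F x in nhds z. ev f x = complex_of_real (x - z) ^ n * h (complex_of_real x)"
    using real_analytic_identity(1)[OF ev_analytic, of f x1 z] by blast
  obtain G where G: "G analytic_on {complex_of_real z}" "G (complex_of_real z) \<noteq> 0"
      "\<And>x. cis (2 * pi * x) - cis (2 * pi * z) = complex_of_real (x - z) * G (complex_of_real x)"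
    using cis_analytic_near_zero[of z] by blast
  obtain g where g: "f = linear_factor z ^ Suc n * g" using ex by blast
  have "\<forall>\<^sub>F x in at z. ev f x = complex_of_real (x - z) ^ n * h (complex_of_real x)"
    using h(3) by (simp add: eventually_nhds_conv_at)
  moreover have "\<forall>\<^sub>F x in at z. x \<noteq> z" by (simp add: eventually_at_filter)
  ultimately have "\<forall>\<^sub>F x in at z. h (complex_of_real x) = complex_of_real (x - z) * (G
      (complex_of_real x) ^ Suc n * ev g x)"
  proof eventually_elim
    case (elim x)
    have "ev f x = (complex_of_real (x - z) * G (complex_of_real x)) ^ Suc n * ev g x"
      using G(3)[of x] by (simp add: g ev_linear_factor)
    also have "\<dots> = complex_of_real (x - z) ^ n *
        (complex_of_real (x - z) * (G (complex_of_real x) ^ Suc n * ev g x))"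
      by (simp add: power_mult_distrib mult_ac)
    finally show ?case using elim by simp
  qed
  moreover have "((\<lambda>x. h (complex_of_real x)) \<longlongrightarrow> h (complex_of_real z)) (at z)"
    using isCont_analytic_of_real[OF h(1)] by (simp add: isCont_def)
  ultimately have "((\<lambda>x. complex_of_real (x - z) * (G (complex_of_real x) ^ Suc n * ev g x))
      \<longlongrightarrow> h (complex_of_real z)) (at z)"
    by (rule iffD1[OF tendsto_cong])
  moreover have "((\<lambda>x. complex_of_real (x - z) * (G (complex_of_real x) ^ Suc n * ev g x))
      \<longlongrightarrow> complex_of_real (z - z) * (G (complex_of_real z) ^ Suc n * ev g z)) (at z)"
    using isCont_analytic_of_real[OF G(1)] ev_isCont[of z g] unfolding isCont_def
    by (intro tendsto_mult tendsto_power tendsto_of_real tendsto_diff tendsto_ident_at tendsto_const)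
  ultimately have "h (complex_of_real z) = complex_of_real (z - z) * (G (complex_of_real z) ^ Suc
      n * ev g z)"
    by (rule tendsto_unique[OF at_neq_bot])
  thus False using h(2) by simp
qed

lemma finite_zeros:
  assumes "f \<noteq> 0" shows "finite {x \<in> {0..1}. ev f x = 0}"
proof (rule ccontr)
  let ?Z = "{x \<in> {0..1}. ev f x = 0}"
  assume "infinite ?Z"
  then obtain x where "x islimpt ?Z"
    using Heine_Borel_imp_Bolzano_Weierstrass[OF compact_Icc, of ?Z 0 1] by blast
  moreover have "\<forall>\<^sub>F y in at x. y \<notin> ?Z"
    using ev_eventually_nonzero[OF assms, of x] by eventually_elim auto
  ultimately show False unfolding islimpt_iff_eventually by contradiction
qed

text \<open>
Splitting off the full power of a linear factor lowers the number of zeros in one period.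
\<close>

lemma factor_into_zeros:
  assumes "f \<noteq> 0"
  obtains u zs where "f = u * prod_list (map linear_factor zs)" "\<And>x. ev u x \<noteq> 0"
proof -
  have "\<exists>u zs. f = u * prod_list (map linear_factor zs) \<and> (\<forall>x. ev u x \<noteq> 0)"
    using assms
  proof (induction "card {x \<in> {0..<1}. ev f x = 0}" arbitrary: f rule: less_induct)
    case less
    have fin: "finite {x \<in> {0..<1}. ev f x = 0}"
      by (rule finite_subset[OF _ finite_zeros[OF less.prems]]) auto
    show ?case
    proof (cases "\<exists>z\<in>{0..<1}. ev f z = 0")
      case False
      have "ev f x \<noteq> 0" for x
        using False ev_frac[of f x] frac_ge_0[of x] frac_lt_1[of x]
        by (metis atLeastLessThan_iff)
      thus ?thesis by (intro exI[of _ f] exI[of _ "[]"]) auto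
    next
      case True
      then obtain z where z: "z \<in> {0..<1}" "ev f z = 0" by blast
      obtain m g where g: "f = linear_factor z ^ m * g" "ev g z \<noteq> 0"
        using split_off_zero[OF less.prems] .
      have "{x \<in> {0..<1}. ev g x = 0} \<subset> {x \<in> {0..<1}. ev f x = 0}"
        using z g by auto
      hence "card {x \<in> {0..<1}. ev g x = 0} < card {x \<in> {0..<1}. ev f x = 0}"
        using fin psubset_card_mono by blast
      moreover have "g \<noteq> 0" using g(2) by auto
      ultimately obtain u zs where u: "g = u * prod_list (map linear_factor zs)" "\<forall>x. ev u x \<noteq> 0"
        using less.hyps by blast
      hence "f = u * prod_list (map linear_factor (replicate m z @ zs))"
        using g(1) by (simp add: mult_ac)
      thus ?thesis using u(2) by blast
    qed
  qed
  thus ?thesis using that by blast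
qed

section \<open>Proportional pairs of unit length\<close>

lemma normalise_pair:
  assumes nz: "\<And>x. ev s x \<noteq> 0 \<or> ev t x \<noteq> 0"
  obtains s' t' where "cconj s' * s' + cconj t' * t' = 1" "s * t' = t * s'"
proof -
  define \<phi> where "\<phi> x = (norm (ev s x))\<^sup>2 + (norm (ev t x))\<^sup>2" for x
  have pos: "\<phi> x > 0" for x using nz[of x] by (auto simp: \<phi>_def add_pos_nonneg add_nonneg_pos)
  have eq: "complex_of_real (\<phi> x) = ev (cconj s * s + cconj t * t) x" for x
    unfolding \<phi>_def of_real_add complex_norm_square by (simp add: mult_ac)
  have "real_analytic (\<lambda>x. complex_of_real (\<phi> x))" unfolding eq by (rule ev_analytic)
  from real_analytic_sqrt[OF this pos]
  have "real_analytic (\<lambda>x. inverse (complex_of_real (sqrt (\<phi> x))))"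
    using pos by (intro real_analytic_inverse) (auto simp: less_imp_neq[THEN not_sym])
  moreover have "\<phi> (x + 1) = \<phi> x" for x by (simp add: \<phi>_def)
  ultimately have r: "ev (Circ (\<lambda>x. inverse (complex_of_real (sqrt (\<phi> x))))) = (\<lambda>x. inverse
      (complex_of_real (sqrt (\<phi> x))))"
    by (intro ev_Circ) auto
  define r where "r = Circ (\<lambda>x. inverse (complex_of_real (sqrt (\<phi> x))))"
  have "cconj (r * s) * (r * s) + cconj (r * t) * (r * t) = 1"
  proof (rule circ_eqI)
    fix x
    have "ev (cconj (r * s) * (r * s) + cconj (r * t) * (r * t)) x =
      (inverse (complex_of_real (sqrt (\<phi> x))))\<^sup>2 * ev (cconj s * s + cconj t * t) x"
      by (simp add: r_def r power2_eq_square algebra_simps)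
    also have "\<dots> = complex_of_real ((inverse (sqrt (\<phi> x)))\<^sup>2 * \<phi> x)"
      by (simp only: eq[symmetric] of_real_mult of_real_power of_real_inverse)
    also have "(inverse (sqrt (\<phi> x)))\<^sup>2 * \<phi> x = 1"
      using pos[of x] by (simp add: power_inverse)
    finally show "ev (cconj (r * s) * (r * s) + cconj (r * t) * (r * t)) x = ev 1 x" by simp
  qed
  moreover have "s * (r * t) = t * (r * s)" by (simp add: mult_ac)
  ultimately show ?thesis using that by blast
qed

text \<open>
Common zeros have to be removed before the pair can be normalised. They are among the zeros of
\<open>a\<close>, whose linear factors are treated one at a time: a factor that divides \<open>b\<close> is cancelled, any
other factor is put back into the pair found for the remaining factors. The latter creates no
common zero, because \<open>t = 0\<close> at a zero \<open>x\<close> of the factor would give \<open>b s = 0\<close> there, whereas neither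
\<open>b\<close> nor \<open>s\<close> vanishes at \<open>x\<close>.
\<close>

lemma unit_pair_proportional:
  "\<exists>s t. cconj s * s + cconj t * t = 1 \<and> a * t = b * s"
proof (cases "a = 0")
  case True
  have "cconj 1 = 1" "cconj 0 = 0" by (rule circ_eqI, simp)+
  thus ?thesis using True by (intro exI[of _ 0] exI[of _ 1]) simp
next
  case False
  then obtain u zs where u: "a = u * prod_list (map linear_factor zs)" "\<And>x. ev u x \<noteq> 0"
    using factor_into_zeros[OF False] by blast
  have "\<exists>s t. cconj s * s + cconj t * t = 1 \<and> u * prod_list (map linear_factor zs) * t = b * s" for b
  proof (induction zs arbitrary: b)
    case Nil
    obtain s t where "cconj s * s + cconj t * t = 1" "u * t = b * s"
      using normalise_pair[of u b] u(2) by blast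
    thus ?case by auto
  next
    case (Cons z zs)
    let ?a = "u * prod_list (map linear_factor zs)"
    show ?case
    proof (cases "ev b z = 0")
      case True
      then obtain b' where b': "b = linear_factor z * b'" by (rule divide_linear_factor)
      obtain s t where st: "cconj s * s + cconj t * t = 1" "?a * t = b' * s"
        using Cons.IH[of b'] by blast
      have "u * prod_list (map linear_factor (z # zs)) * t = linear_factor z * (?a * t)"
        by (simp add: mult_ac)
      also have "\<dots> = b * s" by (simp add: st(2) b')
      finally show ?thesis using st(1) by blast
    next
      case b: False
      obtain s t where st: "cconj s * s + cconj t * t = 1" "?a * t = b * s"
        using Cons.IH[of b] by blast
      have "ev (linear_factor z * s) x \<noteq> 0 \<or> ev t x \<noteq> 0" for x
      proof (rule ccontr)
        assume "\<not> ?thesis"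
        hence 0: "ev (linear_factor z) x * ev s x = 0" "ev t x = 0" by auto
        have 1: "cnj (ev s x) * ev s x = 1"
          using arg_cong[OF st(1), of "\<lambda>f. ev f x"] 0 by simp
        hence "ev (linear_factor z) x = 0" using 0 by auto
        then obtain k where "x = z + of_int k"
          using ev_linear_factor_eq_0_iff by (auto elim!: Ints_cases simp: algebra_simps)
        hence "ev b x \<noteq> 0" using b by (simp add: ev_add_int)
        moreover have "ev b x * ev s x = 0"
          using arg_cong[OF st(2), of "\<lambda>f. ev f x"] 0 by simp
        ultimately show False using 1 by simp
      qed
      then obtain s' t' where st': "cconj s' * s' + cconj t' * t' = 1"
         "(linear_factor z * s) * t' = t * s'" using normalise_pair by blast
      have "(?a * linear_factor z) * t' = b * s'"
      proof (cases "s = 0")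
        case False
        have "s * ((?a * linear_factor z) * t') = ?a * (linear_factor z * s * t')" by (simp add:
            mult_ac)
        also have "\<dots> = (?a * t) * s'" by (subst st'(2)) (simp only: mult.assoc)
        also have "\<dots> = s * (b * s')" by (subst st(2)) (simp only: mult_ac)
        finally show ?thesis using False by simp
      next
        case True
        hence "t \<noteq> 0" using st(1) by auto
        hence "?a = 0" "s' = 0" using st(2) st'(2) True by auto
        thus ?thesis by simp
      qed
      thus ?thesis using st'(1)
        by (intro exI[of _ s'] exI[of _ t'] conjI) (simp_all add: mult_ac)
    qed
  qed
  thus ?thesis using u(1) by blast
qed

section \<open>Unitary matrices over the ring\<close>

lemma one_mat_eq_zero_iff: "(1\<^sub>m d :: 'a :: comm_ring_1 mat) = 0\<^sub>m d d \<longleftrightarrow> d = 0"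
proof
  assume eq: "(1\<^sub>m d :: 'a mat) = 0\<^sub>m d d"
  show "d = 0"
  proof (rule ccontr)
    assume "d \<noteq> 0"
    thus False using arg_cong[OF eq, of "\<lambda>M. M $$ (0, 0)"] by simp
  qed
qed auto

lemma mat_eq_by_vec:
  fixes M M' :: "'a :: comm_ring_1 mat"
  assumes "M \<in> carrier_mat m n" "M' \<in> carrier_mat m n"
    and "\<And>v. v \<in> carrier_vec n \<Longrightarrow> M *\<^sub>v v = M' *\<^sub>v v"
  shows "M = M'"
proof (rule eq_matI)
  fix i j assume ij: "i < dim_row M'" "j < dim_col M'"
  have "(M *\<^sub>v unit_vec n j) $ i = (M' *\<^sub>v unit_vec n j) $ i" using assms(3) by simp
  thus "M $$ (i, j) = M' $$ (i, j)" using ij assms(1,2) by simp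
qed (use assms in auto)

text \<open>
Injectivity on vectors over the ring of coefficients. Over \<open>circ\<close> it amounts to injectivity at
some point of the circle, not at all of them.
\<close>

definition inj_mat :: "'a :: comm_ring_1 mat \<Rightarrow> bool" where
  "inj_mat C \<longleftrightarrow>
     (\<forall>v \<in> carrier_vec (dim_col C). C *\<^sub>v v = 0\<^sub>v (dim_row C) \<longrightarrow> v = 0\<^sub>v (dim_col C))"

lemma inj_matD:
  "inj_mat C \<Longrightarrow> C \<in> carrier_mat m n \<Longrightarrow> v \<in> carrier_vec n \<Longrightarrow> C *\<^sub>v v = 0\<^sub>v m \<Longrightarrow> v = 0\<^sub>v n"
  by (auto simp: inj_mat_def)

text \<open>
Entrywise evaluation at a point (\<open>evm\<close>, \<open>evv\<close>) and translation of the argument (\<open>shm\<close>, \<open>shv\<close>).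
\<close>

abbreviation evm :: "real \<Rightarrow> circ mat \<Rightarrow> complex mat" where
  "evm x \<equiv> map_mat (\<lambda>f. ev f x)"

abbreviation evv :: "real \<Rightarrow> circ vec \<Rightarrow> complex vec" where
  "evv x \<equiv> map_vec (\<lambda>f. ev f x)"

abbreviation shm :: "real \<Rightarrow> circ mat \<Rightarrow> circ mat" where
  "shm a \<equiv> map_mat (shift a)"

abbreviation shv :: "real \<Rightarrow> circ vec \<Rightarrow> circ vec" where
  "shv a \<equiv> map_vec (shift a)"

interpretation ev_hom: comm_ring_hom "\<lambda>f. ev f x" for x by (rule ev_comm_ring_hom)
interpretation shift_hom: comm_ring_hom "shift a" for a by (rule shift_comm_ring_hom)

lemma evm_eqI:
  assumes "\<And>x. evm x M = evm x M'" shows "M = M'"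
proof (rule eq_matI)
  show d: "dim_row M = dim_row M'" "dim_col M = dim_col M'"
    using arg_cong[OF assms, of dim_row 0] arg_cong[OF assms, of dim_col 0] by auto
  fix i j assume ij: "i < dim_row M'" "j < dim_col M'"
  show "M $$ (i, j) = M' $$ (i, j)"
  proof (rule circ_eqI)
    fix x
    show "ev (M $$ (i, j)) x = ev (M' $$ (i, j)) x"
      using arg_cong[OF assms[of x], of "\<lambda>X. X $$ (i, j)"] ij d by simp
  qed
qed

lemma evv_eqI:
  assumes "\<And>x. evv x v = evv x w" shows "v = w"
proof (rule eq_vecI)
  show d: "dim_vec v = dim_vec w"
    using arg_cong[OF assms, of dim_vec 0] by auto
  fix i assume i: "i < dim_vec w"
  show "v $ i = w $ i"
  proof (rule circ_eqI)
    fix x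
    show "ev (v $ i) x = ev (w $ i) x"
      using arg_cong[OF assms[of x], of "\<lambda>X. vec_index X i"] i d by simp
  qed
qed

lemma evm_shm [simp]: "evm x (shm a M) = evm (x + a) M"
  by (rule eq_matI) auto

lemma shm_shm: "shm a (shm b M) = shm (a + b) M"
  by (rule eq_matI) (auto simp: shift_shift)

lemma shv_shv: "shv a (shv b v) = shv (a + b) v"
  by (rule eq_vecI) (auto simp: shift_shift)

lemma shm_0 [simp]: "shm 0 M = M" and shv_0 [simp]: "shv 0 v = v"
  by (auto intro!: eq_matI eq_vecI)

text \<open>
The pointwise adjoint; \<open>circ\<close> is not a field, which \<open>mat_adjoint\<close> presupposes.
\<close>

definition adj :: "circ mat \<Rightarrow> circ mat" where
  "adj M = mat (dim_col M) (dim_row M) (\<lambda>(i, j). cconj (M $$ (j, i)))"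

lemma adj_carrier [simp]: "M \<in> carrier_mat m n \<Longrightarrow> adj M \<in> carrier_mat n m"
  by (auto simp: adj_def)

lemma adj_index [simp]:
  "dim_row (adj M) = dim_col M" "dim_col (adj M) = dim_row M"
  "i < dim_col M \<Longrightarrow> j < dim_row M \<Longrightarrow> adj M $$ (i, j) = cconj (M $$ (j, i))"
  by (auto simp: adj_def)

lemma mat_adjoint_index:
  "dim_row (mat_adjoint M) = dim_col M" "dim_col (mat_adjoint M) = dim_row M"
  "i < dim_col M \<Longrightarrow> j < dim_row M \<Longrightarrow> mat_adjoint M $$ (i, j) = conjugate (M $$ (j, i))"
  by (auto simp: mat_adjoint_def mat_of_rows_def)

lemma evm_adj: "evm x (adj M) = mat_adjoint (evm x M)"
  by (rule eq_matI) (auto simp: mat_adjoint_index)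

definition unitary_circ :: "nat \<Rightarrow> circ mat set" where
  "unitary_circ d = {N \<in> carrier_mat d d. \<forall>x. evm x N \<in> unitary_group d}"

lemma unitary_circ_carrier: "N \<in> unitary_circ d \<Longrightarrow> N \<in> carrier_mat d d"
  by (simp add: unitary_circ_def)

lemma unitary_circ_adj:
  assumes "N \<in> unitary_circ d" shows "adj N * N = 1\<^sub>m d" "N * adj N = 1\<^sub>m d"
proof -
  have N: "N \<in> carrier_mat d d" and u: "\<And>x. evm x N \<in> unitary_group d"
    using assms by (auto simp: unitary_circ_def)
  show "adj N * N = 1\<^sub>m d"
  proof (rule evm_eqI)
    fix x show "evm x (adj N * N) = evm x (1\<^sub>m d)"
      using u[of x] by (simp add: ev_hom.mat_hom_mult[OF adj_carrier[OF N] N] evm_adj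
          unitary_group_def ev_hom.mat_hom_one)
  qed
  show "N * adj N = 1\<^sub>m d"
  proof (rule evm_eqI)
    fix x show "evm x (N * adj N) = evm x (1\<^sub>m d)"
      using u[of x] by (simp add: ev_hom.mat_hom_mult[OF N adj_carrier[OF N]] evm_adj
          unitary_group_def ev_hom.mat_hom_one)
  qed
qed

lemma unitary_circI:
  assumes N: "N \<in> carrier_mat d d" and a: "adj N * N = 1\<^sub>m d"
  shows "N \<in> unitary_circ d"
proof -
  have "evm x N \<in> unitary_group d" for x
  proof -
    have 1: "mat_adjoint (evm x N) * evm x N = 1\<^sub>m d"
      using arg_cong[OF a, of "evm x"]
      by (simp add: ev_hom.mat_hom_mult[OF adj_carrier[OF N] N] evm_adj ev_hom.mat_hom_one)
    have c: "mat_adjoint (evm x N) \<in> carrier_mat d d"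
      using N by (intro carrier_matI) (auto simp: mat_adjoint_index)
    have "evm x N * mat_adjoint (evm x N) = 1\<^sub>m d"
      using mat_mult_left_right_inverse[OF c _ 1] N by auto
    thus ?thesis using 1 N by (simp add: unitary_group_def)
  qed
  thus ?thesis using N by (simp add: unitary_circ_def)
qed

lemma one_unitary: "1\<^sub>m d \<in> unitary_circ d"
proof (rule unitary_circI)
  have "adj (1\<^sub>m d) = 1\<^sub>m d" by (intro eq_matI circ_eqI) auto
  thus "adj (1\<^sub>m d) * 1\<^sub>m d = 1\<^sub>m d" by simp
qed simp

lemma mult_unitary:
  assumes "M \<in> unitary_circ d" "N \<in> unitary_circ d" shows "M * N \<in> unitary_circ d"
proof (rule unitary_circI)
  note c = assms[THEN unitary_circ_carrier]
  show "M * N \<in> carrier_mat d d" using c by simp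
  have "adj (M * N) = adj N * adj M"
    using c by (intro eq_matI circ_eqI)
      (auto simp: scalar_prod_def sum_distrib_left mult_ac ev_hom.hom_sum intro!: sum.cong)
  hence "adj (M * N) * (M * N) = adj N * (adj M * (M * N))"
    using c by (simp add: assoc_mult_mat[of _ d d _ d _ d])
  also have "adj M * (M * N) = (adj M * M) * N"
    using c by (simp add: assoc_mult_mat[of _ d d _ d _ d])
  also have "\<dots> = N" using c assms by (simp add: unitary_circ_adj)
  finally have "adj (M * N) * (M * N) = adj N * N" .
  thus "adj (M * N) * (M * N) = 1\<^sub>m d"
    by (simp add: unitary_circ_adj assms)
qed

lemma shm_unitary:
  assumes "N \<in> unitary_circ d" shows "shm a N \<in> unitary_circ d"
  using assms by (auto simp: unitary_circ_def)

lemma diag_unitary: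
  assumes "M \<in> unitary_circ k" "N \<in> unitary_circ q"
  shows "four_block_mat M (0\<^sub>m k q) (0\<^sub>m q k) N \<in> unitary_circ (k + q)"
proof (rule unitary_circI)
  note c = assms[THEN unitary_circ_carrier]
  let ?D = "four_block_mat M (0\<^sub>m k q) (0\<^sub>m q k) N"
  show "?D \<in> carrier_mat (k + q) (k + q)" using c by simp
  have "adj ?D = four_block_mat (adj M) (0\<^sub>m k q) (0\<^sub>m q k) (adj N)"
    using c by (intro eq_matI circ_eqI) auto
  hence "adj ?D * ?D = four_block_mat (adj M * M) (0\<^sub>m k q) (0\<^sub>m q k) (adj N * N)"
    using c mult_carrier_mat[OF adj_carrier[OF c(1)] c(1)] mult_carrier_mat[OF adj_carrier[OF
        c(2)] c(2)]
    by (simp add: mult_four_block_mat[of _ k k _ q _ q _ _ k _ q])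
  thus "adj ?D * ?D = 1\<^sub>m (k + q)"
    using assms by (simp add: unitary_circ_adj four_block_one_mat)
qed

section \<open>Splitting off the kernel of a matrix\<close>

text \<open>
The first column of the rotation is the unit vector \<open>(s, t)\<close> proportional to \<open>(a, b)\<close>, and
\<open>h = a s\<^sup>* + b t\<^sup>*\<close> is the inner product of the two.
\<close>

lemma givens_rotation:
  obtains G h where "G \<in> unitary_circ 2" "vec_of_list [a, b] = G *\<^sub>v vec_of_list [h, 0]"
proof -
  obtain s t where st: "cconj s * s + cconj t * t = 1" "a * t = b * s"
    using unit_pair_proportional by blast
  define G where "G = mat_of_rows_list 2 [[s, - cconj t], [t, cconj s]]"
  have e: "G $$ (0,0) = s" "G $$ (0,1) = - cconj t" "G $$ (1,0) = t" "G $$ (1,1) = cconj s"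
    "dim_row G = 2" "dim_col G = 2"
    by (auto simp: G_def mat_of_rows_list_def)
  have cc: "cconj (cconj s) = s" "cconj (- cconj t) = - t" by (auto intro!: circ_eqI)
  have "adj G * G = 1\<^sub>m 2"
  proof (rule eq_matI)
    fix i j assume "i < dim_row (1\<^sub>m 2 :: circ mat)" "j < dim_col (1\<^sub>m 2 :: circ mat)"
    hence "i \<in> {0,1}" "j \<in> {0,1}" by auto
    thus "(adj G * G) $$ (i, j) = 1\<^sub>m 2 $$ (i, j)"
      using st(1) e cc by (auto simp: scalar_prod_def numeral_2_eq_2 mult_ac add_ac)
  qed (use e in auto)
  hence "G \<in> unitary_circ 2" using e by (intro unitary_circI) auto
  moreover have "vec_of_list [a, b] = G *\<^sub>v vec_of_list [a * cconj s + b * cconj t, 0]"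
  proof (rule eq_vecI)
    have "a = s * (a * cconj s + b * cconj t)"
    proof -
      have "s * (a * cconj s + b * cconj t) = a * (cconj s * s) + (b * s) * cconj t"
        by (simp add: algebra_simps)
      also have "\<dots> = a * (cconj s * s + cconj t * t)"
        by (simp add: st(2)[symmetric] algebra_simps)
      finally show ?thesis using st(1) by simp
    qed
    moreover have "b = t * (a * cconj s + b * cconj t)"
    proof -
      have "t * (a * cconj s + b * cconj t) = (a * t) * cconj s + b * (cconj t * t)"
        by (simp add: algebra_simps)
      also have "\<dots> = b * (cconj s * s + cconj t * t)"
        by (simp add: st(2) algebra_simps)
      finally show ?thesis using st(1) by simp
    qed
    moreover fix i assume "i < dim_vec (G *\<^sub>v vec_of_list [a * cconj s + b * cconj t, 0])"
    hence "i \<in> {0,1}" using e by auto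
    ultimately show "vec_of_list [a, b] $ i = (G *\<^sub>v vec_of_list [a * cconj s + b * cconj t, 0]) $ i"
      using e by (auto simp: scalar_prod_def numeral_2_eq_2)
  qed (use e in auto)
  ultimately show ?thesis using that by blast
qed

definition first_coord :: "nat \<Rightarrow> circ \<Rightarrow> circ vec" where
  "first_coord d g = vec d (\<lambda>i. if i = 0 then g else 0)"

text \<open>
The last coordinates are collected in the second one by induction, and a Givens rotation moves
that one to the first.
\<close>

lemma rotate_to_first_coord:
  assumes "v \<in> carrier_vec (Suc d)"
  shows "\<exists>N \<in> unitary_circ (Suc d). \<exists>g. v = N *\<^sub>v first_coord (Suc d) g"
  using assms
proof (induction d arbitrary: v)
  case 0
  hence "v = 1\<^sub>m (Suc 0) *\<^sub>v first_coord (Suc 0) (v $ 0)"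
    by (intro eq_vecI) (auto simp: first_coord_def)
  thus ?case using one_unitary by blast
next
  case (Suc d)
  define w where "w = vec (Suc d) (\<lambda>i. v $ Suc i)"
  have v: "v = vec 1 (\<lambda>_. v $ 0) @\<^sub>v w"
    using Suc.prems by (intro eq_vecI) (auto simp: w_def)
  obtain N' g where N': "N' \<in> unitary_circ (Suc d)" "w = N' *\<^sub>v first_coord (Suc d) g"
    using Suc.IH[of w] by (auto simp: w_def)
  obtain G h where G: "G \<in> unitary_circ 2" "vec_of_list [v $ 0, g] = G *\<^sub>v vec_of_list [h, 0]"
    by (rule givens_rotation)
  let ?D = "four_block_mat (1\<^sub>m 1) (0\<^sub>m 1 (Suc d)) (0\<^sub>m (Suc d) 1) N'"
  let ?E = "four_block_mat G (0\<^sub>m 2 d) (0\<^sub>m d 2) (1\<^sub>m d)"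
  have D: "?D \<in> unitary_circ (Suc (Suc d))" using diag_unitary[OF one_unitary[of 1] N'(1)] by simp
  have E: "?E \<in> unitary_circ (Suc (Suc d))" using diag_unitary[OF G(1) one_unitary[of d]] by (simp
      only: add_2_eq_Suc)
  note c = D[THEN unitary_circ_carrier] E[THEN unitary_circ_carrier] N'(1)[THEN unitary_circ_carrier]
    G(1)[THEN unitary_circ_carrier]
  have f: "first_coord (Suc d) g \<in> carrier_vec (Suc d)" "vec_of_list [h, 0] \<in> carrier_vec 2"
    by (auto simp: first_coord_def intro!: carrier_vecI)
  have "v = ?D *\<^sub>v (vec 1 (\<lambda>_. v $ 0) @\<^sub>v first_coord (Suc d) g)"
    by (subst mult_mat_vec_split[OF _ c(3)]) (use v N'(2) f in auto)
  also have "vec 1 (\<lambda>_. v $ 0) @\<^sub>v first_coord (Suc d) g = vec_of_list [v $ 0, g] @\<^sub>v 0\<^sub>v d"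
  proof (rule eq_vecI)
    fix i assume "i < dim_vec (vec_of_list [v $ 0, g] @\<^sub>v 0\<^sub>v d)"
    thus "(vec 1 (\<lambda>_. v $ 0) @\<^sub>v first_coord (Suc d) g) $ i = (vec_of_list [v $ 0, g] @\<^sub>v 0\<^sub>v d) $ i"
      by (cases i; cases "i - 1") (auto simp: first_coord_def)
  qed (auto simp: first_coord_def)
  also have "\<dots> = ?E *\<^sub>v (vec_of_list [h, 0] @\<^sub>v 0\<^sub>v d)"
    by (subst mult_mat_vec_split[OF c(4)]) (use G(2) f in auto)
  also have "vec_of_list [h, 0] @\<^sub>v 0\<^sub>v d = first_coord (Suc (Suc d)) h"
  proof (rule eq_vecI)
    fix i assume "i < dim_vec (first_coord (Suc (Suc d)) h)"
    thus "(vec_of_list [h, 0] @\<^sub>v 0\<^sub>v d) $ i = first_coord (Suc (Suc d)) h $ i"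
      by (cases i; cases "i - 1") (auto simp: first_coord_def)
  qed (auto simp: first_coord_def)
  also have "?D *\<^sub>v (?E *\<^sub>v first_coord (Suc (Suc d)) h) = (?D * ?E) *\<^sub>v first_coord (Suc (Suc d)) h"
    using c by (intro assoc_mult_mat_vec[symmetric]) (auto simp: first_coord_def)
  finally show ?case using mult_unitary[OF D E] by blast
qed

text \<open>
A nonzero kernel vector is rotated into a multiple \<open>g\<close> of the first unit vector. As \<open>g\<close> can be
cancelled in an integral domain, the first column of the rotated matrix is zero, and the other
columns are treated by induction. At each point where \<open>C\<close> is injective, the first \<open>k\<close> columns of
\<open>N\<close> are an orthonormal basis of the kernel of \<open>A\<close>.
\<close>

lemma kernel_splitting:
  assumes "A \<in> carrier_mat m d"
  shows "\<exists>k q N C. d = k + q \<and> N \<in> unitary_circ d \<and> C \<in> carrier_mat m q \<and> inj_mat C \<and>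
    (\<forall>a \<in> carrier_vec k. \<forall>b \<in> carrier_vec q. A *\<^sub>v (N *\<^sub>v (a @\<^sub>v b)) = C *\<^sub>v b)"
  using assms
proof (induction d arbitrary: A)
  case 0
  show ?case
    by (rule exI[of _ 0], rule exI[of _ 0], rule exI[of _ "1\<^sub>m 0"], rule exI[of _ A])
      (use 0 one_unitary[of 0] in \<open>auto simp: inj_mat_def intro!: arg_cong[of _ _ "\<lambda>v. A *\<^sub>v v"]\<close>)
next
  case (Suc d)
  show ?case
  proof (cases "inj_mat A")
    case True
    have "a @\<^sub>v b = b" if "a \<in> carrier_vec 0" for a b :: "circ vec"
      using that by (intro eq_vecI) auto
    thus ?thesis
      by (intro exI[of _ 0] exI[of _ "Suc d"] exI[of _ "1\<^sub>m (Suc d)"] exI[of _ A])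
        (use True Suc.prems one_unitary in auto)
  next
    case False
    then obtain v where v: "v \<in> carrier_vec (Suc d)" "A *\<^sub>v v = 0\<^sub>v m" "v \<noteq> 0\<^sub>v (Suc d)"
      using Suc.prems by (auto simp: inj_mat_def)
    obtain N0 g where N0: "N0 \<in> unitary_circ (Suc d)" "v = N0 *\<^sub>v first_coord (Suc d) g"
      using rotate_to_first_coord[OF v(1)] by blast
    note N0c = unitary_circ_carrier[OF N0(1)]
    have fc: "first_coord (Suc d) g \<in> carrier_vec (Suc d)" by (simp add: first_coord_def)
    have "g \<noteq> 0"
    proof
      assume "g = 0"
      hence "first_coord (Suc d) g = 0\<^sub>v (Suc d)" by (intro eq_vecI) (auto simp: first_coord_def)
      thus False using v(3) N0(2) N0c by auto
    qed
    define X where "X = A * N0"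
    have X: "X \<in> carrier_mat m (Suc d)" using Suc.prems N0c by (simp add: X_def)
    have X0: "X $$ (i, 0) = 0" if i: "i < m" for i
    proof -
      have "X *\<^sub>v first_coord (Suc d) g = 0\<^sub>v m"
        unfolding X_def by (subst assoc_mult_mat_vec[OF Suc.prems N0c fc]) (use v(2) N0(2) in simp)
      hence "(X *\<^sub>v first_coord (Suc d) g) $ i = 0" using i by simp
      also have "(X *\<^sub>v first_coord (Suc d) g) $ i = X $$ (i, 0) * g"
        using i X by (auto simp: scalar_prod_def first_coord_def sum.atLeast0_lessThan_Suc_shift
          simp del: sum.op_ivl_Suc)
      finally show ?thesis using \<open>g \<noteq> 0\<close> by simp
    qed
    define A' where "A' = mat m d (\<lambda>(i, j). X $$ (i, Suc j))"
    have A': "A' \<in> carrier_mat m d" by (simp add: A'_def)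
    have XA: "X *\<^sub>v (x @\<^sub>v w) = A' *\<^sub>v w" if "x \<in> carrier_vec 1" "w \<in> carrier_vec d" for x w
    proof (rule eq_vecI)
      fix i assume "i < dim_vec (A' *\<^sub>v w)"
      thus "(X *\<^sub>v (x @\<^sub>v w)) $ i = (A' *\<^sub>v w) $ i"
        using that X X0[of i] by (auto simp: scalar_prod_def A'_def sum.atLeast0_lessThan_Suc_shift
          simp del: sum.op_ivl_Suc)
    qed (use X in \<open>auto simp: A'_def\<close>)
    obtain k q N' C where IH: "d = k + q" "N' \<in> unitary_circ d" "C \<in> carrier_mat m q" "inj_mat C"
      "\<And>a b. a \<in> carrier_vec k \<Longrightarrow> b \<in> carrier_vec q \<Longrightarrow> A' *\<^sub>v (N' *\<^sub>v (a @\<^sub>v b)) = C *\<^sub>v b"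
      using Suc.IH[OF A'] by blast
    note N'c = unitary_circ_carrier[OF IH(2)]
    let ?D = "four_block_mat (1\<^sub>m 1) (0\<^sub>m 1 d) (0\<^sub>m d 1) N'"
    have D: "?D \<in> unitary_circ (Suc d)" using diag_unitary[OF one_unitary[of 1] IH(2)] by simp
    note Dc = unitary_circ_carrier[OF D]
    have "A *\<^sub>v ((N0 * ?D) *\<^sub>v (a @\<^sub>v b)) = C *\<^sub>v b"
      if a: "a \<in> carrier_vec (Suc k)" and b: "b \<in> carrier_vec q" for a b
    proof -
      define a' where "a' = vec k (\<lambda>i. a $ Suc i)"
      have a': "a' \<in> carrier_vec k" by (simp add: a'_def)
      have c: "a @\<^sub>v b \<in> carrier_vec (Suc d)" "a' @\<^sub>v b \<in> carrier_vec d"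
        using a' a b IH(1) by (auto simp del: append_carrier_vec intro!: carrier_vecI)
      have split: "a @\<^sub>v b = vec 1 (\<lambda>_. a $ 0) @\<^sub>v (a' @\<^sub>v b)"
      proof (rule eq_vecI)
        fix i assume "i < dim_vec (vec 1 (\<lambda>_. a $ 0) @\<^sub>v (a' @\<^sub>v b))"
        thus "(a @\<^sub>v b) $ i = (vec 1 (\<lambda>_. a $ 0) @\<^sub>v (a' @\<^sub>v b)) $ i"
          using a by (cases i) (auto simp: a'_def)
      qed (use a in \<open>auto simp: a'_def\<close>)
      have "A *\<^sub>v ((N0 * ?D) *\<^sub>v (a @\<^sub>v b)) = X *\<^sub>v (?D *\<^sub>v (a @\<^sub>v b))"
        unfolding X_def
        by (subst assoc_mult_mat_vec[OF N0c Dc c(1)], subst assoc_mult_mat_vec[OF Suc.prems N0c])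
          (use Dc c(1) in auto)
      also have "?D *\<^sub>v (a @\<^sub>v b) = vec 1 (\<lambda>_. a $ 0) @\<^sub>v (N' *\<^sub>v (a' @\<^sub>v b))"
        unfolding split by (subst mult_mat_vec_split[OF _ N'c]) (use c in auto)
      also have "X *\<^sub>v \<dots> = A' *\<^sub>v (N' *\<^sub>v (a' @\<^sub>v b))"
        by (rule XA) (use N'c c in auto)
      also have "\<dots> = C *\<^sub>v b" by (rule IH(5)[OF a' b])
      finally show ?thesis .
    qed
    thus ?thesis
      by (intro exI[of _ "Suc k"] exI[of _ q] exI[of _ "N0 * ?D"] exI[of _ C])
        (use IH mult_unitary[OF N0(1) D] in auto)
  qed
qed

section \<open>Reduction of a cocycle by its kernel\<close>

lemma map_mat_ident [simp]: "map_mat (\<lambda>a. a) M = M"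
  by (rule eq_matI) auto

text \<open>
The iterates of a cocycle, as matrices over \<open>circ\<close>.
\<close>

primrec itc :: "real \<Rightarrow> circ mat \<Rightarrow> nat \<Rightarrow> circ mat" where
  "itc a A 0 = 1\<^sub>m (dim_row A)"
| "itc a A (Suc n) = shm (real n * a) A * itc a A n"

lemma itc_carrier [simp]: "A \<in> carrier_mat d d \<Longrightarrow> itc a A n \<in> carrier_mat d d"
  by (induction n) auto

lemma itc_conj:
  assumes c: "A \<in> carrier_mat d d" "N \<in> carrier_mat d d" "B \<in> carrier_mat d d"
    and eq: "A * N = shm a N * B"
  shows "itc a A n * N = shm (real n * a) N * itc a B n"
proof (induction n)
  case 0 thus ?case using c by simp
next
  case (Suc n)
  have "itc a A (Suc n) * N = shm (real n * a) A * (itc a A n * N)"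
    using c by (simp add: assoc_mult_mat[of _ d d _ d _ d])
  also have "\<dots> = (shm (real n * a) A * shm (real n * a) N) * itc a B n"
    using c by (simp add: Suc assoc_mult_mat[of _ d d _ d _ d])
  also have "shm (real n * a) A * shm (real n * a) N = shm (real n * a) (shm a N * B)"
    using c by (simp add: shift_hom.mat_hom_mult[OF c(1,2), symmetric] eq)
  also have "\<dots> = shm (real (Suc n) * a) N * shm (real n * a) B"
    using c by (subst shift_hom.mat_hom_mult[of _ d d _ d]) (auto simp: shm_shm algebra_simps)
  also have "\<dots> * itc a B n = shm (real (Suc n) * a) N * itc a B (Suc n)"
    using c by (simp add: assoc_mult_mat[of _ d d _ d _ d])
  finally show ?case .
qed

text \<open>
The block matrix \<open>[0 | G]\<close> with \<open>k\<close> zero columns.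
\<close>

definition zcols :: "nat \<Rightarrow> 'a :: comm_ring_1 mat \<Rightarrow> 'a mat" where
  "zcols k G = mat (dim_row G) (k + dim_col G) (\<lambda>(i, j). if j < k then 0 else G $$ (i, j - k))"

definition lower :: "nat \<Rightarrow> 'a :: comm_ring_1 mat \<Rightarrow> 'a mat" where
  "lower k G = mat (dim_row G - k) (dim_col G) (\<lambda>(i, j). G $$ (k + i, j))"

definition upper :: "nat \<Rightarrow> 'a :: comm_ring_1 mat \<Rightarrow> 'a mat" where
  "upper k G = mat k (dim_col G) (\<lambda>(i, j). G $$ (i, j))"

lemma zcols_carrier [simp]: "G \<in> carrier_mat m q \<Longrightarrow> zcols k G \<in> carrier_mat m (k + q)"
  by (auto simp: zcols_def)

lemma lower_carrier [simp]: "G \<in> carrier_mat (k + q) m \<Longrightarrow> lower k G \<in> carrier_mat q m"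
  by (auto simp: lower_def)

lemma upper_carrier [simp]: "G \<in> carrier_mat (k + q) m \<Longrightarrow> upper k G \<in> carrier_mat k m"
  by (auto simp: upper_def)

lemma shm_zcols: "shm a (zcols k G) = zcols k (shm a G)"
  by (auto simp: zcols_def intro!: eq_matI)

lemma shm_lower: "shm a (lower k G) = lower k (shm a G)"
  by (auto simp: lower_def intro!: eq_matI)

lemma zcols_eq_zero_iff:
  fixes Y :: "'a :: comm_ring_1 mat"
  assumes "Y \<in> carrier_mat m q"
  shows "zcols k Y = 0\<^sub>m m (k + q) \<longleftrightarrow> Y = 0\<^sub>m m q"
proof
  assume 0: "zcols k Y = 0\<^sub>m m (k + q)"
  show "Y = 0\<^sub>m m q"
  proof (rule eq_matI)
    fix i j assume "i < dim_row (0\<^sub>m m q :: 'a mat)" "j < dim_col (0\<^sub>m m q :: 'a mat)"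
    hence ij: "i < m" "j < q" by auto
    have "zcols k Y $$ (i, k + j) = Y $$ (i, j)" using ij assms by (auto simp: zcols_def)
    thus "Y $$ (i, j) = 0\<^sub>m m q $$ (i, j)" using 0 ij by simp
  qed (use assms in auto)
qed (auto simp: zcols_def intro!: eq_matI)

lemma zcols_mult_vec:
  assumes "G \<in> carrier_mat m q" "a \<in> carrier_vec k" "b \<in> carrier_vec q"
  shows "zcols k G *\<^sub>v (a @\<^sub>v b) = G *\<^sub>v b"
proof (rule eq_vecI)
  fix i assume "i < dim_vec (G *\<^sub>v b)"
  hence i: "i < m" using assms by simp
  have "(zcols k G *\<^sub>v (a @\<^sub>v b)) $ i =
      (\<Sum>j = 0..<k + q. (if j < k then 0 else G $$ (i, j - k)) * ((a @\<^sub>v b) $ j))"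
    using assms i by (simp add: zcols_def scalar_prod_def)
  also have "\<dots> = (\<Sum>j = k..<k + q. (if j < k then 0 else G $$ (i, j - k)) * ((a @\<^sub>v b) $ j))"
    by (intro sum.mono_neutral_right) auto
  also have "\<dots> = (\<Sum>j = 0..<q. (if j + k < k then 0 else G $$ (i, j + k - k)) * ((a @\<^sub>v b) $ (j + k)))"
    using sum.shift_bounds_nat_ivl[of "\<lambda>j. (if j < k then 0 else G $$ (i, j - k)) * ((a @\<^sub>v b) $
        j)" 0 k q]
    by (simp add: add.commute)
  also have "\<dots> = (\<Sum>j = 0..<q. G $$ (i, j) * b $ j)"
    using assms by (intro sum.cong) auto
  also have "\<dots> = (G *\<^sub>v b) $ i"
    using assms i by (simp add: scalar_prod_def)
  finally show "(zcols k G *\<^sub>v (a @\<^sub>v b)) $ i = (G *\<^sub>v b) $ i" .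
qed (use assms in \<open>simp add: zcols_def\<close>)

lemma upper_lower_mult_vec:
  assumes "G \<in> carrier_mat (k + q) m" "b \<in> carrier_vec m"
  shows "G *\<^sub>v b = (upper k G *\<^sub>v b) @\<^sub>v (lower k G *\<^sub>v b)"
  using assms by (intro eq_vecI) (auto simp: scalar_prod_def upper_def lower_def)

lemma lower_mult:
  assumes "G \<in> carrier_mat (k + q) m" "X \<in> carrier_mat m n"
  shows "lower k (G * X) = lower k G * X"
  using assms by (intro eq_matI) (auto simp: scalar_prod_def lower_def)

lemma mat_eq_by_append_vec:
  fixes M M' :: "'a :: comm_ring_1 mat"
  assumes "M \<in> carrier_mat m (k + q)" "M' \<in> carrier_mat m (k + q)"
    and "\<And>a b. a \<in> carrier_vec k \<Longrightarrow> b \<in> carrier_vec q \<Longrightarrow> M *\<^sub>v (a @\<^sub>v b) = M' *\<^sub>v (a @\<^sub>v b)"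
  shows "M = M'"
proof (rule mat_eq_by_vec[OF assms(1,2)])
  fix v :: "'a vec" assume "v \<in> carrier_vec (k + q)"
  hence "v = vec_first v k @\<^sub>v vec_last v q" by simp
  thus "M *\<^sub>v v = M' *\<^sub>v v" using assms(3)[of "vec_first v k" "vec_last v q"] by simp
qed

lemma zcols_mult_zcols:
  fixes X G :: "'a :: comm_ring_1 mat"
  assumes "X \<in> carrier_mat m q" "G \<in> carrier_mat (k + q) q"
  shows "zcols k X * zcols k G = zcols k (X * lower k G)"
proof (rule mat_eq_by_append_vec[of _ m k q])
  fix a b :: "'a vec" assume ab: "a \<in> carrier_vec k" "b \<in> carrier_vec q"
  have "zcols k X * zcols k G *\<^sub>v (a @\<^sub>v b) = zcols k X *\<^sub>v (G *\<^sub>v b)"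
    using assms ab
    by (subst assoc_mult_mat_vec[of _ m "k + q" _ "k + q"]) (auto simp: zcols_mult_vec)
  also have "\<dots> = X *\<^sub>v (lower k G *\<^sub>v b)"
    unfolding upper_lower_mult_vec[OF assms(2) ab(2)]
    using mult_mat_vec_carrier[OF upper_carrier[OF assms(2)] ab(2)]
      mult_mat_vec_carrier[OF lower_carrier[OF assms(2)] ab(2)]
    by (rule zcols_mult_vec[OF assms(1)])
  also have "\<dots> = zcols k (X * lower k G) *\<^sub>v (a @\<^sub>v b)"
    using assms ab zcols_mult_vec[of "X * lower k G" m q a k b]
    by (subst assoc_mult_mat_vec[symmetric, of _ m q _ q]) auto
  finally show "zcols k X * zcols k G *\<^sub>v (a @\<^sub>v b) = zcols k (X * lower k G) *\<^sub>v (a @\<^sub>v b)" .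
next
  show "zcols k X * zcols k G \<in> carrier_mat m (k + q)"
    using assms by (intro mult_carrier_mat[of _ _ "k + q"] zcols_carrier)
  show "zcols k (X * lower k G) \<in> carrier_mat m (k + q)"
    using assms by (intro zcols_carrier mult_carrier_mat[of _ _ q] lower_carrier)
qed

text \<open>
The rows of \<open>[0 | G]\<close> that meet the zero columns of the next factor are lost, so only the lower
block of \<open>G\<close> is iterated.
\<close>

lemma itc_zcols:
  assumes G: "G \<in> carrier_mat (k + q) q"
  shows "itc a (zcols k G) (Suc n) = zcols k (shm (real n * a) G * itc a (lower k G) n)"
proof (induction n)
  case 0
  have Z: "zcols k G \<in> carrier_mat (k + q) (k + q)" using G by simp
  show ?case using carrier_matD[OF Z] carrier_matD[OF lower_carrier[OF G]] right_mult_one_mat[OF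
      Z] right_mult_one_mat[OF G] by simp
next
  case (Suc n)
  note L = lower_carrier[OF G]
  have "itc a (zcols k G) (Suc (Suc n)) =
      zcols k (shm (real (Suc n) * a) G) * zcols k (shm (real n * a) G * itc a (lower k G) n)"
    by (subst itc.simps(2)) (simp only: Suc shm_zcols)
  also have "\<dots> = zcols k (shm (real (Suc n) * a) G * lower k (shm (real n * a) G * itc a (lower k
      G) n))"
    using G L by (intro zcols_mult_zcols) auto
  also have "lower k (shm (real n * a) G * itc a (lower k G) n) = itc a (lower k G) (Suc n)"
    using G L by (subst lower_mult[of _ k q q _ q]) (auto simp: shm_lower)
  finally show ?case .
qed

text \<open>
The kernel frame \<open>N\<close> serves as coordinates both at \<open>x\<close> and at \<open>x + a\<close>.
\<close>

lemma cocycle_reduction: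
  assumes A: "A \<in> carrier_mat d d"
  obtains k q N G where "d = k + q" "N \<in> unitary_circ d" "G \<in> carrier_mat d q" "inj_mat G"
    "A * N = shm a N * zcols k G"
proof -
  obtain k q N C where d: "d = k + q" and N: "N \<in> unitary_circ d" and C: "C \<in> carrier_mat d q"
      "inj_mat C"
    and AN: "\<And>a b. a \<in> carrier_vec k \<Longrightarrow> b \<in> carrier_vec q \<Longrightarrow> A *\<^sub>v (N *\<^sub>v (a @\<^sub>v b)) = C *\<^sub>v b"
    using kernel_splitting[OF A] by blast
  note Nc = unitary_circ_carrier[OF N]
  have M: "shm a N \<in> unitary_circ d" by (rule shm_unitary[OF N])
  note Mc = unitary_circ_carrier[OF M]
  define G where "G = adj (shm a N) * C"
  have G: "G \<in> carrier_mat d q" unfolding G_def using adj_carrier[OF Mc] C by simp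
  have MG: "shm a N * G = C"
    unfolding G_def using adj_carrier[OF Mc] C Mc unitary_circ_adj[OF M]
    by (subst assoc_mult_mat[symmetric, of _ d d _ d _ q]) auto
  have "inj_mat G"
    unfolding inj_mat_def
  proof (intro ballI impI)
    fix v assume v: "v \<in> carrier_vec (dim_col G)" "G *\<^sub>v v = 0\<^sub>v (dim_row G)"
    have "C *\<^sub>v v = shm a N *\<^sub>v (G *\<^sub>v v)"
      using v(1) G Mc by (subst MG[symmetric], subst assoc_mult_mat_vec[of _ d d _ q]) auto
    also have "\<dots> = 0\<^sub>v d" using v G Mc by auto
    finally show "v = 0\<^sub>v (dim_col G)" using C v G inj_matD[OF C(2,1)] by auto
  qed
  moreover have "A * N = shm a N * zcols k G"
  proof (rule mat_eq_by_append_vec[of _ d k q])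
    fix u b :: "circ vec" assume ub: "u \<in> carrier_vec k" "b \<in> carrier_vec q"
    hence c: "u @\<^sub>v b \<in> carrier_vec d" using d by simp
    have "A * N *\<^sub>v (u @\<^sub>v b) = C *\<^sub>v b"
      using AN[OF ub] by (subst assoc_mult_mat_vec[OF A Nc c])
    also have "\<dots> = shm a N *\<^sub>v (G *\<^sub>v b)"
      using ub G Mc by (subst MG[symmetric], subst assoc_mult_mat_vec[of _ d d _ q]) auto
    also have "G *\<^sub>v b = zcols k G *\<^sub>v (u @\<^sub>v b)" using zcols_mult_vec[OF G ub] by simp
    also have "shm a N *\<^sub>v \<dots> = shm a N * zcols k G *\<^sub>v (u @\<^sub>v b)"
      using G d by (intro assoc_mult_mat_vec[OF Mc _ c, symmetric]) auto
    finally show "A * N *\<^sub>v (u @\<^sub>v b) = shm a N * zcols k G *\<^sub>v (u @\<^sub>v b)" .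
  qed (use A Nc Mc G d zcols_carrier[OF G, of k] in auto)
  ultimately show ?thesis using that[OF d N G] by blast
qed

lemma inj_mat_mult_eq_zero:
  assumes "inj_mat C" "C \<in> carrier_mat m q" "X \<in> carrier_mat q n" "C * X = 0\<^sub>m m n"
  shows "X = 0\<^sub>m q n"
proof (rule mat_eq_by_vec[OF assms(3)])
  fix v :: "'a vec" assume v: "v \<in> carrier_vec n"
  have "C *\<^sub>v (X *\<^sub>v v) = 0\<^sub>v m"
    using assms v by (subst assoc_mult_mat_vec[symmetric, of _ m q _ n]) auto
  hence "X *\<^sub>v v = 0\<^sub>v q"
    by (intro inj_matD[OF assms(1,2)] mult_mat_vec_carrier[OF assms(3) v])
  also have "0\<^sub>v q = 0\<^sub>m q n *\<^sub>v v" using v by auto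
  finally show "X *\<^sub>v v = 0\<^sub>m q n *\<^sub>v v" .
qed simp

lemma inj_mat_shm:
  assumes "inj_mat C" shows "inj_mat (shm a C)"
  unfolding inj_mat_def
proof (intro ballI impI)
  fix v assume v: "v \<in> carrier_vec (dim_col (shm a C))" "shm a C *\<^sub>v v = 0\<^sub>v (dim_row (shm a C))"
  have "C *\<^sub>v shv (- a) v = shv (- a) (shm a C *\<^sub>v v)"
    using v(1) by (subst shift_hom.mult_mat_vec_hom[of _ "dim_row C" "dim_col C"]) (auto simp: shm_shm)
  also have "\<dots> = 0\<^sub>v (dim_row C)" using v(2) by (simp add: shift_hom.vec_hom_zero)
  finally have "shv (- a) v = 0\<^sub>v (dim_col C)" using assms v(1) by (auto simp: inj_mat_def)
  hence "shv a (shv (- a) v) = 0\<^sub>v (dim_col C)" by (simp add: shift_hom.vec_hom_zero)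
  thus "v = 0\<^sub>v (dim_col (shm a C))" by (simp add: shv_shv)
qed

text \<open>
In the coordinates \<open>N\<close> the iterate number \<open>n + 1\<close> of \<open>A\<close> is \<open>[0 | G(x + n a) L\<^sub>n(x)]\<close>, where \<open>L\<close> is
the lower block of \<open>G\<close>, and translates of \<open>G\<close> are injective. So the lower block has a nilpotency
degree that is smaller by exactly one.
\<close>

lemma itc_reduction_zero_iff:
  assumes A: "A \<in> carrier_mat d d" and d: "d = k + q" and N: "N \<in> unitary_circ d"
    and G: "G \<in> carrier_mat d q" "inj_mat G" and eq: "A * N = shm a N * zcols k G"
  shows "itc a A (Suc n) = 0\<^sub>m d d \<longleftrightarrow> itc a (lower k G) n = 0\<^sub>m q q"
proof -
  note Nc = unitary_circ_carrier[OF N]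
  have G': "G \<in> carrier_mat (k + q) q" using G d by simp
  have M: "shm (real (Suc n) * a) N \<in> unitary_circ d" by (rule shm_unitary[OF N])
  note Mc = unitary_circ_carrier[OF M]
  let ?Y = "shm (real n * a) G * itc a (lower k G) n"
  note L = lower_carrier[OF G']
  have Y: "?Y \<in> carrier_mat d q" using G L by auto
  have Z: "zcols k ?Y \<in> carrier_mat d d" using zcols_carrier[OF Y, of k] d by simp
  have B: "zcols k G \<in> carrier_mat d d" using zcols_carrier[OF G(1), of k] d by simp
  have conj: "itc a A (Suc n) * N = shm (real (Suc n) * a) N * zcols k ?Y"
    using itc_conj[OF A Nc B eq, of "Suc n"] itc_zcols[OF G', of a n] by simp
  have I: "itc a A (Suc n) \<in> carrier_mat d d" using A by (rule itc_carrier)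
  have "itc a A (Suc n) = 0\<^sub>m d d \<longleftrightarrow> zcols k ?Y = 0\<^sub>m d d"
  proof
    assume "itc a A (Suc n) = 0\<^sub>m d d"
    hence "shm (real (Suc n) * a) N * zcols k ?Y = 0\<^sub>m d d" using conj Nc by simp
    hence "adj (shm (real (Suc n) * a) N) * (shm (real (Suc n) * a) N * zcols k ?Y) = 0\<^sub>m d d"
      using right_mult_zero_mat[OF adj_carrier[OF Mc], of d] by (simp only:)
    thus "zcols k ?Y = 0\<^sub>m d d"
      using assoc_mult_mat[OF adj_carrier[OF Mc] Mc Z] unitary_circ_adj[OF M] Z by simp
  next
    assume "zcols k ?Y = 0\<^sub>m d d"
    hence "itc a A (Suc n) * N = 0\<^sub>m d d" using conj Mc by simp
    hence "itc a A (Suc n) * N * adj N = 0\<^sub>m d d"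
      using left_mult_zero_mat[OF adj_carrier[OF Nc], of d] by (simp only:)
    thus "itc a A (Suc n) = 0\<^sub>m d d"
      using assoc_mult_mat[OF I Nc adj_carrier[OF Nc]] unitary_circ_adj(2)[OF N]
        right_mult_one_mat[OF I] by simp
  qed
  also have "\<dots> \<longleftrightarrow> ?Y = 0\<^sub>m d q"
    using zcols_eq_zero_iff[OF Y, of k] d by simp
  also have "\<dots> \<longleftrightarrow> itc a (lower k G) n = 0\<^sub>m q q"
    using inj_mat_mult_eq_zero[OF inj_mat_shm[OF G(2)], of "real n * a" d q "itc a (lower k G) n" q] G L
    by auto
  finally show ?thesis .
qed

section \<open>The unitary block triangular form\<close>

lemma strictly_block_upper_Cons:
  fixes S :: "complex mat"
  assumes S: "S \<in> carrier_mat (k + q) (k + q)" and S': "S' \<in> carrier_mat q q"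
    and b: "strictly_block_upper_triangular ns S'" and sum: "sum_list ns = q"
    and left: "\<And>i j. i < k + q \<Longrightarrow> j < k \<Longrightarrow> S $$ (i, j) = 0"
    and right: "\<And>i j. i < q \<Longrightarrow> j < q \<Longrightarrow> S $$ (k + i, k + j) = S' $$ (i, j)"
  shows "strictly_block_upper_triangular (k # ns) S"
  unfolding strictly_block_upper_triangular_def
proof (intro allI impI ballI)
  fix u v i j assume u: "u < length (k # ns)" and v: "v \<le> u"
    and i: "i \<in> block_range (k # ns) u" and j: "j \<in> block_range (k # ns) v"
  have le: "sum_list (take w ns) \<le> q" for w
    using sum sum_list_append[of "take w ns" "drop w ns"] by (metis append_take_drop_id le_add1)
  have iq: "i < k + q"
    using i le[of u] by (cases u) (auto simp: block_range_def)
  show "S $$ (i, j) = 0"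
  proof (cases v)
    case 0
    thus ?thesis using left[OF iq] j by (auto simp: block_range_def)
  next
    case (Suc v')
    then obtain u' where u': "u = Suc u'" "v' \<le> u'" using v by (cases u) auto
    have "i - k \<in> block_range ns u'" "j - k \<in> block_range ns v'" "k \<le> i" "k \<le> j" "j < k + q"
      using i j Suc u' le[of "Suc v'"] by (auto simp: block_range_def)
    thus ?thesis using b u u' iq right[of "i - k" "j - k"]
      unfolding strictly_block_upper_triangular_def by auto
  qed
qed

text \<open>
The kernel of \<open>A\<close> is the first block, and the flag of the lower block, whose degree is \<open>p - 1\<close>,
gives the remaining ones. Starting the induction at \<open>p = 0\<close> means \<open>d = 0\<close>.
\<close>

lemma nilpotent_flag:
  assumes "A \<in> carrier_mat d d" "itc a A p = 0\<^sub>m d d" "\<And>n. n < p \<Longrightarrow> itc a A n \<noteq> 0\<^sub>m d d"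
  shows "\<exists>U \<in> unitary_circ d. \<exists>ns S. length ns = p \<and> block_sizes d ns \<and>
     S \<in> carrier_mat d d \<and> A * U = shm a U * S \<and>
     (\<forall>x. strictly_block_upper_triangular ns (evm x S))"
  using assms
proof (induction p arbitrary: d A)
  case 0
  have "d = 0" using 0 by (simp add: one_mat_eq_zero_iff)
  thus ?case using 0 one_unitary[of 0]
    by (intro bexI[of _ "1\<^sub>m 0"] exI[of _ "[]"] exI[of _ A])
      (auto simp: block_sizes_def strictly_block_upper_triangular_def)
next
  case (Suc p)
  note A = Suc.prems(1)
  obtain k q N G where d: "d = k + q" and N: "N \<in> unitary_circ d" and G: "G \<in> carrier_mat d q"
      "inj_mat G"
    and eq: "A * N = shm a N * zcols k G"
    by (rule cocycle_reduction[OF A])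
  note iff = itc_reduction_zero_iff[OF A d N G eq]
  have G': "G \<in> carrier_mat (k + q) q" using G d by simp
  note L = lower_carrier[OF G']
  have "itc a (lower k G) p = 0\<^sub>m q q" using Suc.prems(2) iff by blast
  moreover have "itc a (lower k G) n \<noteq> 0\<^sub>m q q" if "n < p" for n
    using Suc.prems(3)[of "Suc n"] iff[of n] that by auto
  ultimately obtain V ns S' where V: "V \<in> unitary_circ q" "length ns = p" "block_sizes q ns"
     "S' \<in> carrier_mat q q" "lower k G * V = shm a V * S'"
     "\<And>x. strictly_block_upper_triangular ns (evm x S')"
    using Suc.IH[OF L] by blast
  \<comment> \<open>If the kernel were trivial, the lower block would be conjugate to \<open>A\<close>, with the same degree.\<close>
  have "k > 0"
  proof (rule ccontr)
    assume "\<not> k > 0"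
    hence k: "k = 0" "q = d" using d by auto
    hence "lower k G = zcols k G" using G by (auto simp: lower_def zcols_def intro!: eq_matI)
    hence LG: "A * N = shm a N * lower k G" using eq by simp
    have "itc a A p * N = 0\<^sub>m d d"
      using itc_conj[OF A unitary_circ_carrier[OF N] _ LG, of p] L k \<open>itc a (lower k G) p = 0\<^sub>m q q\<close>
        unitary_circ_carrier[OF shm_unitary[OF N, of "real p * a"]] by simp
    hence "itc a A p * N * adj N = 0\<^sub>m d d"
      using left_mult_zero_mat[OF adj_carrier[OF unitary_circ_carrier[OF N]], of d] by (simp only:)
    hence "itc a A p = 0\<^sub>m d d"
      using assoc_mult_mat[OF itc_carrier[OF A] unitary_circ_carrier[OF N] adj_carrier[OF
          unitary_circ_carrier[OF N]], of a p]
        unitary_circ_adj(2)[OF N] right_mult_one_mat[OF itc_carrier[OF A]] by simp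
    thus False using Suc.prems(3)[of p] by simp
  qed
  define D where "D = four_block_mat (1\<^sub>m k) (0\<^sub>m k q) (0\<^sub>m q k) V"
  have D: "D \<in> unitary_circ d" unfolding D_def d by (rule diag_unitary[OF one_unitary V(1)])
  have E: "shm a D \<in> unitary_circ d" by (rule shm_unitary[OF D])
  note c = unitary_circ_carrier[OF N] unitary_circ_carrier[OF D] unitary_circ_carrier[OF E]
    unitary_circ_carrier[OF V(1)] unitary_circ_carrier[OF shm_unitary[OF N, of a]]
  have Z: "zcols k G \<in> carrier_mat d d" using zcols_carrier[OF G', of k] d by simp
  define S where "S = adj (shm a D) * (zcols k G * D)"
  have S: "S \<in> carrier_mat d d"
    unfolding S_def by (intro mult_carrier_mat[of _ _ d] adj_carrier c Z)
  have ES: "shm a D * S = zcols k G * D"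
    unfolding S_def assoc_mult_mat[OF c(3) adj_carrier[OF c(3)] mult_carrier_mat[OF Z c(2)], symmetric]
      unitary_circ_adj(2)[OF E] by (rule left_mult_one_mat[OF mult_carrier_mat[OF Z c(2)]])
  have "A * (N * D) = shm a N * (zcols k G * D)"
    unfolding assoc_mult_mat[OF A c(1,2), symmetric] eq by (rule assoc_mult_mat[OF c(5) Z c(2)])
  also have "\<dots> = shm a N * shm a D * S"
    unfolding ES[symmetric] by (rule assoc_mult_mat[OF c(5,3) S, symmetric])
  also have "shm a N * shm a D = shm a (N * D)"
    using shift_hom.mat_hom_mult[OF c(1,2)] by simp
  finally have AU: "A * (N * D) = shm a (N * D) * S" .
  have S_explicit: "S = four_block_mat (0\<^sub>m k k) (upper k G * V) (0\<^sub>m q k) S'"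
  proof -
    have Zb: "zcols k G = four_block_mat (0\<^sub>m k k) (upper k G) (0\<^sub>m q k) (lower k G)"
      using G' by (intro eq_matI) (auto simp: zcols_def upper_def lower_def)
    have aD: "adj (shm a D) = four_block_mat (1\<^sub>m k) (0\<^sub>m k q) (0\<^sub>m q k) (adj (shm a V))"
      unfolding D_def using c(4) by (intro eq_matI circ_eqI) auto
    note U = upper_carrier[OF G']
    have aV: "adj (shm a V) \<in> carrier_mat q q" using c(4) by (intro adj_carrier) simp
    have "zcols k G * D = four_block_mat (0\<^sub>m k k) (upper k G * V) (0\<^sub>m q k) (lower k G * V)"
      unfolding Zb D_def using U L c(4) mult_carrier_mat[OF U c(4)] mult_carrier_mat[OF L c(4)]
      by (simp add: mult_four_block_mat[of _ k k _ q _ q _ _ k _ q])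
    moreover have "adj (shm a V) * (lower k G * V) = S'"
      unfolding V(5)
        assoc_mult_mat[OF aV unitary_circ_carrier[OF shm_unitary[OF V(1)]] V(4), symmetric]
        unitary_circ_adj(1)[OF shm_unitary[OF V(1)]] by (rule left_mult_one_mat[OF V(4)])
    ultimately show ?thesis
      unfolding S_def aD using U L c(4) aV mult_carrier_mat[OF U c(4)] mult_carrier_mat[OF L c(4)] V(4)
      by (simp add: mult_four_block_mat[of _ k k _ q _ q _ _ k _ q])
  qed
  have "strictly_block_upper_triangular (k # ns) (evm x S)" for x
  proof (rule strictly_block_upper_Cons[of _ k q "evm x S'"])
    note U = mult_carrier_mat[OF upper_carrier[OF G'] c(4)]
    show "evm x S $$ (i, j) = 0" if "i < k + q" "j < k" for i j
      using that V(4) U unfolding S_explicit by auto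
    show "evm x S $$ (k + i, k + j) = evm x S' $$ (i, j)" if "i < q" "j < q" for i j
      using that V(4) U unfolding S_explicit by auto
  qed (use S d V in \<open>auto simp: block_sizes_def\<close>)
  moreover have "block_sizes d (k # ns)" using V(3) \<open>k > 0\<close> d by (auto simp: block_sizes_def)
  ultimately show ?case
    using mult_unitary[OF N D] V(2) S AU
    by (intro bexI[of _ "N * D"] exI[of _ "k # ns"] exI[of _ S]) auto
qed

section \<open>Entries and singular values\<close>

definition entry_norm :: "complex mat \<Rightarrow> real" where
  "entry_norm M = (\<Sum>i<dim_row M. \<Sum>j<dim_col M. norm (M $$ (i, j)))"

lemma entry_norm_nonneg [simp]: "entry_norm M \<ge> 0"
  by (auto simp: entry_norm_def intro!: sum_nonneg)

lemma norm_entry_le: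
  assumes "i < dim_row M" "j < dim_col M"
  shows "norm (M $$ (i, j)) \<le> entry_norm M"
proof -
  have "norm (M $$ (i, j)) \<le> (\<Sum>j<dim_col M. norm (M $$ (i, j)))"
    using assms by (intro member_le_sum) auto
  also have "\<dots> \<le> entry_norm M"
    unfolding entry_norm_def using assms
    by (intro member_le_sum[of i "{..<dim_row M}" "\<lambda>i. \<Sum>j<dim_col M. norm (M $$ (i, j))"])
       (auto intro: sum_nonneg)
  finally show ?thesis .
qed

lemma entry_norm_mult:
  assumes X: "X \<in> carrier_mat m n" and Y: "Y \<in> carrier_mat n l"
  shows "entry_norm (X * Y) \<le> entry_norm X * entry_norm Y"
proof -
  define r where "r k = (\<Sum>i<m. norm (X $$ (i, k)))" for k
  define s where "s k = (\<Sum>j<l. norm (Y $$ (k, j)))" for k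
  have nn: "r k \<ge> 0" "s k \<ge> 0" for k by (auto simp: r_def s_def intro: sum_nonneg)
  have "entry_norm (X * Y) = (\<Sum>i<m. \<Sum>j<l. norm (\<Sum>k<n. X $$ (i, k) * Y $$ (k, j)))"
    using X Y by (auto simp: entry_norm_def scalar_prod_def lessThan_atLeast0 intro!: sum.cong)
  also have "\<dots> \<le> (\<Sum>i<m. \<Sum>j<l. \<Sum>k<n. norm (X $$ (i, k)) * norm (Y $$ (k, j)))"
    by (intro sum_mono order_trans[OF norm_sum]) (simp add: norm_mult)
  also have "\<dots> = (\<Sum>i<m. \<Sum>k<n. \<Sum>j<l. norm (X $$ (i, k)) * norm (Y $$ (k, j)))"
    by (intro sum.cong refl sum.swap)
  also have "\<dots> = (\<Sum>i<m. \<Sum>k<n. norm (X $$ (i, k)) * s k)"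
    by (simp add: s_def sum_distrib_left)
  also have "\<dots> = (\<Sum>k<n. r k * s k)"
    by (subst sum.swap) (simp add: r_def sum_distrib_right)
  also have "\<dots> \<le> (\<Sum>k<n. r k * (\<Sum>k<n. s k))"
    using nn by (intro sum_mono mult_left_mono member_le_sum) auto
  also have "\<dots> = (\<Sum>k<n. r k) * (\<Sum>k<n. s k)" by (simp add: sum_distrib_right)
  also have "(\<Sum>k<n. r k) = entry_norm X"
    unfolding r_def entry_norm_def using X by (subst sum.swap) simp
  also have "(\<Sum>k<n. s k) = entry_norm Y"
    using Y by (auto simp: entry_norm_def s_def)
  finally show ?thesis .
qed

lemma entry_norm_unitary:
  assumes "N \<in> unitary_group d" shows "entry_norm N \<le> real d * real d"
proof -
  have N: "N \<in> carrier_mat d d" "mat_adjoint N * N = 1\<^sub>m d" using assms by (auto simp: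
      unitary_group_def)
  have "norm (N $$ (i, j)) \<le> 1" if ij: "i < d" "j < d" for i j
  proof -
    have "(mat_adjoint N * N) $$ (j, j) = (\<Sum>i<d. complex_of_real ((norm (N $$ (i, j)))\<^sup>2))"
      using N(1) ij by (auto simp: scalar_prod_def mat_adjoint_index lessThan_atLeast0
          complex_norm_square
          mult.commute simp del: of_real_power intro!: sum.cong)
    hence "complex_of_real (\<Sum>i<d. (norm (N $$ (i, j)))\<^sup>2) = 1" using N(2) ij by simp
    hence "(\<Sum>i<d. (norm (N $$ (i, j)))\<^sup>2) = 1" using of_real_eq_1_iff by blast
    moreover have "(norm (N $$ (i, j)))\<^sup>2 \<le> (\<Sum>i<d. (norm (N $$ (i, j)))\<^sup>2)"
      using ij by (intro member_le_sum[of i "{..<d}" "\<lambda>i. (norm (N $$ (i, j)))\<^sup>2"]) auto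
    ultimately show ?thesis by (simp add: power_le_one_iff abs_square_le_1)
  qed
  hence "(\<Sum>i<d. \<Sum>j<d. norm (N $$ (i, j))) \<le> (\<Sum>i<d. \<Sum>j<d. 1)"
    by (intro sum_mono) auto
  thus ?thesis using N(1) by (simp add: entry_norm_def)
qed

lemma norm_det_le:
  assumes M: "M \<in> carrier_mat d d"
  shows "norm (det M) \<le> fact d * entry_norm M ^ d"
proof -
  let ?P = "{p. p permutes {0..<d}}"
  have "norm (det M) \<le> (\<Sum>p\<in>?P. norm (signof p * (\<Prod>i = 0..<d. M $$ (i, p i)) :: complex))"
    unfolding det_def'[OF M] by (rule norm_sum)
  also have "\<dots> \<le> (\<Sum>p\<in>?P. entry_norm M ^ d)"
  proof (rule sum_mono)
    fix p assume "p \<in> ?P"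
    hence p: "\<And>i. i < d \<Longrightarrow> p i < d" by (auto simp: permutes_in_image)
    have "norm (signof p * (\<Prod>i = 0..<d. M $$ (i, p i)) :: complex) = (\<Prod>i = 0..<d. norm (M $$ (i, p i)))"
      by (simp add: norm_mult prod_norm sign_def)
    also have "\<dots> \<le> (\<Prod>i = 0..<d. entry_norm M)"
      using p M by (intro prod_mono) (auto intro: norm_entry_le)
    finally show "norm (signof p * (\<Prod>i = 0..<d. M $$ (i, p i)) :: complex) \<le> entry_norm M ^ d" by simp
  qed
  also have "\<dots> = fact d * entry_norm M ^ d" by (simp add: card_permutations)
  finally show ?thesis .
qed

definition trace_mat :: "'a :: comm_ring_1 mat \<Rightarrow> 'a" where
  "trace_mat A = (\<Sum>i<dim_row A. A $$ (i, i))"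

lemma trace_mult_commute:
  assumes "X \<in> carrier_mat n n" "Y \<in> carrier_mat n n"
  shows "trace_mat (X * Y) = trace_mat (Y * X)"
proof -
  have "trace_mat (X * Y) = (\<Sum>i<n. \<Sum>k<n. X $$ (i, k) * Y $$ (k, i))"
    using assms by (auto simp: trace_mat_def scalar_prod_def lessThan_atLeast0 intro!: sum.cong)
  also have "\<dots> = (\<Sum>k<n. \<Sum>i<n. Y $$ (k, i) * X $$ (i, k))"
    by (subst sum.swap) (simp add: mult.commute)
  also have "\<dots> = trace_mat (Y * X)"
    using assms by (auto simp: trace_mat_def scalar_prod_def lessThan_atLeast0 intro!: sum.cong)
  finally show ?thesis .
qed

lemma trace_eq_sum_eigenvalues:
  assumes H: "(H :: complex mat) \<in> carrier_mat n n"
  shows "trace_mat H = sum_mset (proots (char_poly H))"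
proof -
  obtain es where es: "char_poly H = (\<Prod>a\<leftarrow>es. [:- a, 1:])" using char_poly_factorized[OF H] by blast
  obtain B where B: "B \<in> carrier_mat n n" "upper_triangular B" "similar_mat H B"
    using schur_decomposition_exists[OF H es] by blast
  obtain P Q where PQ: "similar_mat_wit H B P Q" using B(3) by (auto simp: similar_mat_def)
  note w = similar_mat_witD2[OF H PQ]
  have "trace_mat H = trace_mat (P * (B * Q))"
    using w by (simp add: assoc_mult_mat[of _ n n _ n _ n])
  also have "\<dots> = trace_mat (B * Q * P)"
    using w by (intro trace_mult_commute) auto
  also have "B * Q * P = B" using w by (simp add: assoc_mult_mat[of _ n n _ n _ n])
  also have "trace_mat B = sum_list (diag_mat B)"
    using B(1) by (simp add: trace_mat_def diag_mat_def sum_list_sum_nth lessThan_atLeast0)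
  also have "\<dots> = sum_mset (proots (char_poly H))"
  proof -
    have "char_poly H = (\<Prod>p\<leftarrow>map (\<lambda>a. [:- a, 1:]) (diag_mat B). p)"
      using char_poly_similar[OF B(3)] char_poly_upper_triangular[OF B(1,2)] by simp
    hence "proots (char_poly H) = (\<Sum>p\<leftarrow>map (\<lambda>a. [:- a, 1:]) (diag_mat B). proots p)"
      by (simp only:) (rule proots_prod_list, auto)
    also have "\<dots> = mset (diag_mat B)" by (simp add: o_def)
    finally show ?thesis by (simp add: sum_mset_sum_list)
  qed
  finally show ?thesis .
qed

text \<open>
The trace of \<open>M\<^sup>* M\<close> is the sum of the squared moduli of the entries of \<open>M\<close>, and also the sum of
\<open>d\<close> eigenvalues, one of which has a real part at least as large as the mean.
\<close>

lemma sing_val_1_bounds: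
  assumes M: "M \<in> carrier_mat d d" and d: "d \<ge> 1"
  shows "sing_val 1 M \<ge> 0"
    and "(\<Sum>i<d. \<Sum>j<d. (norm (M $$ (i, j)))\<^sup>2) \<le> real d * (sing_val 1 M)\<^sup>2"
proof -
  let ?H = "mat_adjoint M * M"
  define S where "S = (\<Sum>i<d. \<Sum>j<d. (norm (M $$ (i, j)))\<^sup>2)"
  define P where "P = proots (char_poly ?H)"
  have A: "mat_adjoint M \<in> carrier_mat d d" using M by (intro carrier_matI) (auto simp:
      mat_adjoint_index)
  have H: "?H \<in> carrier_mat d d" using A M by simp
  have size: "size P = d"
    unfolding P_def size_proots_complex using degree_monic_char_poly[OF H] by simp
  have "trace_mat ?H = (\<Sum>j<d. \<Sum>i<d. complex_of_real ((norm (M $$ (i, j)))\<^sup>2))"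
    using M A by (auto simp: trace_mat_def scalar_prod_def mat_adjoint_index lessThan_atLeast0
        complex_norm_square mult.commute simp del: of_real_power intro!: sum.cong)
  also have "\<dots> = complex_of_real S" unfolding S_def by (subst sum.swap) simp
  finally have "sum_mset P = complex_of_real S"
    using trace_eq_sum_eigenvalues[OF H] by (simp add: P_def)
  hence "S = Re (sum_mset P)" by simp
  also have "Re (sum_mset P) = sum_mset (image_mset Re P)" by (induction P) auto
  finally have S: "sum_mset (image_mset Re P) = S" by simp
  define \<sigma> where "\<sigma> = sing_val 1 M"
  let ?Q = "image_mset (\<lambda>z. sqrt (Re z)) P"
  let ?l = "sorted_list_of_multiset ?Q"
  have len: "length ?l = d" using size by (metis size_image_mset size_mset mset_sorted_list_of_multiset)
  have "\<sigma> = rev ?l ! 0" by (simp add: \<sigma>_def sing_val_def singular_values_def P_def)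
  also have "\<dots> = ?l ! (d - 1)" using len d by (simp add: rev_nth)
  finally have \<sigma>: "\<sigma> = ?l ! (d - 1)" .
  have le: "sqrt (Re z) \<le> \<sigma>" if "z \<in># P" for z
  proof -
    have "sqrt (Re z) \<in> set ?l" using that by simp
    then obtain i where "i < d" "?l ! i = sqrt (Re z)" using len by (metis in_set_conv_nth)
    thus ?thesis unfolding \<sigma> using sorted_nth_mono[of ?l i "d - 1"] len by simp
  qed
  have S0: "S \<ge> 0" unfolding S_def by (intro sum_nonneg) auto
  \<comment> \<open>There are \<open>d\<close> eigenvalues, whose real parts have the sum \<open>S\<close>.\<close>
  have "\<exists>z \<in># P. Re z \<ge> S / d"
  proof (rule ccontr)
    assume "\<not> ?thesis"
    hence lt: "\<And>z. z \<in># P \<Longrightarrow> Re z < S / d" by auto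
    have "P \<noteq> {#}" using size d by auto
    hence "sum_mset (image_mset Re P) < sum_mset (image_mset (\<lambda>_. S / d) P)"
      using lt
    proof (induction P rule: multiset_induct)
      case (add z P)
      thus ?case by (cases "P = {#}") (auto intro: add_strict_mono)
    qed simp
    also have "\<dots> = S" using size d by simp
    finally show False using S by simp
  qed
  then obtain z where z: "z \<in># P" "Re z \<ge> S / d" by blast
  have "sqrt (S / d) \<le> \<sigma>" using le[OF z(1)] z(2) real_sqrt_le_mono order_trans by blast
  moreover have "sqrt (S / d) \<ge> 0" using S0 by simp
  ultimately show "sing_val 1 M \<ge> 0" unfolding \<sigma>_def by linarith
  have "S / d = (sqrt (S / d))\<^sup>2" using S0 by simp
  also have "\<dots> \<le> \<sigma>\<^sup>2" using \<open>sqrt (S / d) \<le> \<sigma>\<close> \<open>sqrt (S / d) \<ge> 0\<close> by (intro power_mono)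
  finally show "(\<Sum>i<d. \<Sum>j<d. (norm (M $$ (i, j)))\<^sup>2) \<le> real d * (sing_val 1 M)\<^sup>2"
    using d by (simp add: S_def \<sigma>_def field_simps)
qed

lemma entry_norm_le_sing_val:
  assumes M: "M \<in> carrier_mat d d" and d: "d \<ge> 1"
  shows "entry_norm M \<le> real (d * d * d) * sing_val 1 M"
proof -
  note b = sing_val_1_bounds[OF M d]
  have "norm (M $$ (i, j)) \<le> real d * sing_val 1 M" if ij: "i < d" "j < d" for i j
  proof (rule power2_le_imp_le)
    have "(norm (M $$ (i, j)))\<^sup>2 \<le> (\<Sum>j<d. (norm (M $$ (i, j)))\<^sup>2)"
      using ij by (intro member_le_sum[of j "{..<d}" "\<lambda>j. (norm (M $$ (i, j)))\<^sup>2"]) auto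
    also have "\<dots> \<le> (\<Sum>i<d. \<Sum>j<d. (norm (M $$ (i, j)))\<^sup>2)"
      using ij by (intro member_le_sum[of i "{..<d}" "\<lambda>i. \<Sum>j<d. (norm (M $$ (i, j)))\<^sup>2"])
        (auto intro: sum_nonneg)
    also have "\<dots> \<le> real d * (sing_val 1 M)\<^sup>2" by (rule b(2))
    also have "\<dots> \<le> (real d * real d) * (sing_val 1 M)\<^sup>2"
      using d by (intro mult_right_mono) auto
    finally show "(norm (M $$ (i, j)))\<^sup>2 \<le> (real d * sing_val 1 M)\<^sup>2"
      by (simp add: power_mult_distrib power2_eq_square mult_ac)
  qed (use b(1) in simp)
  hence "(\<Sum>i<d. \<Sum>j<d. norm (M $$ (i, j))) \<le> (\<Sum>i<d. \<Sum>j<d. real d * sing_val 1 M)"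
    by (intro sum_mono) auto
  thus ?thesis using M by (simp add: entry_norm_def mult_ac)
qed

section \<open>Nilpotency or a lower bound for the iterates\<close>

lemma det_itc:
  assumes "T \<in> carrier_mat d d"
  shows "ev (det (itc a T n)) x = (\<Prod>j<n. ev (det T) (x + real j * a))"
proof (induction n)
  case 0 thus ?case using assms by simp
next
  case (Suc n)
  have "det (itc a T (Suc n)) = shift (real n * a) (det T) * det (itc a T n)"
    using assms by (simp add: det_mult[of _ d] itc_carrier)
  thus ?case using Suc by (simp add: mult.commute)
qed

lemma entry_norm_lower_le:
  assumes Y: "Y \<in> carrier_mat (k + q) q"
  shows "entry_norm (evm x (lower k Y)) \<le> entry_norm (evm x (zcols k Y))"
proof -
  define f where "f i j = norm (evm x (zcols k Y) $$ (i, j))" for i j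
  have "entry_norm (evm x (lower k Y)) = (\<Sum>i<q. \<Sum>j<q. f (i + k) (j + k))"
    unfolding f_def using Y by (auto simp: entry_norm_def lower_def zcols_def add.commute intro!:
        sum.cong)
  also have "\<dots> = (\<Sum>i<q. \<Sum>j=k..<q + k. f (i + k) j)"
    using sum.shift_bounds_nat_ivl[of "f _" 0 k q] by (simp add: lessThan_atLeast0)
  also have "\<dots> = (\<Sum>i=k..<q + k. \<Sum>j=k..<q + k. f i j)"
    using sum.shift_bounds_nat_ivl[of "\<lambda>i. \<Sum>j=k..<q + k. f i j" 0 k q] by (simp add: lessThan_atLeast0)
  also have "\<dots> \<le> (\<Sum>i<k + q. \<Sum>j=k..<q + k. f i j)"
    by (intro sum_mono2) (auto simp: f_def intro!: sum_nonneg)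
  also have "\<dots> \<le> (\<Sum>i<k + q. \<Sum>j<k + q. f i j)"
    by (intro sum_mono sum_mono2) (auto simp: f_def)
  also have "\<dots> = entry_norm (evm x (zcols k Y))"
    using zcols_carrier[OF Y, of k] by (simp add: entry_norm_def f_def)
  finally show ?thesis .
qed

text \<open>
The iterates are bounded below by the product of a fixed nonzero function along the orbit. The
function \<open>c\<close> stands for the determinant of an \<open>r \<times> r\<close> block of a conjugate cocycle.
\<close>

definition has_minorant :: "nat \<Rightarrow> real \<Rightarrow> circ mat \<Rightarrow> bool" where
  "has_minorant d a A \<longleftrightarrow> (\<exists>c r K. c \<noteq> 0 \<and> r \<ge> (1 :: nat) \<and> K \<ge> 0 \<and>
     (\<forall>n\<ge>1. \<forall>x. (\<Prod>j<n. norm (ev c (x + real j * a))) \<le> K * entry_norm (evm x (itc a A n)) ^ r))"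

lemma inj_mat_imp_minorant:
  assumes T: "T \<in> carrier_mat d d" and inj: "inj_mat T" and d: "d \<ge> 1"
  shows "has_minorant d a T"
proof -
  have "det T \<noteq> 0"
    using det_0_iff_vec_prod_zero[OF T] inj_matD[OF inj T] by blast
  moreover have "(\<Prod>j<n. norm (ev (det T) (x + real j * a))) \<le> fact d * entry_norm (evm x (itc a T
      n)) ^ d" for n x
  proof -
    have "(\<Prod>j<n. norm (ev (det T) (x + real j * a))) = norm (ev (det (itc a T n)) x)"
      by (simp add: det_itc[OF T] prod_norm)
    also have "ev (det (itc a T n)) x = det (evm x (itc a T n))" by simp
    also have "norm \<dots> \<le> fact d * entry_norm (evm x (itc a T n)) ^ d"
      using itc_carrier[OF T] by (intro norm_det_le) auto
    finally show ?thesis .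
  qed
  ultimately show ?thesis using d unfolding has_minorant_def
    by (intro exI[of _ "det T"] exI[of _ d] exI[of _ "fact d"]) auto
qed

text \<open>
The reduction is repeated until the lower block is injective or of size 0. The iterates of the
lower block are submatrices of those of \<open>A\<close> in unitary coordinates, so a minorant for the lower
block is one for \<open>A\<close>, with another constant.
\<close>

lemma nilpotent_or_minorant:
  assumes "A \<in> carrier_mat d d"
  shows "(\<exists>n. itc a A n = 0\<^sub>m d d) \<or> has_minorant d a A"
  using assms
proof (induction d arbitrary: A rule: less_induct)
  case (less d)
  note A = less.prems
  obtain k q N G where d: "d = k + q" and N: "N \<in> unitary_circ d" and G: "G \<in> carrier_mat d q"
      "inj_mat G"
    and eq: "A * N = shm a N * zcols k G"
    by (rule cocycle_reduction[OF A])
  note iff = itc_reduction_zero_iff[OF A d N G eq]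
  have G': "G \<in> carrier_mat (k + q) q" using G d by simp
  note L = lower_carrier[OF G']
  have "(\<exists>n. itc a (lower k G) n = 0\<^sub>m q q) \<or> has_minorant q a (lower k G)"
  proof (cases "k = 0")
    case True
    hence LG: "lower k G = G" by (auto simp: lower_def intro!: eq_matI)
    show ?thesis
    proof (cases "q = 0")
      case True
      hence "itc a (lower k G) 0 = 0\<^sub>m q q" using L by (auto intro!: eq_matI)
      thus ?thesis by blast
    next
      case False
      thus ?thesis using inj_mat_imp_minorant[OF L] G(2) LG by simp
    qed
  next
    case False
    hence "q < d" using d by simp
    from less.IH[OF this L] show ?thesis .
  qed
  thus ?case
  proof
    assume "\<exists>n. itc a (lower k G) n = 0\<^sub>m q q"
    thus ?thesis using iff by blast
  next
    assume "has_minorant q a (lower k G)"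
    then obtain c r K where c: "c \<noteq> 0" "r \<ge> 1" "K \<ge> 0"
      and le: "\<And>n x. n \<ge> 1 \<Longrightarrow> (\<Prod>j<n. norm (ev c (x + real j * a))) \<le>
          K * entry_norm (evm x (itc a (lower k G) n)) ^ r"
      unfolding has_minorant_def by blast
    note Nc = unitary_circ_carrier[OF N]
    let ?B = "zcols k G"
    have B: "?B \<in> carrier_mat d d" using zcols_carrier[OF G', of k] d by simp
    have bound: "entry_norm (evm x (itc a (lower k G) n)) \<le> (real d * real d) * (real d * real d)
        * entry_norm (evm x (itc a A n))"
      if "n \<ge> 1" for n x
    proof -
      obtain m where m: "n = Suc m" using \<open>n \<ge> 1\<close> by (cases n) auto
      let ?Y = "shm (real m * a) G * itc a (lower k G) m"
      have Bn: "itc a ?B n = zcols k ?Y" unfolding m by (rule itc_zcols[OF G'])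
      have Y: "?Y \<in> carrier_mat d q" using G(1) itc_carrier[OF L] by auto
      have Ln: "itc a (lower k G) n = lower k ?Y"
        using G' itc_carrier[OF L] unfolding m by (subst lower_mult[of _ k q q _ q]) (auto simp:
            shm_lower)
      have "entry_norm (evm x (lower k ?Y)) \<le> entry_norm (evm x (zcols k ?Y))"
        using entry_norm_lower_le[of ?Y k q x] Y d by simp
      also have "\<dots> = entry_norm (evm x (itc a ?B n))" by (simp add: Bn)
      also have "itc a ?B n = adj (shm (real n * a) N) * (itc a A n * N)"
      proof -
        have M: "shm (real n * a) N \<in> unitary_circ d" by (rule shm_unitary[OF N])
        note Mc = unitary_circ_carrier[OF M]
        show ?thesis
          unfolding itc_conj[OF A Nc B eq]
            assoc_mult_mat[OF adj_carrier[OF Mc] Mc itc_carrier[OF B], symmetric]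
            unitary_circ_adj(1)[OF M] using left_mult_one_mat[OF itc_carrier[OF B]] by simp
      qed
      also have "evm x \<dots> = mat_adjoint (evm (x + real n * a) N) * (evm x (itc a A n) * evm x N)"
        using Nc itc_carrier[OF A, of a n]
        by (subst ev_hom.mat_hom_mult[of _ d d _ d], simp_all add: evm_adj)
          (subst ev_hom.mat_hom_mult[of _ d d _ d], simp_all)
      also have "entry_norm \<dots> \<le> entry_norm (mat_adjoint (evm (x + real n * a) N)) *
          (entry_norm (evm x (itc a A n)) * entry_norm (evm x N))"
      proof -
        have 1: "mat_adjoint (evm (x + real n * a) N) \<in> carrier_mat d d"
          using Nc by (intro carrier_matI) (auto simp: mat_adjoint_index)
        have 2: "evm x (itc a A n) \<in> carrier_mat d d" "evm x N \<in> carrier_mat d d"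
          using Nc itc_carrier[OF A] by auto
        show ?thesis
          by (intro order_trans[OF entry_norm_mult[OF 1 mult_carrier_mat[OF 2]]] mult_left_mono
              entry_norm_mult[OF 2]) auto
      qed
      also have "\<dots> \<le> (real d * real d) * (entry_norm (evm x (itc a A n)) * (real d * real d))"
      proof (intro mult_mono mult_nonneg_nonneg)
        have "mat_adjoint U \<in> unitary_group d" if "U \<in> unitary_group d" for U
        proof -
          have "mat_adjoint (mat_adjoint U) = U"
            by (intro eq_matI) (auto simp: mat_adjoint_index)
          thus ?thesis using that by (auto simp: unitary_group_def mat_adjoint_index intro!:
              carrier_matI)
        qed
        thus "entry_norm (mat_adjoint (evm (x + real n * a) N)) \<le> real d * real d"
          using N by (intro entry_norm_unitary) (auto simp: unitary_circ_def)
        show "entry_norm (evm x N) \<le> real d * real d"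
          using N by (intro entry_norm_unitary) (auto simp: unitary_circ_def)
      qed auto
      finally show ?thesis by (simp add: Ln mult_ac)
    qed
    let ?D = "(real d * real d) * (real d * real d)"
    have "(\<Prod>j<n. norm (ev c (x + real j * a))) \<le> (K * ?D ^ r) * entry_norm (evm x (itc a A n)) ^ r"
      if "n \<ge> 1" for n x
    proof -
      have "(\<Prod>j<n. norm (ev c (x + real j * a))) \<le> K * entry_norm (evm x (itc a (lower k G) n)) ^ r"
        by (rule le[OF that])
      also have "\<dots> \<le> K * (?D * entry_norm (evm x (itc a A n))) ^ r"
        using c(3) bound[OF that, of x] by (intro mult_left_mono power_mono) auto
      finally show ?thesis by (simp add: power_mult_distrib mult_ac)
    qed
    hence "has_minorant d a A" using c unfolding has_minorant_def
      by (intro exI[of _ c] exI[of _ r] exI[of _ "K * ?D ^ r"]) auto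
    thus ?thesis ..
  qed
qed

section \<open>Integrability of the logarithm\<close>

text \<open>
The negative part of the logarithm, infinite at 0.
\<close>

definition neg_ln :: "real \<Rightarrow> ennreal" where
  "neg_ln t = e2ennreal (- ln_ext t)"

lemma neg_ln_0 [simp]: "neg_ln 0 = top"
  by (simp add: neg_ln_def ln_ext_def)

lemma neg_ln_pos: "t \<noteq> 0 \<Longrightarrow> neg_ln t = ennreal (- ln t)"
  by (simp add: neg_ln_def ln_ext_def)

lemma neg_ln_finite: "t \<noteq> 0 \<Longrightarrow> neg_ln t < top"
  by (simp add: neg_ln_pos)

lemma neg_ln_antimono:
  assumes "0 \<le> s" "s \<le> t" shows "neg_ln t \<le> neg_ln s"
  using assms by (cases "s = 0") (auto simp: neg_ln_pos intro!: ennreal_leI)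

lemma neg_ln_mult:
  assumes "0 \<le> s" "0 \<le> t" shows "neg_ln (s * t) \<le> neg_ln s + neg_ln t"
proof (cases "s = 0 \<or> t = 0")
  case False
  hence "s > 0" "t > 0" using assms by auto
  thus ?thesis
    by (auto simp: neg_ln_pos ln_mult ennreal_plus_if intro!: ennreal_leI)
qed auto

lemma neg_ln_prod:
  fixes n :: nat
  assumes "\<And>j. j < n \<Longrightarrow> 0 \<le> f j"
  shows "neg_ln (\<Prod>j<n. f j) \<le> (\<Sum>j<n. neg_ln (f j))"
  using assms
proof (induction n)
  case 0 thus ?case by (simp add: neg_ln_pos)
next
  case (Suc n)
  have "neg_ln (\<Prod>j<Suc n. f j) \<le> neg_ln (\<Prod>j<n. f j) + neg_ln (f n)"
    using Suc.prems by (simp, intro neg_ln_mult prod_nonneg) auto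
  also have "\<dots> \<le> (\<Sum>j<n. neg_ln (f j)) + neg_ln (f n)"
    using Suc by (intro add_right_mono) auto
  finally show ?case by simp
qed

lemma neg_ln_measurable [measurable]: "neg_ln \<in> borel_measurable borel"
proof -
  have "(\<lambda>t. if t = 0 then top else ennreal (- ln t)) \<in> borel_measurable (borel :: real measure)"
    by measurable
  also have "(\<lambda>t. if t = 0 then top else ennreal (- ln t)) = neg_ln"
    by (auto simp: fun_eq_iff neg_ln_pos)
  finally show ?thesis .
qed

lemma ev_norm_measurable [measurable]: "(\<lambda>x. norm (ev f (x + a))) \<in> borel_measurable borel"
  by (intro borel_measurable_continuous_onI continuous_on_norm continuous_on_compose2[OF
      ev_continuous[of UNIV f]]
      continuous_intros) auto

lemma nn_integral_circle:
  "(\<integral>\<^sup>+ x. f x \<partial>circle_measure) = (\<integral>\<^sup>+ x. f x * indicator {0..1} x \<partial>lborel)"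
  by (subst nn_integral_restrict_space) auto

text \<open>
The factor 2 comes from covering an interval of length 1 by two periods.
\<close>

lemma nn_integral_circle_shift:
  fixes f :: "real \<Rightarrow> ennreal"
  assumes [measurable]: "f \<in> borel_measurable borel" and per: "\<And>x. f (x + 1) = f x"
  shows "(\<integral>\<^sup>+ x. f (x + a) \<partial>circle_measure) \<le> 2 * (\<integral>\<^sup>+ x. f x \<partial>circle_measure)"
proof -
  define b where "b = frac a"
  have b: "0 \<le> b" "b \<le> 1" using frac_ge_0[of a] frac_lt_1[of a] by (auto simp: b_def)
  have fb: "f (x + a) = f (x + b)" for x
    using periodic_add_int[of f "x + b" "\<lfloor>a\<rfloor>", OF per] by (simp add: b_def frac_def)
  have "(\<integral>\<^sup>+ x. f (x + a) \<partial>circle_measure) = (\<integral>\<^sup>+ x. f (b + 1 * x) * indicator {b..b + 1} (b + 1 *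
      x) \<partial>lborel)"
    unfolding nn_integral_circle fb by (intro nn_integral_cong) (auto simp: indicator_def add.commute)
  also have "\<dots> = (\<integral>\<^sup>+ y. f y * indicator {b..b + 1} y \<partial>lborel)"
    by (subst nn_integral_real_affine[of _ 1 b]) auto
  also have "\<dots> \<le> (\<integral>\<^sup>+ y. f y * indicator {0..1} y + f y * indicator {1..2} y \<partial>lborel)"
    using b by (intro nn_integral_mono) (auto simp: indicator_def)
  also have "\<dots> = (\<integral>\<^sup>+ y. f y * indicator {0..1} y \<partial>lborel) + (\<integral>\<^sup>+ y. f y * indicator {1..2} y \<partial>lborel)"
    by (rule nn_integral_add) auto
  also have "(\<integral>\<^sup>+ y. f y * indicator {1..2} y \<partial>lborel) = (\<integral>\<^sup>+ x. f (1 + 1 * x) * indicator {1..2}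
      (1 + 1 * x) \<partial>lborel)"
    by (subst nn_integral_real_affine[of _ 1 1]) auto
  also have "\<dots> = (\<integral>\<^sup>+ y. f y * indicator {0..1} y \<partial>lborel)"
    using per by (intro nn_integral_cong) (auto simp: indicator_def add.commute)
  finally show ?thesis unfolding nn_integral_circle by (simp add: mult_2)
qed

text \<open>
The elementary bound \<open>- ln x \<le> 2 x\<^bsup>-1/2\<^esup>\<close> has an integrable right-hand side.
\<close>

lemma neg_ln_integrable_0:
  "(\<integral>\<^sup>+ x. neg_ln x * indicator {0..1} x \<partial>lborel) < top"
proof -
  define g where "g x = (if x \<in> {0..1} then 2 * x powr (-1/2) else (0 :: real))" for x :: real
  have "((\<lambda>x. x powr (-1/2)) has_integral (1 powr (-1/2 + 1) / (-1/2 + 1))) {0..1::real}"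
    by (rule has_integral_powr_from_0) auto
  hence "((\<lambda>x. 2 * x powr (-1/2)) has_integral (2 * (1 powr (-1/2 + 1) / (-1/2 + 1)))) {0..1::real}"
    by (rule has_integral_mult_right)
  hence hi: "(g has_integral (2 * (1 powr (-1/2 + 1) / (-1/2 + 1)))) UNIV"
    unfolding g_def by (subst has_integral_restrict_UNIV)
  have hm: "g \<in> borel_measurable borel" unfolding g_def by measurable
  have hn: "0 \<le> g x" for x by (simp add: g_def)
  note fin = nn_integral_has_integral_lborel[OF hm hn hi]
  have *: "neg_ln x * indicator {0..1} x \<le> ennreal (g x)" if x: "x \<noteq> 0" for x :: real
  proof (cases "x \<in> {0..1}")
    case True
    hence pos: "x > 0" using x by auto
    have "- ln x = 2 * ln (x powr (-1/2))" using pos by (simp add: ln_powr)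
    also have "ln (x powr (-1/2)) \<le> x powr (-1/2)"
      using pos ln_le_minus_one[of "x powr (-1/2)"] by simp
    finally have "- ln x \<le> g x" using True by (simp add: g_def)
    thus ?thesis using True x by (simp add: neg_ln_pos ennreal_leI)
  qed auto
  have "AE x in lborel. neg_ln x * indicator {0..1} x \<le> ennreal (g x)"
    using AE_lborel_singleton[of "0 :: real"] by eventually_elim (rule *)
  hence "(\<integral>\<^sup>+ x. neg_ln x * indicator {0..1} x \<partial>lborel) \<le> (\<integral>\<^sup>+ x. ennreal (g x) \<partial>lborel)"
    by (rule nn_integral_mono_AE)
  also have "\<dots> < top" unfolding fin by simp
  finally show ?thesis .
qed

text \<open>
A crude form of Jordan's inequality whose left-hand side controls both zeros \<open>0\<close> and \<open>1\<close> of the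
sine, so that its logarithm splits into \<open>ln x\<close> and \<open>ln (1 - x)\<close>.
\<close>

lemma sin_pi_lower:
  fixes x :: real
  assumes "0 \<le> x" "x \<le> 1"
  shows "x * (1 - x) \<le> 2 * sin (pi * x)"
proof -
  have half: "x \<le> 2 * sin (pi * x)" if x: "0 \<le> x" "x \<le> 1/2" for x :: real
  proof (cases "x \<le> 1/3")
    case True
    have "2 * sin (pi * 0) - 0 \<le> 2 * sin (pi * x) - x"
    proof (rule DERIV_nonneg_imp_nondecreasing[of 0 x "\<lambda>x. 2 * sin (pi * x) - x"])
      fix y assume y: "0 \<le> y" "y \<le> x"
      have "cos (pi * y) \<ge> cos (pi / 3)"
        using y True by (intro cos_monotone_0_pi_le) (auto simp: mult_left_le)
      hence "cos (pi * y) \<ge> 1/2" by (simp add: cos_60)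
      hence "pi * cos (pi * y) \<ge> 3 * (1/2)" using pi_gt3 by (intro mult_mono) auto
      hence "2 * (pi * cos (pi * y)) - 1 \<ge> 0" by simp
      moreover have "((\<lambda>x. 2 * sin (pi * x) - x) has_real_derivative (2 * (pi * cos (pi * y)) -
          1)) (at y)"
        by (auto intro!: derivative_eq_intros)
      ultimately show "\<exists>D. ((\<lambda>x. 2 * sin (pi * x) - x) has_real_derivative D) (at y) \<and> 0 \<le> D" by blast
    qed (use x in auto)
    thus ?thesis by simp
  next
    case False
    have "sin (pi / 3) \<le> sin (pi * x)"
      using x False by (intro sin_monotone_2pi_le) (auto simp: field_simps)
    hence "sqrt 3 / 2 \<le> sin (pi * x)" by (simp add: sin_60)
    moreover have "1 \<le> sqrt 3" by simp
    ultimately show ?thesis using x by linarith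
  qed
  show ?thesis
  proof (cases "x \<le> 1/2")
    case True
    have "x * (1 - x) \<le> x * 1" using assms by (intro mult_left_mono) auto
    thus ?thesis using half[of x] True assms by simp
  next
    case False
    have "x * (1 - x) \<le> 1 * (1 - x)" using assms by (intro mult_right_mono) auto
    moreover have "sin (pi * (1 - x)) = sin (pi * x)" by (simp add: right_diff_distrib sin_diff)
    ultimately show ?thesis using half[of "1 - x"] False assms by simp
  qed
qed

lemma norm_linear_factor:
  "norm (ev (linear_factor z) x) = 2 * \<bar>sin (pi * (x - z))\<bar>"
proof -
  have "ev (linear_factor z) x = cis (2 * pi * z) * (cis (2 * pi * (x - z)) - 1)"
    by (simp add: ev_linear_factor right_diff_distrib cis_mult)
  hence "norm (ev (linear_factor z) x) = norm (cis (2 * pi * (x - z)) - 1)"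
    by (simp add: norm_mult)
  also have "cis (2 * pi * (x - z)) - 1 = cis (pi * (x - z)) * (cis (pi * (x - z)) - cis (- (pi *
      (x - z))))"
    by (simp add: right_diff_distrib cis_mult mult.assoc)
  also have "norm \<dots> = norm (cis (pi * (x - z)) - cis (- (pi * (x - z))))" by (simp add: norm_mult)
  also have "cis (pi * (x - z)) - cis (- (pi * (x - z))) = \<i> * of_real (2 * sin (pi * (x - z)))"
    by (simp add: complex_eq_iff)
  finally show ?thesis by (simp add: norm_mult)
qed

lemma neg_ln_linear_factor_integrable:
  "(\<integral>\<^sup>+ x. neg_ln (norm (ev (linear_factor z) x)) \<partial>circle_measure) < top"
proof -
  have "neg_ln (norm (ev (linear_factor 0) x)) * indicator {0..1} x \<le>
      neg_ln x * indicator {0..1} x + neg_ln (1 - x) * indicator {0..1} (1 - x)" for x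
  proof (cases "x \<in> {0..1}")
    case True
    hence "sin (pi * x) \<ge> 0" by (intro sin_ge_zero) (auto simp: mult_left_le)
    hence "neg_ln (norm (ev (linear_factor 0) x)) = neg_ln (2 * sin (pi * x))"
      by (simp add: norm_linear_factor)
    also have "\<dots> \<le> neg_ln (x * (1 - x))"
      using True by (intro neg_ln_antimono sin_pi_lower) auto
    also have "\<dots> \<le> neg_ln x + neg_ln (1 - x)" using True by (intro neg_ln_mult) auto
    finally show ?thesis using True by simp
  qed auto
  hence "(\<integral>\<^sup>+ x. neg_ln (norm (ev (linear_factor 0) x)) \<partial>circle_measure) \<le>
     (\<integral>\<^sup>+ x. neg_ln x * indicator {0..1} x + neg_ln (1 - x) * indicator {0..1} (1 - x) \<partial>lborel)"
    unfolding nn_integral_circle by (intro nn_integral_mono)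
  also have "\<dots> = (\<integral>\<^sup>+ x. neg_ln x * indicator {0..1} x \<partial>lborel) +
      (\<integral>\<^sup>+ x. neg_ln (1 - x) * indicator {0..1} (1 - x) \<partial>lborel)"
    by (rule nn_integral_add) auto
  also have "(\<integral>\<^sup>+ x. neg_ln (1 - x) * indicator {0..1} (1 - x) \<partial>lborel) =
     (\<integral>\<^sup>+ x. neg_ln x * indicator {0..1} x \<partial>lborel)"
    using nn_integral_real_affine[of "\<lambda>x. neg_ln x * indicator {0..1} x" "-1" 1] by simp
  also have "(\<integral>\<^sup>+ x. neg_ln x * indicator {0..1} x \<partial>lborel) + (\<integral>\<^sup>+ x. neg_ln x * indicator {0..1}
      x \<partial>lborel) < top"
    using neg_ln_integrable_0 by simp
  finally have 0: "(\<integral>\<^sup>+ x. neg_ln (norm (ev (linear_factor 0) x)) \<partial>circle_measure) < top" .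
  have "(\<integral>\<^sup>+ x. neg_ln (norm (ev (linear_factor z) x)) \<partial>circle_measure) =
      (\<integral>\<^sup>+ x. neg_ln (norm (ev (linear_factor 0) (x + (- z)))) \<partial>circle_measure)"
    by (simp add: norm_linear_factor)
  also have "\<dots> \<le> 2 * (\<integral>\<^sup>+ x. neg_ln (norm (ev (linear_factor 0) x)) \<partial>circle_measure)"
    using ev_norm_measurable[of "linear_factor 0" 0]
    by (intro nn_integral_circle_shift[of "\<lambda>x. neg_ln (norm (ev (linear_factor 0) x))"]) auto
  also have "\<dots> < top" using 0 by (simp add: ennreal_mult_less_top)
  finally show ?thesis .
qed

lemma neg_ln_ev_measurable: "(\<lambda>x. neg_ln (norm (ev f x))) \<in> borel_measurable circle_measure"
proof -
  have "(\<lambda>x. neg_ln (norm (ev f x))) \<in> borel_measurable borel"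
    using ev_norm_measurable[of f 0] by simp
  thus ?thesis by (intro measurable_restrict_space1) simp
qed

lemma neg_ln_integrable_mult:
  assumes "(\<integral>\<^sup>+ x. neg_ln (norm (ev f x)) \<partial>circle_measure) < top"
    "(\<integral>\<^sup>+ x. neg_ln (norm (ev g x)) \<partial>circle_measure) < top"
  shows "(\<integral>\<^sup>+ x. neg_ln (norm (ev (f * g) x)) \<partial>circle_measure) < top"
proof -
  have "(\<integral>\<^sup>+ x. neg_ln (norm (ev (f * g) x)) \<partial>circle_measure) \<le>
     (\<integral>\<^sup>+ x. neg_ln (norm (ev f x)) + neg_ln (norm (ev g x)) \<partial>circle_measure)"
    by (intro nn_integral_mono) (simp add: norm_mult neg_ln_mult)
  also have "\<dots> = (\<integral>\<^sup>+ x. neg_ln (norm (ev f x)) \<partial>circle_measure) + (\<integral>\<^sup>+ x. neg_ln (norm (ev g x))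
      \<partial>circle_measure)"
    by (intro nn_integral_add neg_ln_ev_measurable)
  also have "\<dots> < top" using assms by simp
  finally show ?thesis .
qed

lemma emeasure_circle: "emeasure circle_measure {0..1} = 1"
  by (simp add: emeasure_restrict_space)

text \<open>
\<open>ln \<bar>c\<bar>\<close> is a sum of translates of one integrable function, which come from the linear factors of
\<open>c\<close>, and of the logarithm of a zero-free factor, which is bounded below.
\<close>

lemma neg_ln_integrable:
  assumes "c \<noteq> 0"
  shows "(\<integral>\<^sup>+ x. neg_ln (norm (ev c x)) \<partial>circle_measure) < top"
proof -
  obtain u zs where u: "c = u * prod_list (map linear_factor zs)" "\<And>x. ev u x \<noteq> 0"
    using factor_into_zeros[OF assms] by blast
  have "(\<integral>\<^sup>+ x. neg_ln (norm (ev (u * prod_list (map linear_factor zs)) x)) \<partial>circle_measure) < top"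
  proof (induction zs)
    case Nil
    obtain x0 where x0: "x0 \<in> {0..1}" "\<And>x. x \<in> {0..1} \<Longrightarrow> norm (ev u x0) \<le> norm (ev u x)"
      using continuous_attains_inf[of "{0..1}" "\<lambda>x. norm (ev u x)"] continuous_on_norm[OF ev_continuous]
      by auto
    have "(\<integral>\<^sup>+ x. neg_ln (norm (ev u x)) \<partial>circle_measure) \<le> (\<integral>\<^sup>+ x. neg_ln (norm (ev u x0))
        \<partial>circle_measure)"
      using x0 by (intro nn_integral_mono neg_ln_antimono) (auto simp: space_restrict_space)
    also have "\<dots> = neg_ln (norm (ev u x0))" by (simp add: space_restrict_space emeasure_circle)
    also have "\<dots> < top" using u(2) by (intro neg_ln_finite) simp
    finally show ?case by simp
  next
    case (Cons z zs)
    show ?case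
      using neg_ln_integrable_mult[OF neg_ln_linear_factor_integrable[of z] Cons] by (simp add: mult_ac)
  qed
  thus ?thesis using u(1) by simp
qed

text \<open>
A minorant \<open>c\<close> bounds \<open>- ln\<close> of the first singular value of the iterate number \<open>n\<close> by a constant
plus the sum of \<open>n\<close> translates of the negative part of \<open>ln \<bar>c\<bar>\<close>. So the averages in the
definition of the exponent are bounded below uniformly in \<open>n\<close>.
\<close>

lemma nilpotent_if_lyapunov_minus_infinity:
  assumes A: "A \<in> carrier_mat d d" and d: "d \<ge> 1"
    and itA: "\<And>n x. iterate d a A' n x = evm x (itc a A n)"
    and lyap: "has_lyapunov_exponent d 1 a A' (-\<infinity>)"
  shows "\<exists>n. itc a A n = 0\<^sub>m d d"
proof (rule ccontr)
  assume "\<not> ?thesis"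
  hence "has_minorant d a A" using nilpotent_or_minorant[OF A] by blast
  then obtain c r K where c: "c \<noteq> 0" "r \<ge> 1" "K \<ge> 0"
      and le: "\<And>n x. n \<ge> 1 \<Longrightarrow> (\<Prod>j<n. norm (ev c (x + real j * a))) \<le>
          K * entry_norm (evm x (itc a A n)) ^ r"
    unfolding has_minorant_def by blast
  define s where "s n x = sing_val 1 (iterate d a A' n x)" for n x
  define D where "D = max 1 (K * real (d * d * d) ^ r)"
  have D: "D \<ge> 1" by (simp add: D_def)
  define I where "I = (\<integral>\<^sup>+ x. neg_ln (norm (ev c x)) \<partial>circle_measure)"
  have I: "I < top" unfolding I_def by (rule neg_ln_integrable[OF c(1)])
  have s0: "s n x \<ge> 0" for n x
    unfolding s_def itA by (rule sing_val_1_bounds(1)[OF _ d]) (use itc_carrier[OF A] in auto)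
  have bound: "neg_ln (s n x) \<le> neg_ln (1 / D) + (\<Sum>j<n. neg_ln (norm (ev c (x + real j * a))))" if
      n: "n \<ge> 1" for n x
  \<comment> \<open>For \<open>s n x < 1\<close> the exponent \<open>r\<close> can be dropped, as \<open>s n x ^ r \<le> s n x\<close>.\<close>
  proof (cases "s n x \<ge> 1")
    case True
    thus ?thesis by (simp add: neg_ln_pos ennreal_neg)
  next
    case False
    have "(\<Prod>j<n. norm (ev c (x + real j * a))) \<le> K * entry_norm (evm x (itc a A n)) ^ r"
      by (rule le[OF n])
    also have "\<dots> \<le> K * (real (d * d * d) * s n x) ^ r"
      unfolding s_def itA using c(3) itc_carrier[OF A]
      by (intro mult_left_mono power_mono entry_norm_le_sing_val d) auto
    also have "\<dots> = (K * real (d * d * d) ^ r) * s n x ^ r" by (simp add: power_mult_distrib)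
    also have "\<dots> \<le> D * s n x ^ r" using s0[of n x] by (intro mult_right_mono) (auto simp: D_def)
    also have "\<dots> \<le> D * s n x"
      using s0[of n x] False c(2) D power_decreasing[of 1 r "s n x"] by (intro mult_left_mono) auto
    finally have "(1 / D) * (\<Prod>j<n. norm (ev c (x + real j * a))) \<le> s n x"
      using D by (simp add: field_simps)
    hence "neg_ln (s n x) \<le> neg_ln ((1 / D) * (\<Prod>j<n. norm (ev c (x + real j * a))))"
      using D by (intro neg_ln_antimono) (auto intro!: prod_nonneg divide_nonneg_nonneg)
    also have "\<dots> \<le> neg_ln (1 / D) + neg_ln (\<Prod>j<n. norm (ev c (x + real j * a)))"
      using D by (intro neg_ln_mult) (auto intro!: prod_nonneg)
    also have "\<dots> \<le> neg_ln (1 / D) + (\<Sum>j<n. neg_ln (norm (ev c (x + real j * a))))"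
      by (intro add_left_mono neg_ln_prod) auto
    finally show ?thesis .
  qed
  define J where "J = neg_ln (1 / D) + 2 * I"
  have J: "J < top" unfolding J_def using I D
    by (auto simp: ennreal_mult_less_top intro!: neg_ln_finite)
  have int: "(\<integral>\<^sup>+ x. neg_ln (s n x) \<partial>circle_measure) \<le> of_nat n * J" if n: "n \<ge> 1" for n
  proof -
    have "(\<integral>\<^sup>+ x. neg_ln (s n x) \<partial>circle_measure) \<le>
        (\<integral>\<^sup>+ x. neg_ln (1 / D) + (\<Sum>j<n. neg_ln (norm (ev (shift (real j * a) c) x))) \<partial>circle_measure)"
      by (intro nn_integral_mono) (use bound[OF n] in simp)
    also have "\<dots> = neg_ln (1 / D) + (\<Sum>j<n. (\<integral>\<^sup>+ x. neg_ln (norm (ev (shift (real j * a) c) x))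
        \<partial>circle_measure))"
      using neg_ln_ev_measurable
      by (subst nn_integral_add) (auto simp: space_restrict_space emeasure_circle nn_integral_sum
          simp del: ev_shift)
    also have "\<dots> \<le> neg_ln (1 / D) + (\<Sum>j<n. 2 * I)"
    proof (intro add_left_mono sum_mono)
      fix j
      have "(\<integral>\<^sup>+ x. neg_ln (norm (ev (shift (real j * a) c) x)) \<partial>circle_measure) =
         (\<integral>\<^sup>+ x. neg_ln (norm (ev c (x + real j * a))) \<partial>circle_measure)" by simp
      also have "\<dots> \<le> 2 * I" unfolding I_def
        using ev_norm_measurable[of c 0]
        by (intro nn_integral_circle_shift[of "\<lambda>x. neg_ln (norm (ev c x))"]) auto
      finally show "(\<integral>\<^sup>+ x. neg_ln (norm (ev (shift (real j * a) c) x)) \<partial>circle_measure) \<le> 2 * I" .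
    qed
    also have "\<dots> = neg_ln (1 / D) + of_nat n * (2 * I)" by simp
    also have "\<dots> \<le> of_nat n * neg_ln (1 / D) + of_nat n * (2 * I)"
      using n mult_right_mono[of 1 "of_nat n :: ennreal" "neg_ln (1 / D)"] by (intro
          add_right_mono) auto
    finally show ?thesis by (simp add: J_def distrib_left)
  qed
  obtain j where j: "J = ennreal j" "j \<ge> 0" using J by (cases J) auto
  have low: "ereal (1 / real n) * ereal_integral circle_measure (\<lambda>x. ln_ext (s n x)) \<ge> ereal (-
      j)" if n: "n \<ge> 1" for n
  proof -
    define N where "N = (\<integral>\<^sup>+ x. neg_ln (s n x) \<partial>circle_measure)"
    define P where "P = (\<integral>\<^sup>+ x. e2ennreal (ln_ext (s n x)) \<partial>circle_measure)"
    have "N \<le> ennreal (real n * j)"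
      using int[OF n] j by (simp add: N_def ennreal_mult ennreal_of_nat_eq_real_of_nat)
    then obtain m where m: "N = ennreal m" "0 \<le> m" "m \<le> real n * j"
      using j(2) by (cases N) (auto simp: top_unique)
    have eq: "ereal_integral circle_measure (\<lambda>x. ln_ext (s n x)) = enn2ereal P - ereal m"
      unfolding ereal_integral_def P_def N_def[symmetric, unfolded neg_ln_def] m(1) using m(2) by simp
    have "ereal (- m) \<le> enn2ereal P - ereal m"
      using enn2ereal_nonneg[of P] by (cases "enn2ereal P") auto
    hence "ereal (1 / real n) * ereal (- m) \<le> ereal (1 / real n) * ereal_integral circle_measure
        (\<lambda>x. ln_ext (s n x))"
      unfolding eq using n by (intro ereal_mult_left_mono) auto
    moreover have "- j \<le> 1 / real n * - m" using m(3) n by (simp add: field_simps)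
    ultimately show ?thesis by (metis ereal_less_eq(3) order_trans times_ereal.simps(1))
  qed
  have lim: "(\<lambda>n. ereal (1 / real n) * ereal_integral circle_measure (\<lambda>x. ln_ext (s n x))) \<longlonglongrightarrow> -\<infinity>"
    using lyap unfolding has_lyapunov_exponent_def s_def .
  have "ereal (- j) \<le> -\<infinity>"
    by (rule LIMSEQ_le_const[OF lim]) (use low in blast)
  thus False by simp
qed

section \<open>Ranks and left inverses\<close>

definition img :: "complex mat \<Rightarrow> complex vec set" where
  "img M = (\<lambda>v. M *\<^sub>v v) ` carrier_vec (dim_col M)"

text \<open>
The rank depends on the image only, hence it does not see zero columns or invertible factors on
the right.
\<close>

lemma rank_eqI:
  assumes M: "M \<in> carrier_mat n a" and M': "M' \<in> carrier_mat n b" and eq: "img M = img M'"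
  shows "vec_space.rank n M = vec_space.rank n M'"
proof -
  interpret vec_space "TYPE(complex)" n .
  have "span (set (cols M)) = img M"
    using col_space_eq[OF M] M by (force simp: col_space_def img_def)
  moreover have "span (set (cols M')) = img M'"
    using col_space_eq[OF M'] M' by (force simp: col_space_def img_def)
  ultimately show ?thesis unfolding rank_def eq by simp
qed

lemma rank_inj_mat:
  assumes M: "(M :: complex mat) \<in> carrier_mat n q" and inj: "inj_mat M"
  shows "vec_space.rank n M = q"
proof -
  interpret vec_space "TYPE(complex)" n .
  have dist: "distinct (cols M)"
    unfolding distinct_conv_nth
  proof (intro allI impI)
    fix i j assume ij: "i < length (cols M)" "j < length (cols M)" "i \<noteq> j"
    hence ij': "i < q" "j < q" using M by auto
    show "cols M ! i \<noteq> cols M ! j"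
    proof
      assume "cols M ! i = cols M ! j"
      hence c: "col M i = col M j" using ij' M by simp
      have "M *\<^sub>v (unit_vec q i - unit_vec q j) = M *\<^sub>v unit_vec q i - M *\<^sub>v unit_vec q j"
        using M by (intro mult_minus_distrib_mat_vec) auto
      also have "\<dots> = 0\<^sub>v n"
      proof (rule eq_vecI)
        fix l assume l: "l < dim_vec (0\<^sub>v n :: complex vec)"
        have "col M i $ l = col M j $ l" using c by simp
        thus "(M *\<^sub>v unit_vec q i - M *\<^sub>v unit_vec q j) $ l = (0\<^sub>v n :: complex vec) $ l"
          using l M ij' by simp
      qed (use M in auto)
      finally have "unit_vec q i - unit_vec q j = (0\<^sub>v q :: complex vec)"
        using inj_matD[OF inj M] by auto
      hence "(unit_vec q i - unit_vec q j :: complex vec) $ i = 0" using ij' by simp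
      thus False using ij' ij(3) by simp
    qed
  qed
  have "lin_indpt (set (cols M))"
  proof
    assume "lin_dep (set (cols M))"
    then obtain v where "v \<in> carrier_vec q" "v \<noteq> 0\<^sub>v q" "M *\<^sub>v v = 0\<^sub>v n"
      using lin_depE[OF M _ dist] by blast
    thus False using inj_matD[OF inj M] by blast
  qed
  thus ?thesis by (rule lin_indpt_full_rank[OF M dist])
qed

lemma img_mult_invertible:
  assumes X: "X \<in> carrier_mat n m" and N: "N \<in> carrier_mat m m" "N' \<in> carrier_mat m m" and inv: "N
      * N' = 1\<^sub>m m"
  shows "img (X * N) = img X"
proof
  show "img (X * N) \<subseteq> img X"
    using X N by (auto simp: img_def assoc_mult_mat_vec[of _ n m _ m])
  show "img X \<subseteq> img (X * N)"
  proof
    fix y assume "y \<in> img X"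
    then obtain v where v: "v \<in> carrier_vec m" "y = X *\<^sub>v v" using X by (auto simp: img_def)
    have "(X * N) *\<^sub>v (N' *\<^sub>v v) = X *\<^sub>v ((N * N') *\<^sub>v v)"
      using X N v(1) by (simp add: assoc_mult_mat_vec[of _ n m _ m] assoc_mult_mat_vec[of _ m m _ m])
    also have "\<dots> = y" using v inv by simp
    finally have "y = (X * N) *\<^sub>v (N' *\<^sub>v v)" by simp
    moreover have "N' *\<^sub>v v \<in> carrier_vec (dim_col (X * N))" using N v by simp
    ultimately show "y \<in> img (X * N)" unfolding img_def by (rule image_eqI)
  qed
qed

lemma img_zcols:
  assumes "G \<in> carrier_mat m q" shows "img (zcols k G) = img G"
proof
  have Z: "zcols k G \<in> carrier_mat m (k + q)" using assms by simp
  show "img (zcols k G) \<subseteq> img G"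
  proof
    fix y assume "y \<in> img (zcols k G)"
    then obtain v where v: "v \<in> carrier_vec (k + q)" "y = zcols k G *\<^sub>v v" using Z by (auto simp:
        img_def)
    have "v = vec_first v k @\<^sub>v vec_last v q" using v(1) by simp
    hence "y = G *\<^sub>v vec_last v q"
      using v(2) zcols_mult_vec[OF assms, of "vec_first v k" k "vec_last v q"] by simp
    thus "y \<in> img G" using assms by (auto simp: img_def)
  qed
  show "img G \<subseteq> img (zcols k G)"
  proof
    fix y assume "y \<in> img G"
    then obtain v where v: "v \<in> carrier_vec q" "y = G *\<^sub>v v" using assms by (auto simp: img_def)
    have "zcols k G *\<^sub>v (0\<^sub>v k @\<^sub>v v) = y"
      using v zcols_mult_vec[OF assms, of "0\<^sub>v k" k v] by simp
    thus "y \<in> img (zcols k G)"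
      using v Z by (auto simp: img_def intro!: image_eqI[of _ _ "0\<^sub>v k @\<^sub>v v"])
  qed
qed

text \<open>
The inner product of \<open>v\<close> and \<open>C\<^sup>* C v\<close> is \<open>\<parallel>C v\<parallel>\<^sup>2\<close>.
\<close>

lemma adjoint_mult_vec_zero:
  assumes C: "(C :: complex mat) \<in> carrier_mat m q" and v: "v \<in> carrier_vec q"
    and z: "mat_adjoint C *\<^sub>v (C *\<^sub>v v) = 0\<^sub>v q"
  shows "C *\<^sub>v v = 0\<^sub>v m"
proof -
  define w where "w = C *\<^sub>v v"
  have w: "w \<in> carrier_vec m" using C v by (simp add: w_def)
  have wi: "w $ i = (\<Sum>j<q. C $$ (i, j) * v $ j)" if "i < m" for i
    using that C v by (auto simp: w_def scalar_prod_def lessThan_atLeast0)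
  have zj: "(\<Sum>i<m. cnj (C $$ (i, j)) * w $ i) = 0" if "j < q" for j
  proof -
    have "(mat_adjoint C *\<^sub>v w) $ j = (\<Sum>i<m. cnj (C $$ (i, j)) * w $ i)"
      using that C w by (auto simp: scalar_prod_def mat_adjoint_index lessThan_atLeast0 intro!:
          sum.cong)
    thus ?thesis using z that by (simp add: w_def)
  qed
  have "complex_of_real (\<Sum>i<m. (norm (w $ i))\<^sup>2) = (\<Sum>i<m. cnj (w $ i) * w $ i)"
    by (simp add: complex_norm_square mult.commute del: of_real_power)
  also have "\<dots> = (\<Sum>i<m. \<Sum>j<q. cnj (v $ j) * (cnj (C $$ (i, j)) * w $ i))"
    by (intro sum.cong refl) (simp add: wi sum_distrib_right sum_distrib_left mult_ac)
  also have "\<dots> = (\<Sum>j<q. cnj (v $ j) * (\<Sum>i<m. cnj (C $$ (i, j)) * w $ i))"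
    by (subst sum.swap) (simp add: sum_distrib_left)
  also have "\<dots> = 0" by (simp add: zj)
  finally have "(\<Sum>i<m. (norm (w $ i))\<^sup>2) = 0" by (simp del: of_real_sum)
  hence "w $ i = 0" if "i < m" for i using that by (subst (asm) sum_nonneg_eq_0_iff) auto
  thus ?thesis using w unfolding w_def[symmetric] by (intro eq_vecI) auto
qed

lemma det_adjoint_mult_neq_0_iff:
  assumes C: "(C :: complex mat) \<in> carrier_mat m q"
  shows "det (mat_adjoint C * C) \<noteq> 0 \<longleftrightarrow> inj_mat C"
proof -
  have A: "mat_adjoint C \<in> carrier_mat q m" using C by (intro carrier_matI) (auto simp:
      mat_adjoint_index)
  have H: "mat_adjoint C * C \<in> carrier_mat q q" using A C by simp
  have z: "(mat_adjoint C * C) *\<^sub>v v = 0\<^sub>v q \<longleftrightarrow> C *\<^sub>v v = 0\<^sub>v m" if v: "v \<in> carrier_vec q" for v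
    unfolding assoc_mult_mat_vec[OF A C v]
    using adjoint_mult_vec_zero[OF C v] A by auto
  show ?thesis
    unfolding det_0_iff_vec_prod_zero[OF H] inj_mat_def using z C by auto
qed

text \<open>
Evaluating at all points, a kernel vector of \<open>C\<^sup>* C\<close> over the ring is one of \<open>C\<close>. So the
determinant of \<open>C\<^sup>* C\<close> is a nonzero element, and \<open>C\<close> is injective where it does not vanish.
\<close>

lemma inj_mat_generic:
  assumes C: "C \<in> carrier_mat m q" and inj: "inj_mat C"
  shows "\<exists>x. inj_mat (evm x C)"
proof -
  let ?H = "adj C * C"
  have A: "adj C \<in> carrier_mat q m" using C by simp
  have H: "?H \<in> carrier_mat q q" by (rule mult_carrier_mat[OF A C])
  have "det ?H \<noteq> 0"
    unfolding det_0_iff_vec_prod_zero[OF H]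
  proof safe
    fix v assume v: "v \<in> carrier_vec q" "v \<noteq> 0\<^sub>v q" "?H *\<^sub>v v = 0\<^sub>v q"
    have "C *\<^sub>v v = 0\<^sub>v m"
    proof (rule evv_eqI)
      fix x
      have "mat_adjoint (evm x C) *\<^sub>v (evm x C *\<^sub>v evv x v) = evv x (?H *\<^sub>v v)"
        using C A v(1)
        by (simp add: assoc_mult_mat_vec[of _ q m _ q] ev_hom.mult_mat_vec_hom[of _ q m]
            ev_hom.mult_mat_vec_hom[of _ m q] evm_adj)
      also have "\<dots> = 0\<^sub>v q" using v(3) by (simp add: ev_hom.vec_hom_zero)
      finally have z: "mat_adjoint (evm x C) *\<^sub>v (evm x C *\<^sub>v evv x v) = 0\<^sub>v q" .
      have "evm x C *\<^sub>v evv x v = 0\<^sub>v m"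
        by (rule adjoint_mult_vec_zero[OF _ _ z]) (use C v(1) in auto)
      thus "evv x (C *\<^sub>v v) = evv x (0\<^sub>v m)"
        using C v(1) by (simp add: ev_hom.mult_mat_vec_hom[of _ m q] ev_hom.vec_hom_zero)
    qed
    thus False using inj_matD[OF inj C v(1)] v(2) by blast
  qed
  then obtain x where "ev (det ?H) x \<noteq> 0" using circ_nonzero by blast
  hence "det (mat_adjoint (evm x C) * evm x C) \<noteq> 0"
    using C A by (simp add: ev_hom.hom_det[symmetric] ev_hom.mat_hom_mult[of _ q m _ q] evm_adj)
  thus ?thesis using det_adjoint_mult_neq_0_iff[of "evm x C" m q] C by auto
qed

text \<open>
The left inverse is \<open>(C\<^sup>* C)\<^sup>-\<^sup>1 C\<^sup>*\<close>; the determinant of \<open>C\<^sup>* C\<close> has no zeros, so it is a unit.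
\<close>

lemma left_inverse_exists:
  assumes C: "C \<in> carrier_mat m q" and inj: "\<And>x. inj_mat (evm x C)"
  obtains D where "D \<in> carrier_mat q m" "D * C = 1\<^sub>m q"
proof -
  let ?H = "adj C * C"
  have A: "adj C \<in> carrier_mat q m" using C by simp
  have H: "?H \<in> carrier_mat q q" by (rule mult_carrier_mat[OF A C])
  have "ev (det ?H) x \<noteq> 0" for x
    using det_adjoint_mult_neq_0_iff[of "evm x C" m q] inj[of x] C A
    by (simp add: ev_hom.hom_det[symmetric] ev_hom.mat_hom_mult[of _ q m _ q] evm_adj)
  then obtain u where u: "det ?H * u = 1" using circ_inverse_exists by blast
  have J: "adj_mat ?H \<in> carrier_mat q q" "adj_mat ?H * ?H = det ?H \<cdot>\<^sub>m 1\<^sub>m q" using adj_mat[OF H]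
      by auto
  have "((u \<cdot>\<^sub>m adj_mat ?H) * adj C) * C = (u \<cdot>\<^sub>m adj_mat ?H) * ?H"
    using J A C by (intro assoc_mult_mat) auto
  also have "\<dots> = u \<cdot>\<^sub>m (adj_mat ?H * ?H)" by (rule mult_smult_assoc_mat[OF J(1) H])
  also have "\<dots> = 1\<^sub>m q" unfolding J(2) using u by (intro eq_matI) (auto simp: mult.commute)
  finally have "((u \<cdot>\<^sub>m adj_mat ?H) * adj C) * C = 1\<^sub>m q" .
  moreover have "(u \<cdot>\<^sub>m adj_mat ?H) * adj C \<in> carrier_mat q m"
    by (rule mult_carrier_mat[OF smult_carrier_mat[OF J(1)] A])
  ultimately show ?thesis using that by blast
qed

text \<open>
This is the splitting of the kernel of the constant function \<open>Y\<close>, evaluated at a point where the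
injective part stays injective.
\<close>

lemma complex_rank_reduction:
  assumes Y: "(Y :: complex mat) \<in> carrier_mat n m"
  obtains k q C where "m = k + q" "C \<in> carrier_mat n q" "inj_mat C" "img Y = img C" "k = 0 \<longrightarrow> inj_mat Y"
proof -
  define K where "K = map_mat cconst Y"
  have K: "K \<in> carrier_mat n m" using Y by (simp add: K_def)
  have KY: "evm x K = Y" for x using Y by (auto simp: K_def intro!: eq_matI)
  obtain k q N C where m: "m = k + q" and N: "N \<in> unitary_circ m" and C: "C \<in> carrier_mat n q"
      "inj_mat C"
    and KN: "\<And>a b. a \<in> carrier_vec k \<Longrightarrow> b \<in> carrier_vec q \<Longrightarrow> K *\<^sub>v (N *\<^sub>v (a @\<^sub>v b)) = C *\<^sub>v b"
    using kernel_splitting[OF K] by blast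
  note Nc = unitary_circ_carrier[OF N]
  have eq: "K * N = zcols k C"
  proof (rule mat_eq_by_append_vec[of _ n k q])
    fix a b :: "circ vec" assume ab: "a \<in> carrier_vec k" "b \<in> carrier_vec q"
    hence "a @\<^sub>v b \<in> carrier_vec m" using m by simp
    thus "K * N *\<^sub>v (a @\<^sub>v b) = zcols k C *\<^sub>v (a @\<^sub>v b)"
      using KN[OF ab] zcols_mult_vec[OF C(1) ab] by (simp add: assoc_mult_mat_vec[OF K Nc])
  qed (use K Nc C m in auto)
  obtain x where x: "inj_mat (evm x C)" using inj_mat_generic[OF C] by blast
  have U: "evm x N \<in> carrier_mat m m" "mat_adjoint (evm x N) \<in> carrier_mat m m"
    "evm x N * mat_adjoint (evm x N) = 1\<^sub>m m" "mat_adjoint (evm x N) * evm x N = 1\<^sub>m m"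
    using N by (auto simp: unitary_circ_def unitary_group_def mat_adjoint_index intro!: carrier_matI)
  have Cx: "evm x C \<in> carrier_mat n q" using C by simp
  have YN: "Y * evm x N = zcols k (evm x C)"
    using arg_cong[OF eq, of "evm x"] ev_hom.mat_hom_mult[OF K Nc, of x] C
    by (simp add: KY) (auto simp: zcols_def intro!: eq_matI)
  have "img Y = img (evm x C)"
    using img_mult_invertible[OF Y U(1,2,3)] img_zcols[OF Cx, of k] YN by simp
  moreover have "inj_mat Y" if k: "k = 0"
    unfolding inj_mat_def
  proof (intro ballI impI)
    fix v assume v: "v \<in> carrier_vec (dim_col Y)" "Y *\<^sub>v v = 0\<^sub>v (dim_row Y)"
    hence vm: "v \<in> carrier_vec m" using Y by simp
    define w where "w = mat_adjoint (evm x N) *\<^sub>v v"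
    have w: "w \<in> carrier_vec m" using U vm by (simp add: w_def)
    have vw: "v = evm x N *\<^sub>v w"
      using U vm by (simp add: w_def assoc_mult_mat_vec[symmetric, of _ m m _ m])
    have "zcols k (evm x C) = evm x C" using k by (auto simp: zcols_def intro!: eq_matI)
    hence "evm x C *\<^sub>v w = (Y * evm x N) *\<^sub>v w" using YN by simp
    also have "\<dots> = 0\<^sub>v n" using v Y U w vw by (simp add: assoc_mult_mat_vec[of _ n m _ m])
    finally have "w = 0\<^sub>v m" using inj_matD[OF x Cx, of w] w k m by simp
    thus "v = 0\<^sub>v (dim_col Y)" using vw U Y by auto
  qed
  ultimately show ?thesis using that[OF m Cx x] by simp
qed

lemma rank_mult_inj:
  assumes P: "P \<in> carrier_mat n' n" "inj_mat P" and Y: "(Y :: complex mat) \<in> carrier_mat n m"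
  shows "vec_space.rank n' (P * Y) = vec_space.rank n Y"
proof -
  obtain k q C where "m = k + q" and C: "C \<in> carrier_mat n q" "inj_mat C" "img Y = img C"
      and "k = 0 \<longrightarrow> inj_mat Y"
    by (rule complex_rank_reduction[OF Y])
  have im: "img (P * Z) = (\<lambda>y. P *\<^sub>v y) ` img Z" if "Z \<in> carrier_mat n l" for Z l
    using P(1) that by (auto simp: img_def assoc_mult_mat_vec[of _ n' n _ l] image_image intro!:
        image_cong)
  have "inj_mat (P * C)"
    unfolding inj_mat_def
  proof (intro ballI impI)
    fix v assume v: "v \<in> carrier_vec (dim_col (P * C))" "(P * C) *\<^sub>v v = 0\<^sub>v (dim_row (P * C))"
    hence v': "v \<in> carrier_vec q" "P *\<^sub>v (C *\<^sub>v v) = 0\<^sub>v n'"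
      using P C by (auto simp: assoc_mult_mat_vec[of _ n' n _ q])
    have "C *\<^sub>v v = 0\<^sub>v n" using inj_matD[OF P(2,1) _ v'(2)] C v'(1) by auto
    thus "v = 0\<^sub>v (dim_col (P * C))" using inj_matD[OF C(2,1) v'(1)] C by simp
  qed
  hence "vec_space.rank n' (P * C) = q" using P C by (intro rank_inj_mat) auto
  moreover have "vec_space.rank n' (P * Y) = vec_space.rank n' (P * C)"
    using P C Y im by (intro rank_eqI[of _ n' m _ q]) auto
  moreover have "vec_space.rank n Y = vec_space.rank n C"
    using Y C by (intro rank_eqI) auto
  moreover have "vec_space.rank n C = q" using C by (intro rank_inj_mat) auto
  ultimately show ?thesis by simp
qed

lemma full_rank_inj:
  assumes Y: "(Y :: complex mat) \<in> carrier_mat n m" and r: "vec_space.rank n Y = m"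
  shows "inj_mat Y"
proof -
  obtain k q C where C: "m = k + q" "C \<in> carrier_mat n q" "inj_mat C" "img Y = img C" "k = 0 \<longrightarrow>
      inj_mat Y"
    by (rule complex_rank_reduction[OF Y])
  have "q = m" using rank_eqI[OF Y C(2,4)] rank_inj_mat[OF C(2,3)] r by simp
  thus ?thesis using C by simp
qed

lemma inj_mat_unitary:
  assumes "N \<in> unitary_circ d" shows "inj_mat (evm x N)"
  unfolding inj_mat_def
proof (intro ballI impI)
  have U: "evm x N \<in> carrier_mat d d" "mat_adjoint (evm x N) \<in> carrier_mat d d"
    "mat_adjoint (evm x N) * evm x N = 1\<^sub>m d"
    using assms by (auto simp: unitary_circ_def unitary_group_def mat_adjoint_index intro!:
        carrier_matI)
  fix v assume v: "v \<in> carrier_vec (dim_col (evm x N))" "evm x N *\<^sub>v v = 0\<^sub>v (dim_row (evm x N))"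
  have "v = (mat_adjoint (evm x N) * evm x N) *\<^sub>v v" using U v(1) by auto
  also have "\<dots> = mat_adjoint (evm x N) *\<^sub>v (evm x N *\<^sub>v v)"
    using U v(1) by (intro assoc_mult_mat_vec[of _ d d _ d]) auto
  also have "\<dots> = 0\<^sub>v d" using U v(2) by auto
  finally show "v = 0\<^sub>v (dim_col (evm x N))" using U by auto
qed

lemma rank_reduction:
  assumes A: "A \<in> carrier_mat d d" and d: "d = k + q" and N: "N \<in> unitary_circ d"
    and G: "G \<in> carrier_mat d q" and eq: "A * N = shm a N * zcols k G"
  shows "vec_space.rank d (evm x (itc a A (Suc n))) =
     vec_space.rank d (evm x (shm (real n * a) G * itc a (lower k G) n))"
proof -
  note Nc = unitary_circ_carrier[OF N]
  have G': "G \<in> carrier_mat (k + q) q" using G d by simp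
  note L = lower_carrier[OF G']
  have B: "zcols k G \<in> carrier_mat d d" using zcols_carrier[OF G', of k] d by simp
  let ?Y = "shm (real n * a) G * itc a (lower k G) n"
  have Y: "?Y \<in> carrier_mat d q" using G itc_carrier[OF L] by auto
  have Yx: "evm x ?Y \<in> carrier_mat d q" using Y by simp
  have Zx: "zcols k (evm x ?Y) \<in> carrier_mat d d" using zcols_carrier[OF Yx, of k] d by simp
  have ezc: "evm x (zcols k ?Y) = zcols k (evm x ?Y)"
    by (auto simp: zcols_def intro!: eq_matI)
  let ?A = "evm x (itc a A (Suc n))" and ?N = "evm x N" and ?M = "evm (x + real (Suc n) * a) N"
  have Ac: "?A \<in> carrier_mat d d" using itc_carrier[OF A, of a "Suc n"] by auto
  have U: "?N \<in> carrier_mat d d" "mat_adjoint ?N \<in> carrier_mat d d" "?N * mat_adjoint ?N = 1\<^sub>m d"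
      "?M \<in> carrier_mat d d"
    using N by (auto simp: unitary_circ_def unitary_group_def mat_adjoint_index intro!: carrier_matI)
  have conj: "itc a A (Suc n) * N = shm (real (Suc n) * a) N * zcols k ?Y"
    using itc_conj[OF A Nc B eq, of "Suc n"] itc_zcols[OF G', of a n] by simp
  have e: "?A * ?N = ?M * zcols k (evm x ?Y)"
  proof -
    have "?A * ?N = evm x (itc a A (Suc n) * N)"
      using itc_carrier[OF A, of a "Suc n"] Nc by (intro ev_hom.mat_hom_mult[symmetric])
    also have "\<dots> = evm x (shm (real (Suc n) * a) N) * evm x (zcols k ?Y)"
      unfolding conj using Nc zcols_carrier[OF Y, of k] d by (intro ev_hom.mat_hom_mult[of _ d d _
          d]) auto
    finally show ?thesis by (simp only: ezc evm_shm)
  qed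
  have "vec_space.rank d ?A = vec_space.rank d (?A * ?N)"
    using img_mult_invertible[OF Ac U(1-3)] Ac U by (intro rank_eqI[of _ d d _ d]) auto
  also have "\<dots> = vec_space.rank d (zcols k (evm x ?Y))"
    unfolding e using inj_mat_unitary[OF N] by (intro rank_mult_inj[OF U(4) _ Zx])
  also have "\<dots> = vec_space.rank d (evm x ?Y)"
    by (rule rank_eqI[OF Zx Yx img_zcols[OF Yx]])
  finally show ?thesis .
qed

definition const_ranks :: "nat \<Rightarrow> real \<Rightarrow> circ mat \<Rightarrow> bool" where
  "const_ranks d a A \<longleftrightarrow> (\<forall>n\<ge>1. \<exists>r. \<forall>x. vec_space.rank d (evm x (itc a A n)) = r)"

text \<open>
At each point \<open>A\<close> and \<open>G\<close> have the same rank. It is \<open>q\<close> at some point, because \<open>G\<close> is injective over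
the ring, hence it is \<open>q\<close> everywhere. Translates of \<open>G\<close> then preserve ranks, so the iterates of the
lower block have the ranks of the iterates of \<open>A\<close>.
\<close>

lemma const_ranks_reduction:
  assumes A: "A \<in> carrier_mat d d" and d: "d = k + q" and N: "N \<in> unitary_circ d"
    and G: "G \<in> carrier_mat d q" "inj_mat G" and eq: "A * N = shm a N * zcols k G"
    and cr: "const_ranks d a A"
  shows "\<And>x. inj_mat (evm x G)" and "const_ranks q a (lower k G)"
proof -
  note rr = rank_reduction[OF A d N G(1) eq]
  have G': "G \<in> carrier_mat (k + q) q" using G d by simp
  note L = lower_carrier[OF G']
  obtain r where r: "\<And>x. vec_space.rank d (evm x (itc a A (Suc 0))) = r"
    using cr unfolding const_ranks_def by (metis One_nat_def order_refl)
  have rG: "vec_space.rank d (evm x G) = r" for x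
    using rr[of x 0] r[of x] G(1) carrier_matD[OF L] by simp
  obtain x0 where "inj_mat (evm x0 G)" using inj_mat_generic[OF G] by blast
  hence "r = q" using rank_inj_mat[of "evm x0 G" d q] rG[of x0] G(1) by auto
  thus inj: "inj_mat (evm x G)" for x
    using full_rank_inj[of "evm x G" d q] rG[of x] G(1) by auto
  show "const_ranks q a (lower k G)"
    unfolding const_ranks_def
  proof (intro allI impI)
    fix n :: nat
    obtain r where r: "\<And>x. vec_space.rank d (evm x (itc a A (Suc n))) = r"
      using cr unfolding const_ranks_def by (metis le_add1 plus_1_eq_Suc)
    have "vec_space.rank q (evm x (itc a (lower k G) n)) = r" for x
    proof -
      have "evm x (shm (real n * a) G * itc a (lower k G) n) =
          evm (x + real n * a) G * evm x (itc a (lower k G) n)"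
        using G(1) itc_carrier[OF L] by (subst ev_hom.mat_hom_mult[of _ d q _ q]) auto
      thus ?thesis
        using rr[of x n] r[of x] rank_mult_inj[of "evm (x + real n * a) G" d q "evm x (itc a
            (lower k G) n)" q]
          inj G(1) itc_carrier[OF L, of a n] by auto
    qed
    thus "\<exists>r. \<forall>x. vec_space.rank q (evm x (itc a (lower k G) n)) = r" by blast
  qed
qed

section \<open>Spanning lists of vectors\<close>

text \<open>
Linear combinations over \<open>circ\<close> of a set of vectors. Unlike the invertibility of a matrix of
columns, spanning is insensitive to the order of the vectors.
\<close>

inductive_set rspan :: "nat \<Rightarrow> circ vec set \<Rightarrow> circ vec set" for d S where
  zero: "0\<^sub>v d \<in> rspan d S"
| step: "v \<in> S \<Longrightarrow> w \<in> rspan d S \<Longrightarrow> r \<cdot>\<^sub>v v + w \<in> rspan d S"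

lemma rspan_carrier:
  assumes "S \<subseteq> carrier_vec d" "w \<in> rspan d S" shows "w \<in> carrier_vec d"
  using assms(2,1) by induction auto

lemma rspan_base:
  assumes "S \<subseteq> carrier_vec d" "v \<in> S" shows "v \<in> rspan d S"
proof -
  have "1 \<cdot>\<^sub>v v + 0\<^sub>v d \<in> rspan d S" using assms(2) by (intro rspan.intros)
  thus ?thesis using assms by auto
qed

lemma rspan_add:
  assumes "S \<subseteq> carrier_vec d" "u \<in> rspan d S" "w \<in> rspan d S" shows "u + w \<in> rspan d S"
  using assms(2)
proof induction
  case zero
  thus ?case using assms(3) rspan_carrier[OF assms(1,3)] by simp
next
  case (step v u r)
  have "(r \<cdot>\<^sub>v v + u) + w = r \<cdot>\<^sub>v v + (u + w)"
    using step rspan_carrier[OF assms(1)] assms by (intro assoc_add_vec[of _ d]) auto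
  thus ?case using rspan.step[OF step(1,3)] by simp
qed

lemma rspan_smult:
  assumes "S \<subseteq> carrier_vec d" "u \<in> rspan d S" shows "c \<cdot>\<^sub>v u \<in> rspan d S"
  using assms(2)
proof induction
  case zero
  have "c \<cdot>\<^sub>v 0\<^sub>v d = (0\<^sub>v d :: circ vec)" by (intro eq_vecI) auto
  thus ?case by (simp add: rspan.zero)
next
  case (step v u r)
  have "c \<cdot>\<^sub>v (r \<cdot>\<^sub>v v + u) = (c * r) \<cdot>\<^sub>v v + c \<cdot>\<^sub>v u"
    using step rspan_carrier[OF assms(1)] assms(1)
    by (subst smult_add_distrib_vec[of _ d]) (auto simp: smult_smult_assoc)
  thus ?case using rspan.step[OF step(1,3)] by simp
qed

lemma rspan_map:
  assumes S: "S \<subseteq> carrier_vec q" and S': "S' \<subseteq> carrier_vec d"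
    and T0: "T (0\<^sub>v q) = 0\<^sub>v d"
    and T: "\<And>r v w. v \<in> carrier_vec q \<Longrightarrow> w \<in> carrier_vec q \<Longrightarrow> T (r \<cdot>\<^sub>v v + w) = r \<cdot>\<^sub>v T v + T w"
    and TS: "\<And>v. v \<in> S \<Longrightarrow> T v \<in> rspan d S'"
    and w: "w \<in> rspan q S"
  shows "T w \<in> rspan d S'"
  using w
proof induction
  case zero thus ?case by (simp add: T0 rspan.zero)
next
  case (step v u r)
  have "T (r \<cdot>\<^sub>v v + u) = r \<cdot>\<^sub>v T v + T u"
    using step S rspan_carrier[OF S] by (intro T) auto
  thus ?case using step TS by (simp add: rspan_add[OF S'] rspan_smult[OF S'])
qed

lemma mat_vec_linear:
  fixes M :: "'a :: comm_ring_1 mat"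
  assumes "M \<in> carrier_mat d q"
  shows "M *\<^sub>v 0\<^sub>v q = 0\<^sub>v d"
    "v \<in> carrier_vec q \<Longrightarrow> w \<in> carrier_vec q \<Longrightarrow> M *\<^sub>v (r \<cdot>\<^sub>v v + w) = r \<cdot>\<^sub>v (M *\<^sub>v v) + M *\<^sub>v w"
proof -
  show "M *\<^sub>v 0\<^sub>v q = 0\<^sub>v d" using assms by auto
  assume "v \<in> carrier_vec q" "w \<in> carrier_vec q"
  thus "M *\<^sub>v (r \<cdot>\<^sub>v v + w) = r \<cdot>\<^sub>v (M *\<^sub>v v) + M *\<^sub>v w"
    using assms by (subst mult_add_distrib_mat_vec[of _ d q]) (auto simp: mult_mat_vec[of _ d q])
qed

lemma mat_of_cols_mult_in_rspan:
  assumes "set vs \<subseteq> carrier_vec d" "y \<in> carrier_vec (length vs)"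
  shows "mat_of_cols d vs *\<^sub>v y \<in> rspan d (set vs)"
  using assms
proof (induction vs arbitrary: y)
  case Nil
  have "mat_of_cols d [] *\<^sub>v y = 0\<^sub>v d" using Nil by (intro eq_vecI) (auto simp: scalar_prod_def)
  thus ?case by (simp add: rspan.zero)
next
  case (Cons v vs)
  define y' where "y' = vec (length vs) (\<lambda>i. y $ Suc i)"
  have v: "v \<in> carrier_vec d" using Cons.prems by simp
  have "mat_of_cols d (v # vs) *\<^sub>v y = y $ 0 \<cdot>\<^sub>v v + mat_of_cols d vs *\<^sub>v y'"
  proof (rule eq_vecI)
    fix i assume "i < dim_vec (y $ 0 \<cdot>\<^sub>v v + mat_of_cols d vs *\<^sub>v y')"
    hence i: "i < d" by simp
    show "(mat_of_cols d (v # vs) *\<^sub>v y) $ i = (y $ 0 \<cdot>\<^sub>v v + mat_of_cols d vs *\<^sub>v y') $ i"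
      using i v Cons.prems
      by (auto simp: scalar_prod_def mat_of_cols_index y'_def sum.atLeast0_lessThan_Suc_shift
          mult.commute
          simp del: sum.op_ivl_Suc)
  qed simp
  moreover have "mat_of_cols d vs *\<^sub>v y' \<in> rspan d (set (v # vs))"
  proof -
    have 1: "mat_of_cols d vs *\<^sub>v y' \<in> rspan d (set vs)"
      using Cons by (auto simp: y'_def)
    have s: "set vs \<subseteq> carrier_vec d" "set (v # vs) \<subseteq> carrier_vec d" using Cons.prems by auto
    show ?thesis
      using rspan_map[OF s, of "\<lambda>x. x", OF _ _ _ 1] rspan_base[OF s(2)] by auto
  qed
  ultimately show ?case by (simp add: rspan.step)
qed

lemma rspan_imp_mat_of_cols:
  assumes "set vs \<subseteq> carrier_vec d" "w \<in> rspan d (set vs)"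
  shows "\<exists>y \<in> carrier_vec (length vs). mat_of_cols d vs *\<^sub>v y = w"
  using assms(2)
proof induction
  case zero
  show ?case by (rule bexI[of _ "0\<^sub>v (length vs)"]) auto
next
  case (step v w r)
  then obtain y where y: "y \<in> carrier_vec (length vs)" "mat_of_cols d vs *\<^sub>v y = w" by blast
  obtain j where j: "j < length vs" "v = vs ! j" using step(1) by (auto simp: in_set_conv_nth)
  have M: "mat_of_cols d vs \<in> carrier_mat d (length vs)" by simp
  have v: "v \<in> carrier_vec d" using step(1) assms(1) by auto
  have c: "mat_of_cols d vs *\<^sub>v unit_vec (length vs) j = v"
    using j v by (intro eq_vecI) (auto simp: mat_of_cols_index)
  have "mat_of_cols d vs *\<^sub>v (r \<cdot>\<^sub>v unit_vec (length vs) j + y) = r \<cdot>\<^sub>v v + w"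
    using mat_vec_linear(2)[OF M, of "unit_vec (length vs) j" y r] y c by simp
  thus ?case using y by (intro bexI[of _ "r \<cdot>\<^sub>v unit_vec (length vs) j + y"]) auto
qed

text \<open>
Preimages of the unit vectors are the columns of a right inverse; at every point it is also a left
inverse.
\<close>

lemma spanning_imp_inverse:
  assumes vs: "set vs \<subseteq> carrier_vec d" "length vs = d" and span: "carrier_vec d \<subseteq> rspan d (set vs)"
  obtains W where "W \<in> carrier_mat d d" "mat_of_cols d vs * W = 1\<^sub>m d" "W * mat_of_cols d vs = 1\<^sub>m d"
proof -
  let ?V = "mat_of_cols d vs"
  have V: "?V \<in> carrier_mat d d" using vs(2) by auto
  have "\<forall>j. \<exists>y. y \<in> carrier_vec d \<and> ?V *\<^sub>v y = unit_vec d j"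
    using rspan_imp_mat_of_cols[OF vs(1)] span vs(2) by (metis subsetD unit_vec_carrier)
  then obtain y where y: "\<And>j. y j \<in> carrier_vec d" "\<And>j. ?V *\<^sub>v y j = unit_vec d j" by metis
  define W where "W = mat d d (\<lambda>(i, j). y j $ i)"
  have W: "W \<in> carrier_mat d d" by (simp add: W_def)
  have VW: "?V * W = 1\<^sub>m d"
  proof (rule eq_matI)
    fix i j assume ij: "i < dim_row (1\<^sub>m d :: circ mat)" "j < dim_col (1\<^sub>m d :: circ mat)"
    have "col W j = y j" using ij y(1)[of j] by (intro eq_vecI) (auto simp: W_def)
    hence "(?V * W) $$ (i, j) = (?V *\<^sub>v y j) $ i" using ij V W by simp
    thus "(?V * W) $$ (i, j) = 1\<^sub>m d $$ (i, j)" using ij y(2)[of j] by simp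
  qed (use V W in auto)
  have "W * ?V = 1\<^sub>m d"
  proof (rule evm_eqI)
    fix x
    have "evm x ?V * evm x W = 1\<^sub>m d"
      using arg_cong[OF VW, of "evm x"] ev_hom.mat_hom_mult[OF V W, of x] by (simp add:
          ev_hom.mat_hom_one)
    hence "evm x W * evm x ?V = 1\<^sub>m d"
      using V W by (intro mat_mult_left_right_inverse[of "evm x ?V" d]) auto
    thus "evm x (W * ?V) = evm x (1\<^sub>m d)"
      using ev_hom.mat_hom_mult[OF W V, of x] by (simp add: ev_hom.mat_hom_one)
  qed
  thus ?thesis using that W VW by blast
qed

lemma mult_append_zero_vec:
  fixes D :: "'a :: comm_ring_1 mat"
  assumes D: "D \<in> carrier_mat m (k + q)" and u: "u \<in> carrier_vec k"
  shows "D *\<^sub>v (u @\<^sub>v 0\<^sub>v q) = mat m k (\<lambda>(i, j). D $$ (i, j)) *\<^sub>v u"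
proof (rule eq_vecI)
  fix i assume "i < dim_vec (mat m k (\<lambda>(i, j). D $$ (i, j)) *\<^sub>v u)"
  hence i: "i < m" by simp
  have "(D *\<^sub>v (u @\<^sub>v 0\<^sub>v q)) $ i = (\<Sum>j = 0..<k + q. D $$ (i, j) * (u @\<^sub>v 0\<^sub>v q) $ j)"
    using D i u by (simp add: scalar_prod_def)
  also have "\<dots> = (\<Sum>j = 0..<k. D $$ (i, j) * (u @\<^sub>v 0\<^sub>v q) $ j)"
    using u by (intro sum.mono_neutral_right) auto
  also have "\<dots> = (mat m k (\<lambda>(i, j). D $$ (i, j)) *\<^sub>v u) $ i"
    using i u by (auto simp: scalar_prod_def intro!: sum.cong)
  finally show "(D *\<^sub>v (u @\<^sub>v 0\<^sub>v q)) $ i = (mat m k (\<lambda>(i, j). D $$ (i, j)) *\<^sub>v u) $ i" .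
qed (use D in auto)

text \<open>
The left inverse \<open>L\<close> decomposes every vector \<open>w\<close> into \<open>E L w\<close>, in the span of \<open>es\<close>, and a vector in
the kernel of \<open>L\<close>. The frame \<open>fs\<close> of that kernel comes from \<open>kernel_splitting\<close>. It has the right
length because the part \<open>C\<close> of \<open>L\<close> is injective and surjective, hence square.
\<close>

lemma complete_to_basis:
  assumes es: "set es \<subseteq> carrier_vec k" and L: "L \<in> carrier_mat (length es) k"
    and LE: "L * mat_of_cols k es = 1\<^sub>m (length es)"
  shows "\<exists>fs. set fs \<subseteq> carrier_vec k \<and> length es + length fs = k \<and>
    carrier_vec k \<subseteq> rspan k (set es \<union> set fs)"
proof -
  let ?m = "length es" and ?E = "mat_of_cols k es"
  have E: "?E \<in> carrier_mat k ?m" by simp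
  obtain k1 q N C where k: "k = k1 + q" and N: "N \<in> unitary_circ k" and C: "C \<in> carrier_mat ?m q"
      "inj_mat C"
    and LN: "\<And>a b. a \<in> carrier_vec k1 \<Longrightarrow> b \<in> carrier_vec q \<Longrightarrow> L *\<^sub>v (N *\<^sub>v (a @\<^sub>v b)) = C *\<^sub>v b"
    using kernel_splitting[OF L] by blast
  note Nc = unitary_circ_carrier[OF N]
  have decomp: "\<exists>a\<in>carrier_vec k1. \<exists>b\<in>carrier_vec q. u = N *\<^sub>v (a @\<^sub>v b)" if u: "u \<in> carrier_vec
      k" for u
  proof -
    define z where "z = adj N *\<^sub>v u"
    have z: "z \<in> carrier_vec (k1 + q)" using adj_carrier[OF Nc] u k by (simp add: z_def)
    have "N *\<^sub>v z = (N * adj N) *\<^sub>v u" unfolding z_def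
      by (rule assoc_mult_mat_vec[OF Nc adj_carrier[OF Nc] u, symmetric])
    hence "u = N *\<^sub>v z" using unitary_circ_adj(2)[OF N] u by simp
    moreover have "z = vec_first z k1 @\<^sub>v vec_last z q" using z by simp
    ultimately show ?thesis by (metis vec_first_carrier vec_last_carrier)
  qed
  define fs where "fs = map (col N) [0..<k1]"
  have fs: "set fs \<subseteq> carrier_vec k" "length fs = k1" using Nc k by (auto simp: fs_def intro!:
      carrier_vecI)
  have surj: "\<exists>b\<in>carrier_vec q. C *\<^sub>v b = y" if y: "y \<in> carrier_vec ?m" for y
  proof -
    obtain a b where ab: "a \<in> carrier_vec k1" "b \<in> carrier_vec q" "?E *\<^sub>v y = N *\<^sub>v (a @\<^sub>v b)"
      using decomp[of "?E *\<^sub>v y"] E y by (metis mult_mat_vec_carrier)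
    have "C *\<^sub>v b = (L * ?E) *\<^sub>v y"
      using LN[OF ab(1,2)] ab(3) by (simp add: assoc_mult_mat_vec[OF L E y])
    thus ?thesis using ab(2) y LE by auto
  qed
  have "?m = q"
  proof -
    obtain x where x: "inj_mat (evm x C)" using inj_mat_generic[OF C] by blast
    have Cx: "evm x C \<in> carrier_mat ?m q" using C by simp
    have "img (evm x C) = carrier_vec ?m"
    proof
      show "img (evm x C) \<subseteq> carrier_vec ?m" using Cx by (auto simp: img_def)
      show "carrier_vec ?m \<subseteq> img (evm x C)"
      proof
        fix y :: "complex vec" assume y: "y \<in> carrier_vec ?m"
        obtain b where b: "b \<in> carrier_vec q" "C *\<^sub>v b = map_vec cconst y"
          using surj[of "map_vec cconst y"] y by auto
        have "evm x C *\<^sub>v evv x b = evv x (map_vec cconst y)"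
          using b C by (simp flip: ev_hom.mult_mat_vec_hom)
        also have "\<dots> = y" by (intro eq_vecI) auto
        finally have "y = evm x C *\<^sub>v evv x b" by simp
        moreover have "evv x b \<in> carrier_vec (dim_col (evm x C))" using b C by simp
        ultimately show "y \<in> img (evm x C)" unfolding img_def by (rule image_eqI)
      qed
    qed
    moreover have "img (1\<^sub>m ?m) = carrier_vec ?m" by (force simp: img_def)
    ultimately have "img (evm x C) = img (1\<^sub>m ?m)" by simp
    hence "vec_space.rank ?m (evm x C) = vec_space.rank ?m (1\<^sub>m ?m :: complex mat)"
      by (rule rank_eqI[OF Cx one_carrier_mat])
    moreover have "inj_mat (1\<^sub>m ?m :: complex mat)" by (auto simp: inj_mat_def)
    ultimately show ?thesis using rank_inj_mat[OF Cx x] rank_inj_mat[of "1\<^sub>m ?m" ?m ?m] by simp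
  qed
  have ec: "set es \<union> set fs \<subseteq> carrier_vec k" using es fs by auto
  have "w \<in> rspan k (set es \<union> set fs)" if w: "w \<in> carrier_vec k" for w
  proof -
    define u where "u = w - ?E *\<^sub>v (L *\<^sub>v w)"
    have Lw: "L *\<^sub>v w \<in> carrier_vec ?m" using L w by simp
    have ELw: "?E *\<^sub>v (L *\<^sub>v w) \<in> carrier_vec k" using E Lw by (rule mult_mat_vec_carrier)
    have u: "u \<in> carrier_vec k" using w ELw by (simp add: u_def)
    have "L *\<^sub>v u = L *\<^sub>v w - L *\<^sub>v (?E *\<^sub>v (L *\<^sub>v w))"
      unfolding u_def by (rule mult_minus_distrib_mat_vec[OF L w ELw])
    also have "L *\<^sub>v (?E *\<^sub>v (L *\<^sub>v w)) = (L * ?E) *\<^sub>v (L *\<^sub>v w)"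
      by (rule assoc_mult_mat_vec[OF L E Lw, symmetric])
    finally have Lu: "L *\<^sub>v u = 0\<^sub>v ?m" using LE Lw by simp
    obtain a b where ab: "a \<in> carrier_vec k1" "b \<in> carrier_vec q" "u = N *\<^sub>v (a @\<^sub>v b)"
      using decomp[OF u] by blast
    have "C *\<^sub>v b = 0\<^sub>v ?m" using LN[OF ab(1,2)] ab(3) Lu by simp
    hence b0: "b = 0\<^sub>v q" using inj_matD[OF C(2,1) ab(2)] by simp
    have "mat k k1 (\<lambda>(i, j). N $$ (i, j)) = mat_of_cols k fs"
      using Nc k by (intro eq_matI) (auto simp: fs_def mat_of_cols_index)
    hence "N *\<^sub>v (a @\<^sub>v 0\<^sub>v q) = mat_of_cols k fs *\<^sub>v a"
      using mult_append_zero_vec[of N k k1 q a] Nc k ab(1) by simp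
    hence u_eq: "u = mat_of_cols k fs *\<^sub>v a" using ab(3) b0 by simp
    have mono: "v \<in> rspan k (set es \<union> set fs)" if "v \<in> rspan k S" "S \<subseteq> set es \<union> set fs" for v S
      using rspan_map[of S k "set es \<union> set fs" k "\<lambda>x. x", OF _ ec _ _ _ that(1)] that(2) ec
        rspan_base[OF ec] by auto
    have "?E *\<^sub>v (L *\<^sub>v w) \<in> rspan k (set es \<union> set fs)"
      by (rule mono[OF mat_of_cols_mult_in_rspan[OF es Lw]]) simp
    moreover have "u \<in> rspan k (set es \<union> set fs)"
      unfolding u_eq by (rule mono[OF mat_of_cols_mult_in_rspan[OF fs(1)]]) (use ab fs in auto)
    moreover have "w = ?E *\<^sub>v (L *\<^sub>v w) + u" using w ELw unfolding u_def by (intro eq_vecI) auto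
    ultimately show ?thesis by (metis rspan_add[OF ec])
  qed
  thus ?thesis using fs \<open>?m = q\<close> k by (intro exI[of _ fs]) auto
qed

section \<open>Jordan chains\<close>

text \<open>
The bottom \<open>cs ! 0\<close> lies in the kernel. Since \<open>A(x)\<close> maps the fibre over \<open>x\<close> to the fibre over
\<open>x + a\<close>, the vector below is met after a translation by \<open>a\<close>.
\<close>

definition jordan_chain :: "real \<Rightarrow> circ mat \<Rightarrow> circ vec list \<Rightarrow> bool" where
  "jordan_chain a A cs \<longleftrightarrow> cs \<noteq> [] \<and> A *\<^sub>v (cs ! 0) = 0\<^sub>v (dim_row A) \<and>
     (\<forall>s. Suc s < length cs \<longrightarrow> A *\<^sub>v (cs ! Suc s) = shv a (cs ! s))"

definition chain_basis :: "nat \<Rightarrow> real \<Rightarrow> circ mat \<Rightarrow> circ vec list list \<Rightarrow> bool" where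
  "chain_basis d a A css \<longleftrightarrow> (\<forall>cs \<in> set css. jordan_chain a A cs) \<and>
     set (concat css) \<subseteq> carrier_vec d \<and> length (concat css) = d \<and>
     carrier_vec d \<subseteq> rspan d (set (concat css))"

lemma chain_basis_conj:
  assumes A: "A \<in> carrier_mat d d" and N: "N \<in> unitary_circ d" and B: "B \<in> carrier_mat d d"
    and eq: "A * N = shm a N * B" and cb: "chain_basis d a B css"
  shows "chain_basis d a A (map (map (\<lambda>v. N *\<^sub>v v)) css)"
proof -
  note Nc = unitary_circ_carrier[OF N]
  have M: "shm a N \<in> carrier_mat d d" using Nc by simp
  note cb' = cb[unfolded chain_basis_def]
  have comm: "A *\<^sub>v (N *\<^sub>v v) = shm a N *\<^sub>v (B *\<^sub>v v)" if "v \<in> carrier_vec d" for v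
    using assoc_mult_mat_vec[OF A Nc that] assoc_mult_mat_vec[OF M B that] eq by simp
  have ch: "jordan_chain a A (map (\<lambda>v. N *\<^sub>v v) cs)" if cs: "cs \<in> set css" for cs
  proof -
    have j: "jordan_chain a B cs" and c: "\<And>s. s < length cs \<Longrightarrow> cs ! s \<in> carrier_vec d"
      using cb' cs by (auto intro: nth_mem)
    have "A *\<^sub>v (N *\<^sub>v (cs ! 0)) = 0\<^sub>v d"
      using j c[of 0] B M comm[of "cs ! 0"] by (auto simp: jordan_chain_def)
    moreover have "A *\<^sub>v (N *\<^sub>v (cs ! Suc s)) = shv a (N *\<^sub>v (cs ! s))" if s: "Suc s < length cs" for s
      using j c[OF s] c[of s] s comm[of "cs ! Suc s"] shift_hom.mult_mat_vec_hom[OF Nc, of "cs ! s" a]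
      by (auto simp: jordan_chain_def)
    ultimately show ?thesis using j A by (auto simp: jordan_chain_def)
  qed
  have cc: "concat (map (map (\<lambda>v. N *\<^sub>v v)) css) = map (\<lambda>v. N *\<^sub>v v) (concat css)"
    by (simp add: map_concat)
  let ?S = "set (concat css)" and ?S' = "(\<lambda>v. N *\<^sub>v v) ` set (concat css)"
  have S: "?S \<subseteq> carrier_vec d" using cb' by blast
  have S': "?S' \<subseteq> carrier_vec d" using S Nc by (auto intro: mult_mat_vec_carrier)
  have "w \<in> rspan d ?S'" if w: "w \<in> carrier_vec d" for w
  proof -
    have z: "adj N *\<^sub>v w \<in> carrier_vec d" using adj_carrier[OF Nc] w by (rule mult_mat_vec_carrier)
    have "N *\<^sub>v (adj N *\<^sub>v w) \<in> rspan d ?S'"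
    proof (rule rspan_map[OF S S', where T = "\<lambda>v. N *\<^sub>v v"])
      show "adj N *\<^sub>v w \<in> rspan d ?S" using z cb' by blast
      show "N *\<^sub>v v \<in> rspan d ?S'" if "v \<in> ?S" for v using that by (intro rspan_base[OF S'] imageI)
    qed (use mat_vec_linear[OF Nc] in auto)
    also have "N *\<^sub>v (adj N *\<^sub>v w) = w"
      using assoc_mult_mat_vec[OF Nc adj_carrier[OF Nc] w] unitary_circ_adj(2)[OF N] w by simp
    finally show ?thesis .
  qed
  moreover have "length (concat (map (map (\<lambda>v. N *\<^sub>v v)) css)) = d" unfolding cc using cb' by simp
  ultimately show ?thesis
    unfolding chain_basis_def using ch S' by (simp only: cc set_map) auto
qed

lemma mat_of_cols_map_mult:
  fixes M :: "'a :: comm_ring_1 mat"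
  assumes "M \<in> carrier_mat k q" "set vs \<subseteq> carrier_vec q"
  shows "mat_of_cols k (map (\<lambda>v. M *\<^sub>v v) vs) = M * mat_of_cols q vs"
proof (rule eq_matI)
  fix i j assume "i < dim_row (M * mat_of_cols q vs)" "j < dim_col (M * mat_of_cols q vs)"
  hence ij: "i < k" "j < length vs" using assms by auto
  have "vs ! j \<in> carrier_vec q" using ij assms(2) by auto
  thus "mat_of_cols k (map (\<lambda>v. M *\<^sub>v v) vs) $$ (i, j) = (M * mat_of_cols q vs) $$ (i, j)"
    using ij assms(1) by (simp add: mat_of_cols_index)
qed (use assms in auto)

text \<open>
The bottoms of the chains are part of a basis. Listing them first makes the first rows of the
inverse basis matrix a left inverse for them.
\<close>

lemma chain_basis_heads_left_inverse:
  assumes cb: "chain_basis q a L css"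
  obtains P where "P \<in> carrier_mat (length css) q"
    "P * mat_of_cols q (map hd css) = 1\<^sub>m (length css)"
proof -
  note cb' = cb[unfolded chain_basis_def]
  have ne: "cs \<noteq> []" if "cs \<in> set css" for cs using cb' that by (auto simp: jordan_chain_def)
  define vs where "vs = map hd css @ concat (map tl css)"
  have len: "length vs = q"
  proof -
    have "length vs = length (concat css)"
      unfolding vs_def using ne by (induction css) (auto simp: Suc_le_eq)
    thus ?thesis using cb' by simp
  qed
  have set: "set vs = set (concat css)"
  proof -
    have "set cs = insert (hd cs) (set (tl cs))" if "cs \<in> set css" for cs
      using ne[OF that] by (cases cs) auto
    thus ?thesis unfolding vs_def by auto
  qed
  obtain W where W: "W \<in> carrier_mat q q" "W * mat_of_cols q vs = 1\<^sub>m q"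
    using spanning_imp_inverse[of vs q] len set cb' by metis
  have m: "length css \<le> q" using len by (auto simp: vs_def)
  define P where "P = mat (length css) q (\<lambda>(i, j). W $$ (i, j))"
  have "P * mat_of_cols q (map hd css) = 1\<^sub>m (length css)"
  proof (rule eq_matI)
    fix i j assume "i < dim_row (1\<^sub>m (length css) :: circ mat)" "j < dim_col (1\<^sub>m (length css) ::
        circ mat)"
    hence ij: "i < length css" "j < length css" by auto
    have "(P * mat_of_cols q (map hd css)) $$ (i, j) = (W * mat_of_cols q vs) $$ (i, j)"
      using ij m W(1) len by (auto simp: P_def scalar_prod_def mat_of_cols_index vs_def nth_append
          intro!: sum.cong)
    thus "(P * mat_of_cols q (map hd css)) $$ (i, j) = 1\<^sub>m (length css) $$ (i, j)"
      using W(2) ij m by simp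
  qed (auto simp: P_def)
  thus ?thesis using that[of P] by (simp add: P_def)
qed

text \<open>
A chain \<open>c\<^sub>0, \<dots>, c\<^sub>l\<close> of the lower block is prolonged to \<open>g c\<^sub>0, \<dots>, g c\<^sub>l, (0, c\<^sub>l)\<close>, where
\<open>g c = (G c)(x - a)\<close>. The vector \<open>g c\<^sub>s\<^sub>+\<^sub>1\<close> has lower part \<open>c\<^sub>s\<close>, so the vectors above the bottoms span
everything modulo the kernel block. The bottoms \<open>g c\<^sub>0\<close> have lower part 0, and their upper parts have
a left inverse, because \<open>G\<close> and the list of the \<open>c\<^sub>0\<close> have one; so they can be completed to a basis
of the kernel block by vectors \<open>f\<close>, each of which is a chain of length 1.
\<close>

lemma chain_basis_zcols:
  assumes G: "G \<in> carrier_mat (k + q) q" and D: "D \<in> carrier_mat q (k + q)" "D * G = 1\<^sub>m q"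
    and cb: "chain_basis q a (lower k G) css"
  shows "\<exists>css'. chain_basis (k + q) a (zcols k G) css'"
proof -
  note cb' = cb[unfolded chain_basis_def]
  note L = lower_carrier[OF G] and U = upper_carrier[OF G]
  let ?L = "lower k G" and ?U = "upper k G" and ?Z = "zcols k G"
  have Z: "?Z \<in> carrier_mat (k + q) (k + q)" using G by simp
  have ne: "cs \<noteq> []" if "cs \<in> set css" for cs using cb' that by (auto simp: jordan_chain_def)
  have cc: "c \<in> carrier_vec q" if "cs \<in> set css" "c \<in> set cs" for cs c using cb' that by auto
  define hs where "hs = map hd css"
  have hs: "set hs \<subseteq> carrier_vec q" using ne cc by (auto simp: hs_def)
  have hs0: "?L *\<^sub>v h = 0\<^sub>v q" if h: "h \<in> set hs" for h
    using h cb' ne L by (auto simp: hs_def jordan_chain_def hd_conv_nth)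
  obtain P where P: "P \<in> carrier_mat (length css) q" "P * mat_of_cols q hs = 1\<^sub>m (length css)"
    using chain_basis_heads_left_inverse[OF cb] unfolding hs_def by blast
  \<comment> \<open>\<open>G\<close> maps the bottoms to vectors with lower part 0, on which \<open>D\<close> acts through its first \<open>k\<close>
      columns.\<close>
  define D1 where "D1 = mat q k (\<lambda>(i, j). D $$ (i, j))"
  have D1: "D1 \<in> carrier_mat q k" by (simp add: D1_def)
  have D1U: "D1 *\<^sub>v (?U *\<^sub>v h) = h" if h: "h \<in> set hs" for h
  proof -
    have hc: "h \<in> carrier_vec q" using h hs by blast
    have Uh: "?U *\<^sub>v h \<in> carrier_vec k" using U hc by (rule mult_mat_vec_carrier)
    have Gh: "G *\<^sub>v h = (?U *\<^sub>v h) @\<^sub>v 0\<^sub>v q"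
      using upper_lower_mult_vec[OF G hc] hs0[OF h] by simp
    have "h = D *\<^sub>v (G *\<^sub>v h)"
      using assoc_mult_mat_vec[OF D(1) G hc] D(2) hc by simp
    also have "\<dots> = D1 *\<^sub>v (?U *\<^sub>v h)"
      unfolding Gh D1_def by (rule mult_append_zero_vec[OF D(1) Uh])
    finally show ?thesis by simp
  qed
  define us where "us = map (\<lambda>h. ?U *\<^sub>v h) hs"
  have us: "set us \<subseteq> carrier_vec k" using hs U by (auto simp: us_def intro: mult_mat_vec_carrier)
  have "D1 * mat_of_cols k us = mat_of_cols q hs"
    using mat_of_cols_map_mult[OF D1 us] D1U by (simp add: us_def o_def cong: map_cong)
  hence Pus: "(P * D1) * mat_of_cols k us = 1\<^sub>m (length css)"
    using P by (subst assoc_mult_mat[OF P(1) D1 mat_of_cols_carrier(1)]) simp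
  define es where "es = map (shv (- a)) us"
  have es: "set es \<subseteq> carrier_vec k" using us by (auto simp: es_def)
  have les: "length es = length css" by (simp add: es_def us_def hs_def)
  have PD: "P * D1 \<in> carrier_mat (length css) k" using P D1 by simp
  have mes: "mat_of_cols k es = shm (- a) (mat_of_cols k us)"
    using us by (intro eq_matI) (auto simp: es_def mat_of_cols_index)
  have "shm (- a) (P * D1) * mat_of_cols k es = 1\<^sub>m (length css)"
    unfolding mes using arg_cong[OF Pus, of "shm (- a)"]
    by (subst shift_hom.mat_hom_mult[OF PD, symmetric]) (auto simp: shift_hom.mat_hom_one us_def hs_def)
  then obtain fs where fs: "set fs \<subseteq> carrier_vec k" "length es + length fs = k"
     "carrier_vec k \<subseteq> rspan k (set es \<union> set fs)"
    using complete_to_basis[OF es, of "shm (- a) (P * D1)"] PD les by auto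
  define g where "g c = shv (- a) (G *\<^sub>v c)" for c
  define ext where "ext cs = map g cs @ [0\<^sub>v k @\<^sub>v last cs]" for cs
  define css' where "css' = map ext css @ map (\<lambda>f. [f @\<^sub>v 0\<^sub>v q]) fs"
  have gc: "g c \<in> carrier_vec (k + q)" if "c \<in> carrier_vec q" for c
    using mult_mat_vec_carrier[OF G that] by (simp add: g_def)
  have g_split: "g c = shv (- a) (?U *\<^sub>v c) @\<^sub>v shv (- a) (?L *\<^sub>v c)" if c: "c \<in> carrier_vec q" for c
    unfolding g_def upper_lower_mult_vec[OF G c]
    using mult_mat_vec_carrier[OF U c] mult_mat_vec_carrier[OF L c] by (intro eq_vecI) auto
  have shg: "shv a (g c) = G *\<^sub>v c" for c by (simp add: g_def shv_shv)
  have g_head: "g (cs ! 0) = shv (- a) (?U *\<^sub>v (cs ! 0)) @\<^sub>v 0\<^sub>v q" if cs: "cs \<in> set css" for cs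
  proof -
    have "cs ! 0 \<in> carrier_vec q" using cc[OF cs, of "cs ! 0"] ne[OF cs] by simp
    moreover have "?L *\<^sub>v (cs ! 0) = 0\<^sub>v q" using cb' cs L by (auto simp: jordan_chain_def)
    ultimately show ?thesis using g_split[of "cs ! 0"] by (simp add: shift_hom.vec_hom_zero)
  qed
  have g_Suc: "g (cs ! Suc s) = shv (- a) (?U *\<^sub>v (cs ! Suc s)) @\<^sub>v (cs ! s)"
    if cs: "cs \<in> set css" and s: "Suc s < length cs" for cs s
  proof -
    have "cs ! Suc s \<in> carrier_vec q" using cc[OF cs, of "cs ! Suc s"] s by simp
    moreover have "?L *\<^sub>v (cs ! Suc s) = shv a (cs ! s)" using cb' cs s by (auto simp: jordan_chain_def)
    ultimately show ?thesis using g_split[of "cs ! Suc s"] by (simp add: shv_shv)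
  qed
  have Zmult: "?Z *\<^sub>v (u @\<^sub>v v) = G *\<^sub>v v" if "u \<in> carrier_vec k" "v \<in> carrier_vec q" for u v
    by (rule zcols_mult_vec[OF G that])
  have Uc: "shv b (?U *\<^sub>v c) \<in> carrier_vec k" if "c \<in> carrier_vec q" for b c
    using mult_mat_vec_carrier[OF U that] by simp
  have chain_ext: "jordan_chain a ?Z (ext cs)" if cs: "cs \<in> set css" for cs
    unfolding jordan_chain_def
  proof (intro conjI allI impI)
    have ncs: "length cs > 0" using ne[OF cs] by simp
    have c: "\<And>s. s < length cs \<Longrightarrow> cs ! s \<in> carrier_vec q" using cc[OF cs] by simp
    have "ext cs ! 0 = g (cs ! 0)" using ncs by (simp add: ext_def nth_append)
    thus "?Z *\<^sub>v (ext cs ! 0) = 0\<^sub>v (dim_row ?Z)"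
      using g_head[OF cs] Zmult[OF Uc[OF c[OF ncs]], of "0\<^sub>v q" "- a"]
        mat_vec_linear(1)[OF G] carrier_matD[OF Z] by simp
    fix s assume s: "Suc s < length (ext cs)"
    hence es: "ext cs ! s = g (cs ! s)" by (simp add: ext_def nth_append)
    show "?Z *\<^sub>v (ext cs ! Suc s) = shv a (ext cs ! s)"
    proof (cases "Suc s < length cs")
      case True
      hence "ext cs ! Suc s = g (cs ! Suc s)" by (simp add: ext_def nth_append)
      thus ?thesis
        unfolding es shg using g_Suc[OF cs True] Zmult[OF Uc[OF c[OF True]] c[of s]] True by simp
    next
      case False
      hence "Suc s = length cs" using s by (simp add: ext_def)
      hence "ext cs ! Suc s = 0\<^sub>v k @\<^sub>v (cs ! s)"
        using ne[OF cs] by (simp add: ext_def nth_append last_conv_nth flip: \<open>Suc s = length cs\<close>)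
      thus ?thesis
        unfolding es shg using Zmult[of "0\<^sub>v k" "cs ! s"] c[of s] \<open>Suc s = length cs\<close> by simp
    qed
  qed (simp add: ext_def)
  have chain_f: "jordan_chain a ?Z [f @\<^sub>v 0\<^sub>v q]" if "f \<in> set fs" for f
    using Zmult[of f "0\<^sub>v q"] fs(1) that mat_vec_linear(1)[OF G] carrier_matD[OF Z]
    by (auto simp: jordan_chain_def)
  let ?S = "set (concat css')"
  have S_eq: "?S = (\<Union>cs\<in>set css. g ` set cs \<union> {0\<^sub>v k @\<^sub>v last cs}) \<union> (\<lambda>f. f @\<^sub>v 0\<^sub>v q) ` set fs"
    by (auto simp: css'_def ext_def)
  have gS: "g c \<in> ?S" if "cs \<in> set css" "c \<in> set cs" for cs c
    unfolding S_eq using that by blast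
  have S: "?S \<subseteq> carrier_vec (k + q)"
    unfolding S_eq using gc cc ne fs(1) by (auto simp del: append_carrier_vec intro!:
        append_carrier_vec)
  have len: "length (concat css') = k + q"
  proof -
    have "length (concat (map ext css)) = length (concat css) + length css"
      by (induction css) (auto simp: ext_def)
    moreover have "length (concat (map (\<lambda>f. [f @\<^sub>v 0\<^sub>v q]) fs)) = length fs"
      by (induction fs) auto
    ultimately show ?thesis using cb' fs(2) les by (simp add: css'_def)
  qed
  have left: "x @\<^sub>v 0\<^sub>v q \<in> rspan (k + q) ?S" if x: "x \<in> carrier_vec k" for x
  proof (rule rspan_map[where T = "\<lambda>x. x @\<^sub>v 0\<^sub>v q", OF _ S])
    show "set es \<union> set fs \<subseteq> carrier_vec k" using es fs(1) by auto
    show "x \<in> rspan k (set es \<union> set fs)" using fs(3) x by blast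
    show "0\<^sub>v k @\<^sub>v 0\<^sub>v q = (0\<^sub>v (k + q) :: circ vec)" by (intro eq_vecI) auto
    show "(r \<cdot>\<^sub>v v + w) @\<^sub>v 0\<^sub>v q = r \<cdot>\<^sub>v (v @\<^sub>v 0\<^sub>v q) + (w @\<^sub>v 0\<^sub>v q)"
      if "v \<in> carrier_vec k" "w \<in> carrier_vec k" for r and v w :: "circ vec"
      using that by (intro eq_vecI) auto
    show "v @\<^sub>v 0\<^sub>v q \<in> rspan (k + q) ?S" if vin: "v \<in> set es \<union> set fs" for v
    proof (cases "v \<in> set fs")
      case True
      thus ?thesis by (intro rspan_base[OF S], unfold S_eq) auto
    next
      case False
      then obtain cs where cs: "cs \<in> set css" "v = shv (- a) (?U *\<^sub>v (hd cs))"
        using vin by (auto simp: es_def us_def hs_def)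
      hence "v @\<^sub>v 0\<^sub>v q = g (cs ! 0)" using g_head[OF cs(1)] ne[OF cs(1)] by (simp add: hd_conv_nth)
      moreover have "cs ! 0 \<in> set cs" using ne[OF cs(1)] by simp
      ultimately show ?thesis using rspan_base[OF S gS[OF cs(1)]] by simp
    qed
  qed
  have right: "0\<^sub>v k @\<^sub>v y \<in> rspan (k + q) ?S" if y: "y \<in> carrier_vec q" for y
  proof (rule rspan_map[where T = "\<lambda>y. 0\<^sub>v k @\<^sub>v y", OF _ S])
    show "set (concat css) \<subseteq> carrier_vec q" using cb' by blast
    show "y \<in> rspan q (set (concat css))" using cb' y by blast
    show "0\<^sub>v k @\<^sub>v 0\<^sub>v q = (0\<^sub>v (k + q) :: circ vec)" by (intro eq_vecI) auto
    show "0\<^sub>v k @\<^sub>v (r \<cdot>\<^sub>v v + w) = r \<cdot>\<^sub>v (0\<^sub>v k @\<^sub>v v) + (0\<^sub>v k @\<^sub>v w)"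
      if "v \<in> carrier_vec q" "w \<in> carrier_vec q" for r and v w :: "circ vec"
      using that by (intro eq_vecI) auto
    show "0\<^sub>v k @\<^sub>v v \<in> rspan (k + q) ?S" if vin: "v \<in> set (concat css)" for v
    proof -
      obtain cs where cs: "cs \<in> set css" "v \<in> set cs" using vin by auto
      then obtain s where s: "s < length cs" "v = cs ! s" by (auto simp: in_set_conv_nth)
      have vc: "v \<in> carrier_vec q" using cc cs by blast
      show ?thesis
      proof (cases "Suc s < length cs")
        case True
        define x where "x = shv (- a) (?U *\<^sub>v (cs ! Suc s))"
        have x: "x \<in> carrier_vec k" unfolding x_def using cc[OF cs(1)] True by (intro Uc) simp
        have gx: "g (cs ! Suc s) = x @\<^sub>v v" using g_Suc[OF cs(1) True] s by (simp add: x_def)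
        \<comment> \<open>Below the top, \<open>(0, v)\<close> is the next vector of the prolonged chain up to its upper part \<open>x\<close>.\<close>
        have "x @\<^sub>v v \<in> rspan (k + q) ?S"
          unfolding gx[symmetric] by (rule rspan_base[OF S gS[OF cs(1) nth_mem[OF True]]])
        moreover have "(-1) \<cdot>\<^sub>v (x @\<^sub>v 0\<^sub>v q) \<in> rspan (k + q) ?S" by (intro rspan_smult[OF S] left x)
        ultimately have "(x @\<^sub>v v) + (-1) \<cdot>\<^sub>v (x @\<^sub>v 0\<^sub>v q) \<in> rspan (k + q) ?S" by (rule
            rspan_add[OF S])
        also have "(x @\<^sub>v v) + (-1) \<cdot>\<^sub>v (x @\<^sub>v 0\<^sub>v q) = 0\<^sub>v k @\<^sub>v v"
          using x vc by (intro eq_vecI) auto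
        finally show ?thesis .
      next
        case False
        hence "v = last cs" using s ne[OF cs(1)] by (metis Suc_lessI diff_Suc_1 last_conv_nth)
        thus ?thesis using cs(1) by (intro rspan_base[OF S], unfold S_eq) auto
      qed
    qed
  qed
  have "w \<in> rspan (k + q) ?S" if w: "w \<in> carrier_vec (k + q)" for w
  proof -
    have "w = (vec_first w k @\<^sub>v 0\<^sub>v q) + (0\<^sub>v k @\<^sub>v vec_last w q)"
      using w by (intro eq_vecI) (auto simp: vec_first_def vec_last_def)
    moreover have "(vec_first w k @\<^sub>v 0\<^sub>v q) + (0\<^sub>v k @\<^sub>v vec_last w q) \<in> rspan (k + q) ?S"
      by (intro rspan_add[OF S] left right) auto
    ultimately show ?thesis by simp
  qed
  hence "chain_basis (k + q) a ?Z css'"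
    unfolding chain_basis_def using S len chain_ext chain_f by (auto simp: css'_def)
  thus ?thesis by blast
qed

lemma jordan_chain_basis_exists:
  assumes "A \<in> carrier_mat d d" "itc a A p = 0\<^sub>m d d" "const_ranks d a A"
  shows "\<exists>css. chain_basis d a A css"
  using assms
proof (induction p arbitrary: d A)
  case 0
  have "d = 0" using 0 by (simp add: one_mat_eq_zero_iff)
  moreover have "carrier_vec 0 \<subseteq> rspan 0 {}"
  proof
    fix v :: "circ vec" assume "v \<in> carrier_vec 0"
    hence "v = 0\<^sub>v 0" by auto
    thus "v \<in> rspan 0 {}" using rspan.zero[of 0 "{}"] by (simp only:)
  qed
  ultimately show ?case
    by (intro exI[of _ "[]"]) (simp add: chain_basis_def)
next
  case (Suc p)
  note A = Suc.prems(1)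
  obtain k q N G where d: "d = k + q" and N: "N \<in> unitary_circ d" and G: "G \<in> carrier_mat d q"
      "inj_mat G"
    and eq: "A * N = shm a N * zcols k G"
    by (rule cocycle_reduction[OF A])
  have G': "G \<in> carrier_mat (k + q) q" using G d by simp
  have Z: "zcols k G \<in> carrier_mat d d" using zcols_carrier[OF G', of k] d by simp
  note cr = const_ranks_reduction[OF A d N G eq Suc.prems(3)]
  obtain D where D: "D \<in> carrier_mat q d" "D * G = 1\<^sub>m q"
    using left_inverse_exists[OF G(1) cr(1)] by blast
  have "itc a (lower k G) p = 0\<^sub>m q q"
    using itc_reduction_zero_iff[OF A d N G eq] Suc.prems(2) by blast
  then obtain css where "chain_basis q a (lower k G) css"
    using Suc.IH[OF lower_carrier[OF G'] _ cr(2)] by blast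
  then obtain css' where "chain_basis d a (zcols k G) css'"
    using chain_basis_zcols[OF G'] D d by blast
  thus ?case using chain_basis_conj[OF A N Z eq] by blast
qed

section \<open>Analytic families of complex matrices\<close>

lemma analytic_circle_as_circ:
  assumes "A \<in> analytic_circle d Y" "Y \<subseteq> carrier_mat d d"
  obtains C where "C \<in> carrier_mat d d" "\<And>x. evm x C = A x"
proof -
  have c: "A x \<in> carrier_mat d d" and p: "A (x + 1) = A x" for x
    using assms by (auto simp: analytic_circle_def)
  have r: "ev (Circ (\<lambda>x. A x $$ (i, j))) = (\<lambda>x. A x $$ (i, j))" if "i < d" "j < d" for i j
    using assms(1) that p by (intro ev_Circ) (auto simp: analytic_circle_def)
  have "evm x (mat d d (\<lambda>(i, j). Circ (\<lambda>x. A x $$ (i, j)))) = A x" for x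
    using c[of x] r by (intro eq_matI) auto
  thus ?thesis using that[of "mat d d (\<lambda>(i, j). Circ (\<lambda>x. A x $$ (i, j)))"] by simp
qed

lemma circ_in_analytic_circle:
  assumes "N \<in> carrier_mat d d" "\<And>x. evm x N \<in> Y"
  shows "(\<lambda>x. evm x N) \<in> analytic_circle d Y"
  unfolding analytic_circle_def
proof (safe intro!: assms(2))
  fix x show "evm (x + 1) N = evm x N" by (intro eq_matI) auto
next
  fix i j assume "i < d" "j < d"
  thus "real_analytic (\<lambda>x. evm x N $$ (i, j))" using assms(1) by simp
qed

lemma iterate_eq_itc:
  assumes C: "C \<in> carrier_mat d d" and A: "\<And>x. evm x C = A x"
  shows "iterate d \<alpha> A n x = evm x (itc \<alpha> C n)"
proof (induction n)
  case 0 thus ?case using C by (simp add: ev_hom.mat_hom_one)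
next
  case (Suc n)
  have "evm x (itc \<alpha> C (Suc n)) = evm (x + real n * \<alpha>) C * evm x (itc \<alpha> C n)"
    using C itc_carrier[OF C, of \<alpha> n] by (simp, subst ev_hom.mat_hom_mult[of _ d d _ d]) auto
  thus ?case using Suc A by simp
qed

lemma mat_inv_eq:
  assumes "X \<in> carrier_mat d d" "Y \<in> carrier_mat d d" "X * Y = 1\<^sub>m d" "Y * X = 1\<^sub>m d"
  shows "mat_inv X = Y"
proof (cases "mat_inverse X")
  case None
  have "X \<in> Units (ring_mat TYPE(complex) d ())"
    using assms by (auto simp: Units_def ring_mat_simps)
  thus ?thesis using mat_inverse(1)[OF assms(1) None, of "()"] by contradiction
next
  case (Some B)
  have B: "B \<in> carrier_mat d d" "B * X = 1\<^sub>m d" using mat_inverse(2)[OF assms(1) Some] by auto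
  have "B = B * (X * Y)" using right_mult_one_mat[OF B(1)] assms(3) by simp
  also have "\<dots> = (B * X) * Y" by (rule assoc_mult_mat[OF B(1) assms(1,2), symmetric])
  also have "\<dots> = Y" using B(2) left_mult_one_mat[OF assms(2)] by simp
  finally show ?thesis by (simp add: mat_inv_def Some)
qed

lemma conj_cocycle_eq:
  assumes C: "C \<in> carrier_mat d d" and A: "\<And>x. evm x C = A x"
    and U: "U \<in> carrier_mat d d" and W: "W \<in> carrier_mat d d" "U * W = 1\<^sub>m d" "W * U = 1\<^sub>m d"
    and S: "S \<in> carrier_mat d d" and eq: "C * U = shm \<alpha> U * S"
  shows "conj_cocycle \<alpha> A (\<lambda>x. evm x U) x = evm x S"
proof -
  have inv: "evm y U * evm y W = 1\<^sub>m d" "evm y W * evm y U = 1\<^sub>m d" for y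
    using arg_cong[OF W(2), of "evm y"] arg_cong[OF W(3), of "evm y"]
      ev_hom.mat_hom_mult[OF U W(1), of y] ev_hom.mat_hom_mult[OF W(1) U, of y]
    by (auto simp: ev_hom.mat_hom_one)
  have c: "evm y U \<in> carrier_mat d d" "evm y W \<in> carrier_mat d d" "evm y S \<in> carrier_mat d d" "A y
      \<in> carrier_mat d d" for y
    using U W S C by (auto simp flip: A)
  have "A x * evm x U = evm (x + \<alpha>) U * evm x S"
    using arg_cong[OF eq, of "evm x"] ev_hom.mat_hom_mult[OF C U, of x]
      ev_hom.mat_hom_mult[OF _ S, of "shm \<alpha> U" d x] U A by simp
  hence "evm (x + \<alpha>) W * A x * evm x U = evm (x + \<alpha>) W * evm (x + \<alpha>) U * evm x S"
    using c by (simp add: assoc_mult_mat[of _ d d _ d _ d])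
  also have "\<dots> = evm x S" using c inv by simp
  finally show ?thesis
    unfolding conj_cocycle_def mat_inv_eq[OF c(1,2) inv] .
qed

lemma circ_AE_zero:
  assumes "AE x in circle_measure. ev f x = 0" shows "f = 0"
proof (rule ccontr)
  assume "f \<noteq> 0"
  have "AE x in lborel. x \<in> {0..1} \<longrightarrow> ev f x = 0"
    using assms by (subst (asm) AE_restrict_space_iff) auto
  moreover have "AE x in lborel. x \<notin> {x \<in> {0..1}. ev f x = 0}"
    by (intro AE_not_in finite_imp_null_set_lborel finite_zeros \<open>f \<noteq> 0\<close>)
  ultimately have "AE x in lborel. x \<notin> {0..1::real}" by eventually_elim auto
  hence "{0..1::real} \<in> null_sets lborel" by (subst AE_iff_null_sets) auto
  thus False by (simp add: null_sets_def)
qed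

lemma AE_evm_zero_iff:
  assumes X: "X \<in> carrier_mat d d"
  shows "(AE x in circle_measure. evm x X = 0\<^sub>m d d) \<longleftrightarrow> X = 0\<^sub>m d d"
proof
  assume AE: "AE x in circle_measure. evm x X = 0\<^sub>m d d"
  show "X = 0\<^sub>m d d"
  proof (rule eq_matI)
    fix i j assume "i < dim_row (0\<^sub>m d d :: circ mat)" "j < dim_col (0\<^sub>m d d :: circ mat)"
    hence ij: "i < d" "j < d" by auto
    have "AE x in circle_measure. ev (X $$ (i, j)) x = 0"
      using AE
    proof eventually_elim
      case (elim x)
      have "evm x X $$ (i, j) = 0" using elim ij by simp
      thus ?case using X ij by simp
    qed
    hence "X $$ (i, j) = 0" by (rule circ_AE_zero)
    thus "X $$ (i, j) = 0\<^sub>m d d $$ (i, j)" using ij by simp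
  qed (use X in auto)
next
  assume "X = 0\<^sub>m d d"
  hence "evm x X = 0\<^sub>m d d" for x by (auto intro!: eq_matI)
  thus "AE x in circle_measure. evm x X = 0\<^sub>m d d" by simp
qed

lemma nilpotency_degree_eq:
  assumes C: "C \<in> carrier_mat d d" and A: "\<And>x. evm x C = A x" and d: "d \<ge> 1"
  shows "nilpotency_degree d \<alpha> A = (LEAST n. itc \<alpha> C n = 0\<^sub>m d d)"
proof -
  have "(n \<ge> 1 \<and> (AE x in circle_measure. iterate d \<alpha> A n x = 0\<^sub>m d d)) \<longleftrightarrow> itc \<alpha> C n = 0\<^sub>m d d" for n
  proof -
    have "(1\<^sub>m d :: circ mat) \<noteq> 0\<^sub>m d d" using d by (simp add: one_mat_eq_zero_iff)
    hence "itc \<alpha> C n = 0\<^sub>m d d \<Longrightarrow> n \<ge> 1" using C by (cases n) auto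
    thus ?thesis
      unfolding iterate_eq_itc[OF C A] AE_evm_zero_iff[OF itc_carrier[OF C]] by blast
  qed
  thus ?thesis unfolding nilpotency_degree_def by simp
qed

lemma block_range_exists:
  "i < sum_list ns \<Longrightarrow> \<exists>a<length ns. i \<in> block_range ns a"
proof (induction ns arbitrary: i)
  case (Cons n ns)
  show ?case
  proof (cases "i < n")
    case True
    thus ?thesis by (intro exI[of _ 0]) (auto simp: block_range_def)
  next
    case False
    hence "i - n < sum_list ns" using Cons.prems by (simp add: less_diff_conv2)
    then obtain a where "a < length ns" "i - n \<in> block_range ns a"
      using Cons.IH[of "i - n"] by blast
    thus ?thesis using False by (intro exI[of _ "Suc a"]) (auto simp: block_range_def)
  qed
qed simp

lemma strictly_block_upper_imp_strictly_upper:
  assumes B: "B \<in> carrier_mat d d" and ns: "sum_list ns = d" and s: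
      "strictly_block_upper_triangular ns B"
  shows "strictly_upper_triangular B"
  unfolding strictly_upper_triangular_def
proof (intro allI impI)
  fix i j assume ij: "i < dim_row B" "j < dim_col B" "j \<le> i"
  obtain u where u: "u < length ns" "i \<in> block_range ns u" using block_range_exists[of i ns] ij B
      ns by auto
  obtain v where v: "v < length ns" "j \<in> block_range ns v" using block_range_exists[of j ns] ij B
      ns by auto
  have "v \<le> u"
  proof (rule ccontr)
    assume "\<not> v \<le> u"
    hence "take v ns = take (Suc u) ns @ take (v - Suc u) (drop (Suc u) ns)"
      by (metis Suc_leI le_add_diff_inverse not_le take_add)
    hence "sum_list (take (Suc u) ns) \<le> sum_list (take v ns)" by simp
    thus False using u(2) v(2) ij(3) by (auto simp: block_range_def)
  qed
  thus "B $$ (i, j) = 0" using s u v unfolding strictly_block_upper_triangular_def by blast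
qed

lemma mat_of_cols_append_mult_vec:
  fixes xs ys :: "'a :: comm_ring_1 vec list"
  assumes u: "u \<in> carrier_vec (length xs)" and v: "v \<in> carrier_vec (length ys)"
  shows "mat_of_cols d (xs @ ys) *\<^sub>v (u @\<^sub>v v) = mat_of_cols d xs *\<^sub>v u + mat_of_cols d ys *\<^sub>v v"
proof (rule eq_vecI)
  let ?n = "length xs" and ?m = "length ys"
  fix i assume "i < dim_vec (mat_of_cols d xs *\<^sub>v u + mat_of_cols d ys *\<^sub>v v)"
  hence i: "i < d" by simp
  define f where "f j = (xs @ ys) ! j $ i * (u @\<^sub>v v) $ j" for j
  have "(mat_of_cols d (xs @ ys) *\<^sub>v (u @\<^sub>v v)) $ i = (\<Sum>j = 0..<?n + ?m. f j)"
    using i u v by (auto simp: scalar_prod_def mat_of_cols_index f_def intro!: sum.cong)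
  also have "\<dots> = (\<Sum>j = 0..<?n. f j) + (\<Sum>j = ?n..<?n + ?m. f j)"
    by (rule sum.atLeastLessThan_concat[symmetric]) auto
  also have "(\<Sum>j = ?n..<?n + ?m. f j) = (\<Sum>j = 0..<?m. f (j + ?n))"
    using sum.shift_bounds_nat_ivl[of f 0 ?n ?m] by (simp add: add.commute)
  also have "(\<Sum>j = 0..<?n. f j) = (mat_of_cols d xs *\<^sub>v u) $ i"
    using i u v by (auto simp: scalar_prod_def mat_of_cols_index f_def nth_append intro!: sum.cong)
  also have "(\<Sum>j = 0..<?m. f (j + ?n)) = (mat_of_cols d ys *\<^sub>v v) $ i"
    using i u v by (auto simp: scalar_prod_def mat_of_cols_index f_def nth_append intro!: sum.cong)
  finally show "(mat_of_cols d (xs @ ys) *\<^sub>v (u @\<^sub>v v)) $ i =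
      (mat_of_cols d xs *\<^sub>v u + mat_of_cols d ys *\<^sub>v v) $ i" using i by simp
qed simp

lemma shm_mat_of_cols:
  assumes "set vs \<subseteq> carrier_vec d"
  shows "shm a (mat_of_cols d vs) = mat_of_cols d (map (shv a) vs)"
proof (rule eq_matI)
  fix i j assume "i < dim_row (mat_of_cols d (map (shv a) vs))" "j < dim_col (mat_of_cols d (map
      (shv a) vs))"
  hence ij: "i < d" "j < length vs" by auto
  have "vs ! j \<in> carrier_vec d" using ij assms by auto
  thus "shm a (mat_of_cols d vs) $$ (i, j) = mat_of_cols d (map (shv a) vs) $$ (i, j)"
    using ij by (simp add: mat_of_cols_index)
qed auto

lemma jordan_chain_block:
  assumes A: "A \<in> carrier_mat d d" and ch: "jordan_chain a A cs" and cs: "set cs \<subseteq> carrier_vec d"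
  shows "A * mat_of_cols d cs = mat_of_cols d (map (shv a) cs) * jordan_block (length cs) 0"
proof (rule eq_matI)
  fix i j assume "i < dim_row (mat_of_cols d (map (shv a) cs) * jordan_block (length cs) 0)"
    "j < dim_col (mat_of_cols d (map (shv a) cs) * jordan_block (length cs) (0 :: circ))"
  hence ij: "i < d" "j < length cs" by auto
  have c: "cs ! l \<in> carrier_vec d" if "l < length cs" for l using that cs by auto
  have "(mat_of_cols d (map (shv a) cs) * jordan_block (length cs) 0) $$ (i, j) =
      (\<Sum>l = 0..<length cs. shv a (cs ! l) $ i * (if l = j then 0 else if Suc l = j then 1 else 0))"
    using ij by (auto simp: scalar_prod_def mat_of_cols_index intro!: sum.cong)
  also have "\<dots> = (A *\<^sub>v (cs ! j)) $ i"
  proof (cases j)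
    case 0
    have "(\<Sum>l = 0..<length cs. shv a (cs ! l) $ i * (if l = j then 0 else if Suc l = j then 1 else
        0)) = 0"
      using 0 by (intro sum.neutral) auto
    thus ?thesis using 0 ch ij A by (simp add: jordan_chain_def)
  next
    case (Suc j')
    have "(\<Sum>l = 0..<length cs. shv a (cs ! l) $ i * (if l = j then 0 else if Suc l = j then 1 else 0)) =
        (\<Sum>l = 0..<length cs. if l = j' then shv a (cs ! l) $ i else 0)"
      using Suc by (intro sum.cong) auto
    also have "\<dots> = shv a (cs ! j') $ i" using ij Suc by simp
    finally show ?thesis using ch ij Suc by (simp add: jordan_chain_def)
  qed
  also have "\<dots> = (A * mat_of_cols d cs) $$ (i, j)" using A ij c[of j] by simp
  finally show "(A * mat_of_cols d cs) $$ (i, j) =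
     (mat_of_cols d (map (shv a) cs) * jordan_block (length cs) 0) $$ (i, j)" by simp
qed (use A in auto)

lemma jordan_chains_matrix:
  assumes A: "A \<in> carrier_mat d d" and "\<forall>cs \<in> set css. jordan_chain a A cs" "set (concat css) \<subseteq>
      carrier_vec d"
  shows "A * mat_of_cols d (concat css) =
    mat_of_cols d (map (shv a) (concat css)) * jordan_matrix (map (\<lambda>n. (n, 0)) (map length css))"
  using assms(2,3)
proof (induction css)
  case Nil
  show ?case using A by (intro eq_matI) (auto simp: jordan_matrix_def)
next
  case (Cons cs css)
  let ?J = "jordan_matrix (map (\<lambda>n. (n, 0)) (map length css)) :: circ mat"
  let ?n = "length cs" and ?m = "length (concat css)"
  let ?B = "jordan_block ?n 0 :: circ mat"
  have sm: "sum_list (map fst (map (\<lambda>n. (n, 0 :: circ)) (map length css))) = ?m"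
    by (simp add: o_def length_concat)
  have J: "?J \<in> carrier_mat ?m ?m"
    using jordan_matrix_carrier[of "map (\<lambda>n. (n, 0 :: circ)) (map length css)"] unfolding sm .
  have B: "?B \<in> carrier_mat ?n ?n" by simp
  have JJ: "jordan_matrix (map (\<lambda>n. (n, 0)) (map length (cs # css))) = four_block_mat ?B (0\<^sub>m ?n
      ?m) (0\<^sub>m ?m ?n) ?J"
    using jordan_matrix_Cons[of ?n "0 :: circ" "map (\<lambda>n. (n, 0)) (map length css)"] unfolding sm by simp
  have IH: "A * mat_of_cols d (concat css) = mat_of_cols d (map (shv a) (concat css)) * ?J"
    using Cons by simp
  have ch: "A * mat_of_cols d cs = mat_of_cols d (map (shv a) cs) * ?B"
    using Cons.prems by (intro jordan_chain_block[OF A]) auto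
  have FB: "four_block_mat ?B (0\<^sub>m ?n ?m) (0\<^sub>m ?m ?n) ?J \<in> carrier_mat (?n + ?m) (?n + ?m)" using
      B J by simp
  have V: "mat_of_cols d (cs @ concat css) \<in> carrier_mat d (?n + ?m)"
    using mat_of_cols_carrier(1)[of d "cs @ concat css"] by simp
  have V': "mat_of_cols d (map (shv a) (cs @ concat css)) \<in> carrier_mat d (?n + ?m)"
    using mat_of_cols_carrier(1)[of d "map (shv a) (cs @ concat css)"] by simp
  have c: "mat_of_cols d cs \<in> carrier_mat d ?n" "mat_of_cols d (concat css) \<in> carrier_mat d ?m"
    "mat_of_cols d (map (shv a) cs) \<in> carrier_mat d ?n"
    "mat_of_cols d (map (shv a) (concat css)) \<in> carrier_mat d ?m"
    using mat_of_cols_carrier(1)[of d "map (shv a) cs"] mat_of_cols_carrier(1)[of d "map (shv a)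
        (concat css)"]
    by auto
  have "A * mat_of_cols d (cs @ concat css) =
      mat_of_cols d (map (shv a) (cs @ concat css)) * four_block_mat ?B (0\<^sub>m ?n ?m) (0\<^sub>m ?m ?n) ?J"
  proof (rule mat_eq_by_append_vec[of _ d ?n ?m])
    fix u v :: "circ vec" assume uv: "u \<in> carrier_vec ?n" "v \<in> carrier_vec ?m"
    hence w: "u @\<^sub>v v \<in> carrier_vec (?n + ?m)" by simp
    have Bu: "?B *\<^sub>v u \<in> carrier_vec ?n" "?J *\<^sub>v v \<in> carrier_vec ?m"
      using mult_mat_vec_carrier[OF B uv(1)] mult_mat_vec_carrier[OF J uv(2)] by auto
    have "A * mat_of_cols d (cs @ concat css) *\<^sub>v (u @\<^sub>v v) =
        A *\<^sub>v (mat_of_cols d cs *\<^sub>v u + mat_of_cols d (concat css) *\<^sub>v v)"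
      unfolding assoc_mult_mat_vec[OF A V w] mat_of_cols_append_mult_vec[OF uv] ..
    also have "\<dots> = A *\<^sub>v (mat_of_cols d cs *\<^sub>v u) + A *\<^sub>v (mat_of_cols d (concat css) *\<^sub>v v)"
      using mult_mat_vec_carrier[OF c(1) uv(1)] mult_mat_vec_carrier[OF c(2) uv(2)]
      by (rule mult_add_distrib_mat_vec[OF A])
    also have "\<dots> = mat_of_cols d (map (shv a) cs) *\<^sub>v (?B *\<^sub>v u) +
        mat_of_cols d (map (shv a) (concat css)) *\<^sub>v (?J *\<^sub>v v)"
      unfolding assoc_mult_mat_vec[OF A c(1) uv(1), symmetric] assoc_mult_mat_vec[OF A c(2) uv(2),
          symmetric]
        ch IH assoc_mult_mat_vec[OF c(3) B uv(1)] assoc_mult_mat_vec[OF c(4) J uv(2)] ..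
    also have "\<dots> = mat_of_cols d (map (shv a) cs @ map (shv a) (concat css)) *\<^sub>v ((?B *\<^sub>v u) @\<^sub>v
        (?J *\<^sub>v v))"
      using Bu by (intro mat_of_cols_append_mult_vec[symmetric]) auto
    also have "(?B *\<^sub>v u) @\<^sub>v (?J *\<^sub>v v) = four_block_mat ?B (0\<^sub>m ?n ?m) (0\<^sub>m ?m ?n) ?J *\<^sub>v (u @\<^sub>v v)"
      by (rule mult_mat_vec_split[OF B J uv, symmetric])
    finally show "A * mat_of_cols d (cs @ concat css) *\<^sub>v (u @\<^sub>v v) =
      mat_of_cols d (map (shv a) (cs @ concat css)) * four_block_mat ?B (0\<^sub>m ?n ?m) (0\<^sub>m ?m ?n) ?J
          *\<^sub>v (u @\<^sub>v v)"
      unfolding assoc_mult_mat_vec[OF V' FB w] by simp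
  next
    show "A * mat_of_cols d (cs @ concat css) \<in> carrier_mat d (?n + ?m)" using A V by (rule
        mult_carrier_mat)
    show "mat_of_cols d (map (shv a) (cs @ concat css)) * four_block_mat ?B (0\<^sub>m ?n ?m) (0\<^sub>m ?m ?n) ?J
      \<in> carrier_mat d (?n + ?m)" using V' FB by (rule mult_carrier_mat)
  qed
  thus ?case unfolding JJ by simp
qed

lemma map_fst_pairs: "map fst (map (\<lambda>n. (n, c)) ns) = ns"
  by (induction ns) auto

lemma evm_jordan_matrix:
  "evm x (jordan_matrix (map (\<lambda>n. (n, 0)) ns)) = jordan_matrix (map (\<lambda>n. (n, 0)) ns)"
proof (induction ns)
  case Nil
  show ?case by (intro eq_matI) (auto simp: jordan_matrix_def)
next
  case (Cons n ns)
  have b: "evm x (jordan_block n 0) = jordan_block n 0" by (intro eq_matI) auto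
  have z: "evm x (0\<^sub>m k l) = 0\<^sub>m k l" for k l by (intro eq_matI) auto
  have s: "sum_list (map fst (map (\<lambda>n. (n, 0 :: circ)) ns)) = sum_list ns"
    "sum_list (map fst (map (\<lambda>n. (n, 0 :: complex)) ns)) = sum_list ns" by (simp_all add: o_def)
  have J: "(jordan_matrix (map (\<lambda>n. (n, 0)) ns) :: circ mat) \<in> carrier_mat (sum_list ns) (sum_list ns)"
    using jordan_matrix_carrier[of "map (\<lambda>n. (n, 0 :: circ)) ns"] unfolding s .
  show ?case
    unfolding list.map jordan_matrix_Cons s
    by (subst map_four_block_mat[OF jordan_block_carrier zero_carrier_mat zero_carrier_mat J])
      (simp add: b z Cons)
qed

text \<open>
A nilpotent Jordan matrix has one kernel direction for each block.
\<close>

lemma kernel_dim_jordan_matrix: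
  assumes "\<forall>n\<in>set ns. n > 0"
  shows "kernel_dim (jordan_matrix (map (\<lambda>n. (n, 0 :: complex)) ns)) = length ns"
proof -
  let ?J = "jordan_matrix (map (\<lambda>n. (n, 0 :: complex)) ns)"
  have J: "?J \<in> carrier_mat (sum_list (map fst (map (\<lambda>n. (n, 0 :: complex)) ns)))
      (sum_list (map fst (map (\<lambda>n. (n, 0 :: complex)) ns)))" by (rule jordan_matrix_carrier)
  have "char_matrix ?J 0 ^\<^sub>m 1 = ?J"
    using J by (auto simp: char_matrix_def intro!: eq_matI)
  hence "kernel_dim ?J = dim_gen_eigenspace ?J 0 1" by (simp add: dim_gen_eigenspace_def)
  also have "\<dots> = (\<Sum>n\<leftarrow>ns. min 1 n)"
    unfolding dim_gen_eigenspace_jordan_matrix by (simp add: filter_map o_def)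
  also have "\<dots> = length ns" using assms by (induction ns) auto
  finally show ?thesis .
qed

theorem theorem2:
  fixes d :: nat and \<alpha> :: real and A :: "real \<Rightarrow> complex mat"
  assumes "d \<ge> 1"
    and "A \<in> analytic_circle d (carrier_mat d d)"
    and "has_lyapunov_exponent d 1 \<alpha> A (-\<infinity>)"
  shows
    "(\<exists>U \<in> analytic_circle d (unitary_group d). \<exists>ns.
        block_sizes d ns \<and> length ns = nilpotency_degree d \<alpha> A \<and>
        (\<forall>x. strictly_upper_triangular (conj_cocycle \<alpha> A U x) \<and>
             strictly_block_upper_triangular ns (conj_cocycle \<alpha> A U x)))
     \<and>
     ((\<forall>n\<ge>1. \<exists>r. \<forall>x. vec_space.rank d (iterate d \<alpha> A n x) = r) \<longrightarrow>
      (\<exists>M \<in> analytic_circle d (general_linear_group d). \<exists>ns.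
        block_sizes d ns \<and>
        (\<forall>x. length ns = kernel_dim (A x) \<and>
             conj_cocycle \<alpha> A M x = jordan_matrix (map (\<lambda>n. (n, 0)) ns))))"
proof -
  obtain C where C: "C \<in> carrier_mat d d" and CA: "\<And>x. evm x C = A x"
    using analytic_circle_as_circ[OF assms(2)] by blast
  note it = iterate_eq_itc[OF C CA]
  have nil: "\<exists>n. itc \<alpha> C n = 0\<^sub>m d d"
    by (rule nilpotent_if_lyapunov_minus_infinity[OF C assms(1) it assms(3)])
  define p where "p = (LEAST n. itc \<alpha> C n = 0\<^sub>m d d)"
  have p: "itc \<alpha> C p = 0\<^sub>m d d" unfolding p_def using nil by (rule LeastI_ex)
  have deg: "nilpotency_degree d \<alpha> A = p"
    unfolding p_def by (rule nilpotency_degree_eq[OF C CA assms(1)])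
  have less: "itc \<alpha> C n \<noteq> 0\<^sub>m d d" if "n < p" for n
    using that unfolding p_def by (rule not_less_Least)
  show ?thesis
  proof (intro conjI impI)
    obtain U ns S where U: "U \<in> unitary_circ d" and ns: "length ns = p" "block_sizes d ns"
      and S: "S \<in> carrier_mat d d" "C * U = shm \<alpha> U * S"
      and su: "\<And>x. strictly_block_upper_triangular ns (evm x S)"
      using nilpotent_flag[OF C p less] by blast
    note Uc = unitary_circ_carrier[OF U]
    have conj: "conj_cocycle \<alpha> A (\<lambda>x. evm x U) x = evm x S" for x
      by (rule conj_cocycle_eq[OF C CA Uc adj_carrier[OF Uc] unitary_circ_adj(2)[OF U]
          unitary_circ_adj(1)[OF U] S])
    have "(\<lambda>x. evm x U) \<in> analytic_circle d (unitary_group d)"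
      using U by (intro circ_in_analytic_circle) (auto simp: unitary_circ_def)
    moreover have "strictly_upper_triangular (evm x S)" for x
      using su S(1) ns(2) by (intro strictly_block_upper_imp_strictly_upper[of _ d ns]) (auto
          simp: block_sizes_def)
    ultimately show "\<exists>U \<in> analytic_circle d (unitary_group d). \<exists>ns.
        block_sizes d ns \<and> length ns = nilpotency_degree d \<alpha> A \<and>
        (\<forall>x. strictly_upper_triangular (conj_cocycle \<alpha> A U x) \<and>
             strictly_block_upper_triangular ns (conj_cocycle \<alpha> A U x))"
      using ns su conj deg by (intro bexI[of _ "\<lambda>x. evm x U"] exI[of _ ns]) auto
  next
    assume "\<forall>n\<ge>1. \<exists>r. \<forall>x. vec_space.rank d (iterate d \<alpha> A n x) = r"
    hence cr: "const_ranks d \<alpha> C" unfolding const_ranks_def it .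
    obtain css where css: "chain_basis d \<alpha> C css"
      using jordan_chain_basis_exists[OF C p cr] by blast
    note cb = css[unfolded chain_basis_def]
    define ns where "ns = map length css"
    let ?M = "mat_of_cols d (concat css)"
    have M: "?M \<in> carrier_mat d d" using cb mat_of_cols_carrier(1)[of d "concat css"] by simp
    obtain W where W: "W \<in> carrier_mat d d" "?M * W = 1\<^sub>m d" "W * ?M = 1\<^sub>m d"
      using spanning_imp_inverse[of "concat css" d] cb by blast
    have ns: "block_sizes d ns"
      using cb by (auto simp: block_sizes_def ns_def jordan_chain_def length_concat)
    let ?J = "jordan_matrix (map (\<lambda>n. (n, 0 :: circ)) ns)"
    let ?Jc = "jordan_matrix (map (\<lambda>n. (n, 0 :: complex)) ns)"
    have sns: "sum_list ns = d" using ns unfolding block_sizes_def by (rule conjunct2)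
    have J: "?J \<in> carrier_mat d d" "?Jc \<in> carrier_mat d d"
      using jordan_matrix_carrier[of "map (\<lambda>n. (n, 0 :: circ)) ns"]
        jordan_matrix_carrier[of "map (\<lambda>n. (n, 0 :: complex)) ns"]
      by (simp_all only: map_fst_pairs sns)
    have eq: "C * ?M = shm \<alpha> ?M * ?J"
    proof -
      have c: "\<forall>cs \<in> set css. jordan_chain \<alpha> C cs" "set (concat css) \<subseteq> carrier_vec d"
        using cb by blast+
      show ?thesis unfolding shm_mat_of_cols[OF c(2)] ns_def by (rule jordan_chains_matrix[OF C c])
    qed
    have conj: "conj_cocycle \<alpha> A (\<lambda>x. evm x ?M) x = ?Jc" for x
      using conj_cocycle_eq[OF C CA M W J(1) eq] by (simp add: evm_jordan_matrix)
    have inv: "evm x ?M * evm x W = 1\<^sub>m d" "evm x W * evm x ?M = 1\<^sub>m d" for x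
      using arg_cong[OF W(2), of "evm x"] arg_cong[OF W(3), of "evm x"]
        ev_hom.mat_hom_mult[OF M W(1), of x] ev_hom.mat_hom_mult[OF W(1) M, of x]
      by (auto simp: ev_hom.mat_hom_one)
    have c: "evm x ?M \<in> carrier_mat d d" "evm x W \<in> carrier_mat d d" for x using M W(1) by auto
    have "(\<lambda>x. evm x ?M) \<in> analytic_circle d (general_linear_group d)"
    proof (rule circ_in_analytic_circle[OF M])
      fix x show "evm x ?M \<in> general_linear_group d"
        using c[of x] inv[of x] by (auto simp: general_linear_group_def invertible_mat_def
            inverts_mat_def square_mat.simps
            intro!: exI[of _ "evm x W"])
    qed
    moreover have "length ns = kernel_dim (A x)" for x
    proof -
      have Ac: "A x \<in> carrier_mat d d" using C by (auto simp flip: CA)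
      have "A x * evm x ?M = evm (x + \<alpha>) ?M * ?Jc"
        using arg_cong[OF eq, of "evm x"] ev_hom.mat_hom_mult[OF C M, of x]
          ev_hom.mat_hom_mult[of "shm \<alpha> ?M" d d ?J d x] M J CA by (simp add: evm_jordan_matrix)
      hence "A x * evm x ?M * evm x W = evm (x + \<alpha>) ?M * ?Jc * evm x W" by simp
      hence AJ: "A x = evm (x + \<alpha>) ?M * ?Jc * evm x W"
        using assoc_mult_mat[OF Ac c] inv[of x] Ac by simp
      have "kernel.dim d (A x) = kernel.dim d ?Jc"
        unfolding AJ mat_kernel_dim_mult_eq_right[OF mult_carrier_mat[OF c(1) J(2)] c(2,1) inv(2)]
          mat_kernel_mult_eq[OF J(2) c(1,2) inv(2)] ..
      hence "kernel_dim (A x) = kernel_dim ?Jc"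
        unfolding kernel_dim_def by (simp only: carrier_matD[OF Ac] carrier_matD[OF J(2)])
      also have "\<dots> = length ns" using ns by (intro kernel_dim_jordan_matrix) (auto simp:
          block_sizes_def)
      finally show ?thesis by simp
    qed
    ultimately show "\<exists>M \<in> analytic_circle d (general_linear_group d). \<exists>ns.
        block_sizes d ns \<and>
        (\<forall>x. length ns = kernel_dim (A x) \<and>
             conj_cocycle \<alpha> A M x = jordan_matrix (map (\<lambda>n. (n, 0)) ns))"
      using ns conj by (intro bexI[of _ "\<lambda>x. evm x ?M"] exI[of _ ns]) auto
  qed
qed

end
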